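(* Consider the VRA-GT iteration (defined in the context) for minimizing $f(x)=\frac1n\sum_{j=1}^nf_j(x)$ over $\mathbb{R}^d$. Suppose that: (a) the objective function assumption and the weight matrix and network assumption stated in the context hold; (b) $f$ is $\mu$-strongly convex, with minimizer $x^*$; the noise variables $\{\xi_{i,k}\}$ and $\{\zeta_{i,k}\}$ are zero-mean, mutually independent and independent of the initial values; and there exists a constant $\sigma$ such that $\mathbb{E}[\|\zeta_{i,t}\|^2]\le\sigma^2$ and $\mathbb{E}[\|\xi_{i,t}\|^2]\le\sigma^2$ for all $i,t$; (c) $0<\gamma<1$, $\eta_k=\frac{a_1}{k^{\eta}}$, $\beta_k=\frac{a_2}{k^{\beta}}$, $\alpha_k=\frac{a_3}{k^{\alpha}}$, where $a_1,a_2,a_3\in(0,1]$, $\eta,\alpha,\beta\in(0.5,1)$ and $\alpha>\frac{1+\beta}{2}$. Then there is a constant $c_*>0$ such that, with $$v_{k+1}=\|\mathbf{y}'_{k+1}-v\bar y'_{k+1}\|_C^2+\|\mathbf{x}_{k+1}-\mathbf{1}\bar x_{k+1}\|_R^2+c_*\|\bar x_{k+1}-x^*\|^2,$$ one has $$\mathbb{E}[v_{k+1}]\le\mathcal{O}\left(\frac{1}{k^{\min\{2\beta-\alpha,\ \beta+\eta-\alpha\}}}\right).$$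
   Context: Let $\mathcal{V}=\{1,\dots,n\}$. For a nonnegative matrix $\mathbf{W}=\{w_{ij}\}\in\mathbb{R}^{n\times n}$, the induced directed graph $\mathcal{G}_{\mathbf{W}}=(\mathcal{V},\mathcal{E}_{\mathbf{W}})$ has $(i,j)\in\mathcal{E}_{\mathbf{W}}$ iff $w_{ij}>0$, where the ordered pair $(i,j)$ means that node $j$ can send information to node $i$ (a directed edge from $j$ to $i$); $\mathcal{N}^{\rm in}_{\mathbf{W},i}=\{j\neq i: w_{ij}>0\}$. Objective function assumption: for every $i\in\mathcal{V}$, $f_i:\mathbb{R}^d\to\mathbb{R}$ is convex and differentiable and $\|\nabla f_i(x)-\nabla f_i(y)\|\le L\|x-y\|$ for all $x,y\in\mathbb{R}^d$. Weight matrix and network assumption: (i) $\mathbf{R}=\{R_{ij}\}\in\mathbb{R}^{n\times n}$ is nonnegative with $\mathbf{R}\mathbf{1}=\mathbf{1}$, $\mathbf{C}=\{C_{ij}\}\in\mathbb{R}^{n\times n}$ is nonnegative with $\mathbf{1}^\intercal\mathbf{C}=\mathbf{1}^\intercal$, and the diagonal entries of $\mathbf{R}$ and $\mathbf{C}$ are positive. (ii) The graphs $\mathcal{G}_{\mathbf{R}}$ and $\mathcal{G}_{\mathbf{C}^\intercal}$ each contain at least one (directed) spanning tree, and at least one node is a root of spanning trees for both, i.e. $\mathcal{R}_{\mathbf{R}}\cap\mathcal{R}_{\mathbf{C}^\intercal}\ne\emptyset$, where $\mathcal{R}_{\mathbf{R}}$ (resp. $\mathcal{R}_{\mathbf{C}^\intercal}$)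 is the set of roots of all possible spanning trees of $\mathcal{G}_{\mathbf{R}}$ (resp. $\mathcal{G}_{\mathbf{C}^\intercal}$). Under this assumption there are nonnegative vectors $u,v\in\mathbb{R}^n$ with $u^\intercal\mathbf{R}=u^\intercal$, $\mathbf{C}v=v$, $u^\intercal\mathbf{1}=v^\intercal\mathbf{1}=n$, and $u^\intercal v>0$. VRA-GT iteration: given initial values $x_{i,1}$ and $s_{i,1}=z_{i,1}$ in $\mathbb{R}^d$ ($i\in\mathcal{V}$), with finite second moments if random, for $k=1,2,\dots$ and every $i\in\mathcal{V}$, $$s_{i,k+1}=(1-\gamma)s_{i,k}+\gamma z_{i,k}+\nabla f_i(x_{i,k}),$$ $$x_{i,k+1}=(1-\beta_k)x_{i,k}+\beta_k\Big(\sum_{j=1}^nR_{ij}x_{j,k}+\sum_{j\in\mathcal{N}^{\rm in}_{\mathbf{R},i}}R_{ij}\xi_{j,k}\Big)-\alpha_k(s_{i,k+1}-s_{i,k}),$$ $$z_{i,k+1}=(1-\eta_k)z_{i,k}+\eta_k\Big(\sum_{j=1}^nC_{ij}\frac{s_{j,k+1}-(1-\eta_k)s_{j,k}}{\eta_k}+\sum_{j\in\mathcal{N}^{\rm in}_{\mathbf{C},i}}\zeta_{j,k+1}\Big),$$ where $\xi_{j,k},\zeta_{j,k}$ are random vectors in $\mathbb{R}^d$ (information-sharing noise). Notation: $\mathbf{x}_k=[x_{1,k},\dots,x_{n,k}]^\intercal\in\mathbb{R}^{n\times d}$, $\mathbf{g}_k=[\nabla f_1(x_{1,k}),\dots,\nabla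 f_n(x_{n,k})]^\intercal$, $\mathbf{C}_\gamma=(1-\gamma)\mathbf{I}+\gamma\mathbf{C}$, $\mathbf{R}_k=(1-\beta_k)\mathbf{I}+\beta_k\mathbf{R}$. The auxiliary sequence is $\mathbf{y}'_1=\mathbf{g}_1$, $\mathbf{y}'_{k+1}=\mathbf{C}_\gamma\mathbf{y}'_k+\mathbf{g}_{k+1}-\mathbf{g}_k$. Weighted averages: $\bar x_k=\frac{u^\intercal}{n}\mathbf{x}_k$ and $\bar y'_k=\frac{\mathbf{1}^\intercal}{n}\mathbf{y}'_k$, row vectors, identified with vectors of $\mathbb{R}^d$ when needed. Norms: $\hat{\mathbf{R}},\hat{\mathbf{C}}\in\mathbb{R}^{n\times n}$ are fixed invertible matrices such that, with the vector norms $\|x\|_R=\|\hat{\mathbf{R}}x\|$, $\|x\|_C=\|\hat{\mathbf{C}}x\|$ on $\mathbb{R}^n$ and the induced matrix norms, $\|\mathbf{C}_\gamma-\frac{v\mathbf{1}^\intercal}{n}\|_C<1-\gamma\rho_C$ and $\|\mathbf{R}_k-\frac{\mathbf{1}u^\intercal}{n}\|_R\le1-\beta_k\rho_R$ for all $k$, with constants $\rho_C,\rho_R\in(0,1]$ (such matrices exist under the weight matrix and network assumption). For $\mathbf{x}\in\mathbb{R}^{n\times d}$ with columns $\mathbf{x}^{(1)},\dots,\mathbf{x}^{(d)}$, $\|\mathbf{x}\|_W=\big(\sum_{l=1}^d\|\mathbf{x}^{(l)}\|_W^2\big)^{1/2}$ for $W\in\{R,C\}$. For positive sequences, $a_k=\mathcal{O}(b_k)$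 (equivalently $a_k\le\mathcal{O}(b_k)$) means there is $c>0$ with $a_k\le c\,b_k$ for all $k$. *)

theory Defs
  imports "HOL-Probability.Probability"
begin

section \<open>Objective functions\<close>

definition grad :: "('a::real_inner \<Rightarrow> real) \<Rightarrow> 'a \<Rightarrow> 'a" where
  "grad f x = (THE D. GDERIV f x :> D)"

lemma GDERIV_grad:
  fixes f :: "'a::euclidean_space \<Rightarrow> real"
  assumes "f differentiable (at x)"
  shows "GDERIV f x :> grad f x"
proof -
  obtain f' where f': "(f has_derivative f') (at x)"
    using assms by (auto simp: differentiable_def)
  then interpret linear f'
    by (rule has_derivative_linear)
  define D where "D = (\<Sum>b\<in>Basis. f' b *\<^sub>R b)"
  have "f' h = inner h D" for h
  proof -
    have "f' h = f' (\<Sum>b\<in>Basis. inner h b *\<^sub>R b)"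
      by (simp add: euclidean_representation)
    also have "\<dots> = inner h D"
      by (simp add: D_def sum scale inner_sum_right mult.commute)
    finally show ?thesis .
  qed
  then have "f' = (\<lambda>h. inner h D)"
    by (rule ext)
  with f' have D: "GDERIV f x :> D"
    unfolding gderiv_def by metis
  moreover have "D' = D" if "GDERIV f x :> D'" for D'
  proof -
    have "(\<lambda>h. inner h D') = (\<lambda>h. inner h D)"
      using D that unfolding gderiv_def by (rule has_derivative_unique[rotated])
    then have "\<forall>h. inner h D' = inner h D"
      by (rule fun_cong[THEN allI])
    then show ?thesis
      using vector_eq_ldot[of D' D] by blast
  qed
  ultimately show ?thesis
    unfolding grad_def by (rule theI)
qed

definition strongly_convex :: "real \<Rightarrow> ('a::real_inner \<Rightarrow> real) \<Rightarrow> bool" where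
  "strongly_convex \<mu> f \<longleftrightarrow> 0 < \<mu> \<and>
     (\<forall>x y. \<forall>t\<in>{0..1}.
        f ((1 - t) *\<^sub>R x + t *\<^sub>R y)
          \<le> (1 - t) * f x + t * f y - \<mu> / 2 * t * (1 - t) * (norm (x - y))\<^sup>2)"

section \<open>Communication graphs\<close>

text \<open>
  A pair \<open>(i, j)\<close> is the directed edge from \<open>j\<close> to \<open>i\<close> (node \<open>j\<close> sends to node \<open>i\<close>), so that a
  directed path from \<open>r\<close> to \<open>i\<close> is witnessed by \<open>(i, r) \<in> E\<^sup>*\<close>.
\<close>

definition induced_edges :: "real^'n^'n \<Rightarrow> ('n \<times> 'n) set" where
  "induced_edges W = {(i, j). W $ i $ j > 0}"

definition in_nbrs :: "real^'n^'n \<Rightarrow> 'n \<Rightarrow> 'n set" where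
  "in_nbrs W i = {j. j \<noteq> i \<and> W $ i $ j > 0}"

definition is_spanning_tree :: "('n \<times> 'n) set \<Rightarrow> 'n \<Rightarrow> ('n \<times> 'n) set \<Rightarrow> bool" where
  "is_spanning_tree E r T \<longleftrightarrow> T \<subseteq> E \<and>
     (\<forall>j. (r, j) \<notin> T) \<and>
     (\<forall>i. i \<noteq> r \<longrightarrow> (\<exists>!j. (i, j) \<in> T)) \<and>
     (\<forall>i. (i, r) \<in> T\<^sup>*)"

definition tree_roots :: "real^'n^'n \<Rightarrow> 'n set" where
  "tree_roots W = {r. \<exists>T. is_spanning_tree (induced_edges W) r T}"

section \<open>Matrices and norms\<close>

text \<open>
  An \<open>n \<times> d\<close> matrix whose rows are indexed by the nodes is an element of \<open>real^'d^'n\<close>; row \<open>i\<close>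
  of \<open>X\<close> is \<open>X $ i\<close>. The all-ones vector is \<open>1\<close>.
\<close>

definition outer :: "real^'m \<Rightarrow> real^'p \<Rightarrow> real^'p^'m" where
  "outer a b = (\<chi> i j. a $ i * b $ j)"

definition wnorm :: "real^'n^'n \<Rightarrow> real^'n \<Rightarrow> real" where
  "wnorm H x = norm (H *v x)"

text \<open>As in \<^const>\<open>onorm\<close>, the term for \<open>x = 0\<close> is \<open>0 / 0 = 0\<close> and does not affect the supremum.\<close>

definition wnorm_op :: "real^'n^'n \<Rightarrow> real^'n^'n \<Rightarrow> real" where
  "wnorm_op H A = (SUP x. wnorm H (A *v x) / wnorm H x)"

definition wnorm_mat :: "real^'n^'n \<Rightarrow> real^'d^'n \<Rightarrow> real" where
  "wnorm_mat H X = sqrt (\<Sum>l\<in>UNIV. (wnorm H (column l X))\<^sup>2)"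

definition mix :: "real \<Rightarrow> real^'n^'n \<Rightarrow> real^'n^'n" where
  "mix t W = (1 - t) *\<^sub>R mat 1 + t *\<^sub>R W"

definition wavg :: "real^'n \<Rightarrow> real^'d^'n \<Rightarrow> real^'d" where
  "wavg w X = (1 / real CARD('n)) *\<^sub>R (w v* X)"

definition stacked_grad :: "('n \<Rightarrow> real^'d \<Rightarrow> real) \<Rightarrow> real^'d^'n \<Rightarrow> real^'d^'n" where
  "stacked_grad f X = (\<chi> i. grad (f i) (X $ i))"

section \<open>The VRA-GT iteration\<close>

text \<open>
  All sequences start at index \<open>1\<close>; their values at \<open>0\<close> are irrelevant. The arguments are
  sequences of \<open>n \<times> d\<close> matrices, i.e.\ one realisation of the noise and of the iterates.
\<close>

definition vra_gt ::
  "('n \<Rightarrow> real^'d \<Rightarrow> real) \<Rightarrow> real^'n^'n \<Rightarrow> real^'n^'n \<Rightarrow> real \<Rightarrow>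
   (nat \<Rightarrow> real) \<Rightarrow> (nat \<Rightarrow> real) \<Rightarrow> (nat \<Rightarrow> real) \<Rightarrow>
   (nat \<Rightarrow> real^'d^'n) \<Rightarrow> (nat \<Rightarrow> real^'d^'n) \<Rightarrow>
   (nat \<Rightarrow> real^'d^'n) \<Rightarrow> (nat \<Rightarrow> real^'d^'n) \<Rightarrow> (nat \<Rightarrow> real^'d^'n) \<Rightarrow> bool" where
  "vra_gt f R C \<gamma> \<alpha> \<beta> \<eta> \<xi> \<zeta> x s z \<longleftrightarrow>
     z 1 = s 1 \<and>
     (\<forall>k\<ge>1. \<forall>i.
        s (k+1) $ i = (1 - \<gamma>) *\<^sub>R s k $ i + \<gamma> *\<^sub>R z k $ i + grad (f i) (x k $ i) \<and>
        x (k+1) $ i = (1 - \<beta> k) *\<^sub>R x k $ i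
          + \<beta> k *\<^sub>R ((\<Sum>j\<in>UNIV. R $ i $ j *\<^sub>R x k $ j)
                    + (\<Sum>j\<in>in_nbrs R i. R $ i $ j *\<^sub>R \<xi> k $ j))
          - \<alpha> k *\<^sub>R (s (k+1) $ i - s k $ i) \<and>
        z (k+1) $ i = (1 - \<eta> k) *\<^sub>R z k $ i
          + \<eta> k *\<^sub>R ((\<Sum>j\<in>UNIV. C $ i $ j *\<^sub>R
                        ((s (k+1) $ j - (1 - \<eta> k) *\<^sub>R s k $ j) /\<^sub>R \<eta> k))
                    + (\<Sum>j\<in>in_nbrs C i. \<zeta> (k+1) $ j)))"

definition aux_tracker ::
  "('n \<Rightarrow> real^'d \<Rightarrow> real) \<Rightarrow> real^'n^'n \<Rightarrow> real \<Rightarrow>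
   (nat \<Rightarrow> real^'d^'n) \<Rightarrow> (nat \<Rightarrow> real^'d^'n) \<Rightarrow> bool" where
  "aux_tracker f C \<gamma> x y \<longleftrightarrow>
     y 1 = stacked_grad f (x 1) \<and>
     (\<forall>k\<ge>1. y (k+1) = mix \<gamma> C ** y k + stacked_grad f (x (k+1)) - stacked_grad f (x k))"

definition noise_index :: "(('n \<times> nat) + ('n \<times> nat)) set" where
  "noise_index = (UNIV \<times> {1..}) <+> (UNIV \<times> {1..})"

definition noise_family ::
  "(nat \<Rightarrow> 'a \<Rightarrow> real^'d^'n) \<Rightarrow> (nat \<Rightarrow> 'a \<Rightarrow> real^'d^'n) \<Rightarrow>
   ('n \<times> nat) + ('n \<times> nat) \<Rightarrow> 'a \<Rightarrow> real^'d" where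
  "noise_family \<xi> \<zeta> a \<omega> =
     (case a of Inl (i, k) \<Rightarrow> \<xi> k \<omega> $ i | Inr (i, k) \<Rightarrow> \<zeta> k \<omega> $ i)"

text \<open>
  The noise vectors \<open>\<xi>\<^sub>i\<^sub>,\<^sub>k\<close>, \<open>\<zeta>\<^sub>i\<^sub>,\<^sub>k\<close> (\<open>k \<ge> 1\<close>) form one mutually independent family, and
  this family is jointly independent of the tuple of all initial values; the initial values may
  depend on each other. The library's \<open>indep_var\<close> needs both variables to have the same type, hence
  the generated sigma-algebras.
\<close>

definition independent_noise ::
  "'a measure \<Rightarrow> (nat \<Rightarrow> 'a \<Rightarrow> real^'d^'n) \<Rightarrow> (nat \<Rightarrow> 'a \<Rightarrow> real^'d^'n) \<Rightarrow>
   ('a \<Rightarrow> real^'d^'n) \<Rightarrow> ('a \<Rightarrow> real^'d^'n) \<Rightarrow> bool" where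
  "independent_noise M \<xi> \<zeta> x1 s1 \<longleftrightarrow>
     prob_space.indep_vars M (\<lambda>_. borel) (noise_family \<xi> \<zeta>) noise_index \<and>
     (\<lambda>\<omega>. (x1 \<omega>, s1 \<omega>)) \<in> borel_measurable M \<and>
     prob_space.indep_set M
       (sets (vimage_algebra (space M) (\<lambda>\<omega>. (x1 \<omega>, s1 \<omega>)) borel))
       (sets (vimage_algebra (space M)
          (\<lambda>\<omega>. restrict (\<lambda>a. noise_family \<xi> \<zeta> a \<omega>) noise_index)
          (PiM noise_index (\<lambda>_. borel))))"

end

theory Submission
  imports Defs "HOL-Real_Asymp.Real_Asymp"
begin

text \<open>
  Put \<open>e\<^sub>k = z\<^sub>k - C s\<^sub>k\<close>. Eliminating \<open>z\<close> gives \<open>e\<^sub>k\<^sub>+\<^sub>1 = (1 - \<eta>\<^sub>k) e\<^sub>k + \<eta>\<^sub>k N \<zeta>\<^sub>k\<^sub>+\<^sub>1\<close>, so the sharing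
  error averages out at rate \<open>E |e\<^sub>k|\<^sup>2 = O(k powr -\<eta>)\<close>. The tracking variable
  is \<open>s\<^sub>k\<^sub>+\<^sub>1 - s\<^sub>k = y'\<^sub>k + \<gamma> e\<^sub>k + h\<^sub>k\<close>, where \<open>h\<close> has zero column sums and is driven through the
  contraction \<open>C\<^sub>\<gamma> - v1\<^sup>T/n\<close> by \<open>e\<close> only; hence \<open>D\<^sub>k = \<gamma> e\<^sub>k + h\<^sub>k\<close> has the same rate. So
  \<open>(x, y')\<close> follows a noiseless-looking recursion perturbed by \<open>\<alpha>\<^sub>k D\<^sub>k\<close> and by \<open>\<beta>\<^sub>k\<close> times the noise
  \<open>\<xi>\<^sub>k\<close>, which is independent of the past. Its tracking, consensus and optimality errors
  contract with factors \<open>1 - \<gamma> \<rho>\<^sub>C\<close>, \<open>1 - \<beta>\<^sub>k \<rho>\<^sub>R\<close> and \<open>1 - c \<alpha>\<^sub>k\<close>; since \<open>\<alpha>\<^sub>k / \<beta>\<^sub>k\<close> and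
  \<open>\<beta>\<^sub>k\<close> tend to \<open>0\<close>, the unweighted sum of their squares satisfies
  \<open>E V\<^sub>k\<^sub>+\<^sub>1 \<le> (1 - c \<alpha>\<^sub>k) E V\<^sub>k + O(\<alpha>\<^sub>k k powr -\<eta> + \<beta>\<^sub>k\<^sup>2)\<close> for large \<open>k\<close>. This yields the rate
  \<open>k powr -min \<eta> (2\<beta> - \<alpha>)\<close>, at least as good as the claimed one because \<open>\<beta> < \<alpha>\<close>, and it works
  with \<open>c\<^sub>* = 1\<close>.
\<close>

section \<open>Scalar recursions\<close>

text \<open>From \<open>ln (1 + 1/k) \<le> 1/k\<close> and \<open>1 + t \<le> exp t\<close>: the
  factor \<open>1 - \<theta>/k\<close> is at most \<open>(1 + 1/k) powr (-\<theta>)\<close>, which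
  is the ratio of consecutive terms of \<open>1 / k powr \<theta>\<close>.\<close>

lemma powr_neg_Suc_ge:
  fixes \<theta> :: real
  assumes "0 \<le> \<theta>" "k \<ge> (1::nat)"
  shows "(1 - \<theta> / real k) / real k powr \<theta> \<le> 1 / real (Suc k) powr \<theta>"
proof -
  have k: "real k > 0" using assms by simp
  have "1 - \<theta> / real k \<le> 1 - \<theta> * ln (1 + 1 / real k)"
    using ln_add_one_self_le_self[of "1 / real k"] assms mult_left_mono[of "ln (1 + 1 / real k)" "1 / real k" \<theta>]
    by (simp)
  also have "\<dots> \<le> exp (- (\<theta> * ln (1 + 1 / real k)))"
    using exp_ge_add_one_self[of "- (\<theta> * ln (1 + 1 / real k))"] by simp
  also have "\<dots> = (1 + 1 / real k) powr (-\<theta>)"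
    using k by (simp add: powr_def add_nonneg_eq_0_iff)
  also have "1 + 1 / real k = real (Suc k) / real k"
    using k by (simp add: field_simps)
  also have "\<dots> powr (-\<theta>) = real k powr \<theta> / real (Suc k) powr \<theta>"
    using k by (simp add: powr_divide powr_minus field_simps)
  finally show ?thesis
    using k by (simp add: divide_simps mult.commute)
qed

text \<open>
  A discrete Gronwall bound in the style of Chung: the ansatz \<open>D / k powr \<theta>\<close> loses a factor
  \<open>1 - \<theta> / k\<close> per step, which is eventually dominated by the contraction \<open>1 - c / k powr a\<close>
  because \<open>a < 1\<close>.
\<close>

lemma chung_rate:
  fixes w :: "nat \<Rightarrow> real"
  assumes rec: "\<And>k. k \<ge> K \<Longrightarrow> w (Suc k) \<le> (1 - c / real k powr a) * w k + b / real k powr (a + \<theta>)"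
    and c: "0 < c" "c \<le> 1" and a: "0 \<le> a" "a < 1" and \<theta>: "0 \<le> \<theta>" and b: "0 \<le> b"
  shows "\<exists>D>0. \<forall>k\<ge>1. w k \<le> D / real k powr \<theta>"
proof -
  have "((\<lambda>k::nat. \<theta> * real k powr (a - 1)) \<longlongrightarrow> 0) at_top"
    using a by real_asymp
  then have "eventually (\<lambda>k. \<theta> * real k powr (a - 1) < c / 2) at_top"
    using c by (intro order_tendstoD) auto
  then obtain K0 where K0: "\<And>k. k \<ge> K0 \<Longrightarrow> \<theta> * real k powr (a - 1) < c / 2"
    unfolding eventually_at_top_linorder by auto
  define K1 where "K1 = Max {K, K0, 1}"
  \<comment> \<open>The summand \<open>2 * b / c\<close> lets the forcing cost at most half of the
    contraction, the finite sum covers the indices up to \<open>K1\<close>, and the \<open>1\<close>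
    keeps \<open>D\<close> positive.\<close>
  define D where "D = 2 * b / c + (\<Sum>k\<le>K1. \<bar>w k\<bar> * real k powr \<theta>) + 1"
  have S: "0 \<le> (\<Sum>k\<le>K1. \<bar>w k\<bar> * real k powr \<theta>)" by (intro sum_nonneg) auto
  have D: "D > 0" "2 * b / c \<le> D"
    using S b c by (auto simp: D_def intro!: add_nonneg_pos add_nonneg_nonneg)
  have small: "w k \<le> D / real k powr \<theta>" if "1 \<le> k" "k \<le> K1" for k
  proof -
    have "w k * real k powr \<theta> \<le> \<bar>w k\<bar> * real k powr \<theta>"
      by (intro mult_right_mono) auto
    also have "\<dots> \<le> (\<Sum>k\<le>K1. \<bar>w k\<bar> * real k powr \<theta>)"
      using that by (intro member_le_sum) auto
    also have "\<dots> \<le> D" using b c by (simp add: D_def)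
    finally show ?thesis using that by (simp add: field_simps)
  qed
  have "w k \<le> D / real k powr \<theta>" if "k \<ge> K1" for k
    using that
  proof (induction k rule: dec_induct)
    case base
    then show ?case by (intro small) (auto simp: K1_def)
  next
    case (step k)
    have k: "k \<ge> 1" "k \<ge> K" "k \<ge> K0" using step by (auto simp: K1_def)
    define p where "p = real k powr a"
    define q where "q = real k powr \<theta>"
    have p: "p \<ge> 1" using k a by (auto simp: p_def ge_one_powr_ge_zero)
    have q: "q > 0" using k by (simp add: q_def)
    have "\<theta> / real k = \<theta> * real k powr (a - 1) / p"
      using k by (simp add: p_def powr_diff)
    also have "\<dots> \<le> (c / 2) / p"
      using K0[OF k(3)] p by (intro divide_right_mono) auto
    finally have t: "\<theta> / real k \<le> c / (2 * p)" by simp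
    have "w (Suc k) \<le> (1 - c / p) * w k + b / (p * q)"
      using rec[OF k(2)] by (simp add: p_def q_def powr_add)
    also have "\<dots> \<le> (1 - c / p) * (D / q) + (c * D / 2) / (p * q)"
    proof (intro add_mono mult_left_mono divide_right_mono)
      show "0 \<le> 1 - c / p" using c p by (simp add: field_simps)
      show "b \<le> c * D / 2" using D(2) c by (simp add: field_simps)
    qed (use step p q in \<open>auto simp: q_def\<close>)
    \<comment> \<open>Half of the contraction has absorbed the forcing; the other half pays for the
      shrinking of the ansatz.\<close>
    also have "\<dots> = D * ((1 - c / (2 * p)) / q)"
      using p q by (simp add: field_simps)
    also have "\<dots> \<le> D * ((1 - \<theta> / real k) / q)"
      using t D q by (intro mult_left_mono divide_right_mono) auto
    also have "\<dots> \<le> D * (1 / real (Suc k) powr \<theta>)"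
      unfolding q_def using D k \<theta> by (intro mult_left_mono powr_neg_Suc_ge) auto
    finally show ?case by simp
  qed
  with small D show ?thesis by (metis nle_le)
qed

text \<open>Convexity of the square at the convex combination of \<open>a\<close> and
  \<open>b / t\<close>; the gap is an explicit square with a nonnegative factor. It turns a
  contraction of norms into one of squares, at the price \<open>1 / t\<close> on the
  perturbation.\<close>

lemma square_convex_split:
  fixes a b t :: real
  assumes "0 < t" "t \<le> 1"
  shows "((1 - t) * a + b)\<^sup>2 \<le> (1 - t) * a\<^sup>2 + b\<^sup>2 / t"
proof -
  have "(1 - t) * a\<^sup>2 + b\<^sup>2 / t - ((1 - t) * a + b)\<^sup>2 = (1 - t) * (a * t - b)\<^sup>2 / t"
    using assms by (simp add: field_simps power2_eq_square)
  moreover have "\<dots> \<ge> 0" using assms by auto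
  ultimately show ?thesis by linarith
qed

lemma square_affine_le:
  fixes a b r t :: real
  assumes "0 < t" "t \<le> 1" "0 \<le> r" "r \<le> (1 - t) * a + b"
  shows "r\<^sup>2 \<le> (1 - t) * a\<^sup>2 + b\<^sup>2 / t"
  using square_convex_split[of t a b] power_mono[of r "(1 - t) * a + b" 2] assms by linarith

text \<open>Cauchy-Schwarz for six terms, the longest sum in \<open>lyapunov_coupling\<close>;
  shorter ones are padded with zeros there.\<close>

lemma sum_squares_bound:
  fixes a b c d e g :: real
  shows "(a + b + c + d + e + g)\<^sup>2 \<le> 6 * (a\<^sup>2 + b\<^sup>2 + c\<^sup>2 + d\<^sup>2 + e\<^sup>2 + g\<^sup>2)"
proof -
  have "6 * (a\<^sup>2 + b\<^sup>2 + c\<^sup>2 + d\<^sup>2 + e\<^sup>2 + g\<^sup>2) - (a + b + c + d + e + g)\<^sup>2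
    = (a-b)\<^sup>2 + (a-c)\<^sup>2 + (a-d)\<^sup>2 + (a-e)\<^sup>2 + (a-g)\<^sup>2 + (b-c)\<^sup>2 + (b-d)\<^sup>2 + (b-e)\<^sup>2 + (b-g)\<^sup>2
     + (c-d)\<^sup>2 + (c-e)\<^sup>2 + (c-g)\<^sup>2 + (d-e)\<^sup>2 + (d-g)\<^sup>2 + (e-g)\<^sup>2"
    by (simp add: power2_eq_square algebra_simps)
  also have "\<dots> \<ge> 0" by (intro add_nonneg_nonneg zero_le_power2)
  finally show ?thesis by linarith
qed

text \<open>
  The coupling of tracking error \<open>p\<close>, consensus error \<open>q\<close> and optimality error \<open>r\<close> is harmless
  once \<open>\<alpha> / \<beta>\<close> and \<open>\<beta>\<close> are small, so the unweighted sum of squares is a Lyapunov function.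
\<close>

lemma lyapunov_coupling:
  fixes c \<kappa> \<alpha> \<beta> p q r \<delta> \<nu> p' q' r' :: real
  assumes c: "0 < c" "c \<le> 1" and \<kappa>: "1 \<le> \<kappa>"
    and pos: "0 \<le> p" "0 \<le> q" "0 \<le> r" "0 \<le> \<delta>" "0 \<le> \<nu>" "0 \<le> p'" "0 \<le> q'" "0 \<le> r'"
    and \<alpha>: "0 < \<alpha>" "\<alpha> \<le> c\<^sup>2 / (48 * \<kappa>\<^sup>2) * \<beta>" and \<beta>: "0 < \<beta>" "\<beta> \<le> c\<^sup>2 / (48 * \<kappa>\<^sup>2)"
    and p': "p' \<le> (1 - c) * p + \<kappa> * (\<beta> * q + \<alpha> * (p + q + r + \<delta>) + \<beta> * \<nu>)"
    and q': "q' \<le> (1 - \<beta> * c) * q + \<alpha> * \<kappa> * (p + q + r + \<delta>)"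
    and r': "r' \<le> (1 - \<alpha> * c) * r + \<alpha> * \<kappa> * (p + q + \<delta>)"
  shows "p'\<^sup>2 + q'\<^sup>2 + r'\<^sup>2
    \<le> (1 - \<alpha> * c / 2) * (p\<^sup>2 + q\<^sup>2 + r\<^sup>2) + 18 * \<kappa>\<^sup>2 / c * (\<alpha> * \<delta>\<^sup>2 + \<beta>\<^sup>2 * \<nu>\<^sup>2)"
proof -
  \<comment> \<open>\<open>m\<close> collects the 6 of Cauchy-Schwarz, the coupling
    \<open>\<kappa>\<^sup>2\<close> and the price \<open>1 / c\<close> of squaring;
    \<open>\<epsilon>\<close> is chosen to make \<open>m * \<epsilon> = c / 8\<close>.\<close>
  define \<epsilon> where "\<epsilon> = c\<^sup>2 / (48 * \<kappa>\<^sup>2)"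
  define m where "m = 6 * \<kappa>\<^sup>2 / c"
  have \<kappa>2: "\<kappa>\<^sup>2 \<ge> 1" using \<kappa> by simp
  have c2: "c\<^sup>2 \<le> 1" using c by (simp add: power_le_one)
  have \<epsilon>: "0 < \<epsilon>" "\<epsilon> \<le> 1" "m * \<epsilon> = c / 8"
    using c c2 \<kappa>2 by (auto simp: \<epsilon>_def m_def field_simps power2_eq_square)
  have m: "m > 0" using c \<kappa> by (simp add: m_def)
  have \<alpha>\<epsilon>: "\<alpha> \<le> \<epsilon> * \<beta>" and \<beta>\<epsilon>: "\<beta> \<le> \<epsilon>" using \<alpha> \<beta> by (auto simp: \<epsilon>_def)
  have \<beta>1: "\<beta> \<le> 1" using \<beta>\<epsilon> \<epsilon> by linarith
  have \<alpha>\<beta>: "\<alpha> \<le> \<beta>" using \<alpha>\<epsilon> \<epsilon> \<beta> mult_left_le_one_le[of \<beta> \<epsilon>] by linarith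
  \<comment> \<open>Squaring the slowly contracting \<open>q\<close> costs
    \<open>1 / (\<beta> * c)\<close> and leaves \<open>\<alpha>\<^sup>2 / \<beta>\<close>, still a
    small multiple of \<alpha>.\<close>
  have A1: "\<alpha>\<^sup>2 / \<beta> \<le> \<epsilon> * \<alpha>"
    using mult_left_mono[OF \<alpha>\<epsilon>, of \<alpha>] \<alpha> \<beta> by (simp add: field_simps power2_eq_square)
  have "\<alpha>\<^sup>2 * 1 \<le> \<alpha>\<^sup>2 / \<beta>" using \<beta> \<beta>1 mult_left_mono[of \<beta> 1 "\<alpha>\<^sup>2"] by (simp add: field_simps)
  then have A2: "\<alpha>\<^sup>2 \<le> \<epsilon> * \<alpha>" using A1 by simp
  have A3: "\<beta>\<^sup>2 \<le> \<epsilon> * \<beta>" using mult_right_mono[OF \<beta>\<epsilon>, of \<beta>] \<beta> by (simp add: power2_eq_square)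
  have bc: "0 < \<beta> * c" "\<beta> * c \<le> 1" "0 < \<alpha> * c" "\<alpha> * c \<le> 1"
    using c \<beta> \<alpha> \<beta>1 \<alpha>\<beta> by (auto intro!: mult_le_one)
  define P Q Z E N where "P = p\<^sup>2" and "Q = q\<^sup>2" and "Z = r\<^sup>2" and "E = \<delta>\<^sup>2" and "N = \<nu>\<^sup>2"
  have nn: "0 \<le> P" "0 \<le> Q" "0 \<le> Z" "0 \<le> E" "0 \<le> N"
    by (auto simp: P_def Q_def Z_def E_def N_def)
  have "p'\<^sup>2 \<le> (1 - c) * P + (\<kappa> * (\<beta> * q + \<alpha> * (p + q + r + \<delta>) + \<beta> * \<nu>))\<^sup>2 / c"
    unfolding P_def using c pos p' by (intro square_affine_le) auto
  also have "\<beta> * q + \<alpha> * (p + q + r + \<delta>) + \<beta> * \<nu>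
      = \<beta> * q + \<alpha> * p + \<alpha> * q + \<alpha> * r + \<alpha> * \<delta> + \<beta> * \<nu>"
    by (simp add: algebra_simps)
  also have "(\<kappa> * (\<beta> * q + \<alpha> * p + \<alpha> * q + \<alpha> * r + \<alpha> * \<delta> + \<beta> * \<nu>))\<^sup>2 / c
      = \<kappa>\<^sup>2 / c * (\<beta> * q + \<alpha> * p + \<alpha> * q + \<alpha> * r + \<alpha> * \<delta> + \<beta> * \<nu>)\<^sup>2"
    by (simp add: power_mult_distrib)
  also have "\<dots> \<le> \<kappa>\<^sup>2 / c * (6 * ((\<beta>*q)\<^sup>2 + (\<alpha>*p)\<^sup>2 + (\<alpha>*q)\<^sup>2 + (\<alpha>*r)\<^sup>2 + (\<alpha>*\<delta>)\<^sup>2 + (\<beta>*\<nu>)\<^sup>2))"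
    using c by (intro mult_left_mono sum_squares_bound) auto
  also have "\<dots> = m * (\<beta>\<^sup>2 * Q + \<alpha>\<^sup>2 * (P + Q + Z + E) + \<beta>\<^sup>2 * N)"
    by (simp add: m_def P_def Q_def Z_def E_def N_def power_mult_distrib algebra_simps)
  also have "\<dots> \<le> m * ((\<epsilon> * \<beta>) * Q + (\<epsilon> * \<alpha>) * (P + Q + Z + E) + \<beta>\<^sup>2 * N)"
    using nn m A2 A3 by (intro mult_left_mono add_mono mult_right_mono) auto
  finally have 1: "p'\<^sup>2 \<le> (1 - c) * P + m * ((\<epsilon> * \<beta>) * Q + (\<epsilon> * \<alpha>) * (P + Q + Z + E) + \<beta>\<^sup>2 * N)"
    by simp
  have "q'\<^sup>2 \<le> (1 - \<beta> * c) * Q + (\<alpha> * \<kappa> * (p + q + r + \<delta>))\<^sup>2 / (\<beta> * c)"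
    unfolding Q_def using bc pos q' by (intro square_affine_le) auto
  also have "(\<alpha> * \<kappa> * (p + q + r + \<delta>))\<^sup>2 / (\<beta> * c) = \<kappa>\<^sup>2 / c * (\<alpha>\<^sup>2 / \<beta>) * (p + q + r + \<delta> + 0 + 0)\<^sup>2"
    by (simp add: power_mult_distrib mult_ac)
  also have "\<dots> \<le> \<kappa>\<^sup>2 / c * (\<alpha>\<^sup>2 / \<beta>) * (6 * (p\<^sup>2 + q\<^sup>2 + r\<^sup>2 + \<delta>\<^sup>2 + 0\<^sup>2 + 0\<^sup>2))"
    using c \<beta> by (intro mult_left_mono sum_squares_bound) auto
  also have "\<dots> = m * ((\<alpha>\<^sup>2 / \<beta>) * (P + Q + Z + E))"
    by (simp add: m_def P_def Q_def Z_def E_def)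
  also have "\<dots> \<le> m * ((\<epsilon> * \<alpha>) * (P + Q + Z + E))"
    using nn m A1 by (intro mult_left_mono mult_right_mono) auto
  finally have 2: "q'\<^sup>2 \<le> (1 - \<beta> * c) * Q + m * ((\<epsilon> * \<alpha>) * (P + Q + Z + E))" by simp
  \<comment> \<open>Here squaring leaves a full \<alpha> without the factor \<epsilon>. This is
    harmless because \<open>r\<close> is absent from its own perturbation, and the contractions of
    \<open>p\<close> and \<open>q\<close> are much stronger than \<alpha>.\<close>
  have "r'\<^sup>2 \<le> (1 - \<alpha> * c) * Z + (\<alpha> * \<kappa> * (p + q + \<delta>))\<^sup>2 / (\<alpha> * c)"
    unfolding Z_def using bc pos r' by (intro square_affine_le) auto
  also have "(\<alpha> * \<kappa> * (p + q + \<delta>))\<^sup>2 / (\<alpha> * c) = \<kappa>\<^sup>2 / c * \<alpha> * (p + q + \<delta> + 0 + 0 + 0)\<^sup>2"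
    using \<alpha> by (simp add: power_mult_distrib power2_eq_square)
  also have "\<dots> \<le> \<kappa>\<^sup>2 / c * \<alpha> * (6 * (p\<^sup>2 + q\<^sup>2 + \<delta>\<^sup>2 + 0\<^sup>2 + 0\<^sup>2 + 0\<^sup>2))"
    using c \<alpha> by (intro mult_left_mono sum_squares_bound) auto
  also have "\<dots> = m * (\<alpha> * (P + Q + E))"
    by (simp add: m_def P_def Q_def Z_def E_def)
  finally have 3: "r'\<^sup>2 \<le> (1 - \<alpha> * c) * Z + m * (\<alpha> * (P + Q + E))" by simp
  have m\<alpha>: "m * \<alpha> \<le> c * \<beta> / 8" using mult_left_mono[OF \<alpha>\<epsilon>, of m] m \<epsilon>(3) by (simp add: mult.assoc[symmetric])
  have "p'\<^sup>2 + q'\<^sup>2 + r'\<^sup>2 \<le> P * (1 - c + 2 * (c / 8) * \<alpha> + m * \<alpha>)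
     + Q * (1 - \<beta> * c + c / 8 * \<beta> + 2 * (c / 8) * \<alpha> + m * \<alpha>)
     + Z * (1 - \<alpha> * c + 2 * (c / 8) * \<alpha>)
     + m * (2 * \<epsilon> + 1) * \<alpha> * E + m * \<beta>\<^sup>2 * N"
    using 1 2 3 unfolding \<epsilon>(3)[symmetric] by (simp add: algebra_simps)
  \<comment> \<open>Each contraction still exceeds \<open>\<alpha> * c / 2\<close> after the
    couplings are deducted; the one of \<open>Z\<close> keeps three quarters of
    \<open>\<alpha> * c\<close>.\<close>
  also have "\<dots> \<le> P * (1 - \<alpha> * c / 2) + Q * (1 - \<alpha> * c / 2) + Z * (1 - \<alpha> * c / 2)
     + 3 * m * \<alpha> * E + 3 * m * \<beta>\<^sup>2 * N"
  proof (intro add_mono mult_left_mono mult_right_mono)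
    have ab: "c * \<alpha> \<le> c * \<beta>" "c * \<beta> \<le> c" using \<alpha>\<beta> c \<beta>1 by auto
    then show "1 - c + 2 * (c / 8) * \<alpha> + m * \<alpha> \<le> 1 - \<alpha> * c / 2"
      using m\<alpha> mult.commute[of \<alpha> c] c(1) by linarith
    show "1 - \<beta> * c + c / 8 * \<beta> + 2 * (c / 8) * \<alpha> + m * \<alpha> \<le> 1 - \<alpha> * c / 2"
      using m\<alpha> ab mult.commute[of \<alpha> c] mult.commute[of \<beta> c] mult_pos_pos[OF \<beta>(1) c(1)] by linarith
    show "1 - \<alpha> * c + 2 * (c / 8) * \<alpha> \<le> 1 - \<alpha> * c / 2"
      using \<alpha> c by (simp add: field_simps)
    show "m * (2 * \<epsilon> + 1) \<le> 3 * m" using m \<epsilon> by (simp add: field_simps)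
    show "m \<le> 3 * m" using m by simp
  qed (use nn \<alpha> in auto)
  also have "\<dots> = (1 - \<alpha> * c / 2) * (P + Q + Z) + 3 * m * (\<alpha> * E + \<beta>\<^sup>2 * N)"
    by (simp add: algebra_simps)
  finally show ?thesis by (simp add: P_def Q_def Z_def E_def N_def m_def)
qed

section \<open>Matrix algebra\<close>

lemma matrix_mult_row:
  fixes A :: "real^'n^'m" and X :: "real^'d^'n"
  shows "(A ** X) $ i = (\<Sum>j\<in>UNIV. A $ i $ j *\<^sub>R X $ j)"
  by (simp add: vec_eq_iff matrix_matrix_mult_def)

lemma bounded_linear_matrix_mult:
  "bounded_linear (\<lambda>X::real^'d^'n. (A::real^'n^'m) ** X)"
  unfolding linear_conv_bounded_linear[symmetric]
  by (rule linearI) (simp_all add: vec_eq_iff matrix_mult_row sum_distrib_left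
      sum.distrib distrib_left mult_ac)

lemma bounded_linear_outer: "bounded_linear (outer a)"
  unfolding linear_conv_bounded_linear[symmetric]
  by (rule linearI) (simp_all add: outer_def vec_eq_iff algebra_simps)

lemma bounded_linear_wavg: "bounded_linear (wavg w)"
  unfolding linear_conv_bounded_linear[symmetric]
  by (rule linearI) (simp_all add: wavg_def vec_eq_iff vector_matrix_mult_def algebra_simps
      sum.distrib sum_distrib_left)

lemmas matrix_mult_linear_simps =
  linear_simps[OF bounded_linear_matrix_mult]
  linear_simps[OF bounded_linear_outer]
  linear_simps[OF bounded_linear_wavg]

lemma matrix_mult_left_distribs:
  fixes A B :: "real^'n^'m" and X :: "real^'d^'n"
  shows "(A + B) ** X = A ** X + B ** X" "(A - B) ** X = A ** X - B ** X"
    "(c *\<^sub>R A) ** X = c *\<^sub>R (A ** X)"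
  by (simp_all add: vec_eq_iff matrix_mult_row algebra_simps sum.distrib sum_subtractf sum_distrib_left)

lemma mix_mult: "mix t W ** (X::real^'d^'n) = (1 - t) *\<^sub>R X + t *\<^sub>R (W ** X)"
  by (simp add: mix_def matrix_mult_left_distribs)

lemma matrix_mult_outer: "A ** outer a w = outer (A *v a) w"
  by (simp add: vec_eq_iff outer_def matrix_matrix_mult_def matrix_vector_mult_def sum_distrib_right mult.assoc)

lemma outer_mult: "outer a (b :: real^'n) ** (X :: real^'d^'n) = real CARD('n) *\<^sub>R outer a (wavg b X)"
  by (simp add: vec_eq_iff outer_def matrix_matrix_mult_def vector_matrix_mult_def wavg_def
      sum_distrib_left mult_ac)

lemma wavg_matrix_mult:
  assumes "b v* A = b" shows "wavg b (A ** X) = wavg b X"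
  by (simp add: wavg_def vector_matrix_mul_assoc[symmetric] assms)

lemma wavg_outer: "wavg b (outer a w :: real^'d^'n) = (inner b a / real CARD('n)) *\<^sub>R w"
proof -
  have "b v* outer a w = inner b a *\<^sub>R w"
    by (simp add: vec_eq_iff outer_def vector_matrix_mult_def inner_vec_def sum_distrib_left mult_ac)
  then show ?thesis by (simp add: wavg_def)
qed

lemma mix_right_eigenvector:
  fixes A :: "real^'n^'n"
  assumes "A *v a = a" shows "mix t A *v a = a"
proof -
  have "mix t A *v a = (1 - t) *\<^sub>R a + t *\<^sub>R (A *v a)"
    by (simp add: mix_def matrix_vector_mult_add_rdistrib flip: scaleR_matrix_vector_assoc)
  then show ?thesis by (simp add: assms algebra_simps)
qed

lemma mix_left_eigenvector:
  fixes A :: "real^'n^'n"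
  assumes "b v* A = b" shows "b v* mix t A = b"
proof -
  have "b v* mix t A = transpose (mix t A) *v b" by simp
  also have "transpose (mix t A) = mix t (transpose A)"
    by (simp add: vec_eq_iff mix_def transpose_def mat_def)
  also have "\<dots> *v b = b" using assms by (intro mix_right_eigenvector) simp
  finally show ?thesis .
qed

text \<open>When \<open>inner b a\<close> is the number of nodes, this is the oblique projection
  along \<open>a\<close> onto the matrices of vanishing \<open>b\<close>-average. The pair
  \<open>v\<close>, \<open>1\<close> gives the tracking error, the pair \<open>1\<close>,
  \<open>u\<close> the consensus error.\<close>

definition dev :: "real^'n \<Rightarrow> real^'n \<Rightarrow> real^'d^'n \<Rightarrow> real^'d^'n" where
  "dev a b X = X - outer a (wavg b X)"

lemma bounded_linear_dev: "bounded_linear (dev a b)"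
  unfolding dev_def
  by (intro bounded_linear_sub bounded_linear_ident bounded_linear_compose[OF bounded_linear_outer]
      bounded_linear_wavg)

text \<open>The average of \<open>A ** X\<close> is that of \<open>X\<close>, and \<open>A\<close>
  fixes every \<open>outer a w\<close>, so \<open>A\<close> commutes with \<open>dev\<close>; the
  rank-one correction vanishes on the range of \<open>dev\<close>.\<close>

lemma dev_mult:
  fixes A :: "real^'n^'n"
  assumes "A *v a = a" "b v* A = b" "inner b a = real CARD('n)"
  shows "dev a b (A ** X) = (A - (1 / real CARD('n)) *\<^sub>R outer a b) ** dev a b X"
proof -
  have *: "(A - (1 / real CARD('n)) *\<^sub>R outer a b) ** Z = A ** Z - outer a (wavg b Z)" for Z :: "real^'d^'n"
    by (simp add: matrix_mult_left_distribs outer_mult)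
  show ?thesis
    using assms unfolding *[of "dev a b X"]
    by (simp add: dev_def wavg_matrix_mult wavg_outer matrix_mult_outer matrix_mult_linear_simps)
qed

section \<open>Weighted norms\<close>

text \<open>Summing over columns or over rows gives the same Frobenius norm, so weighted norms
  become ordinary norms of linear images.\<close>

lemma wnorm_mat_eq_norm: "wnorm_mat H X = norm (H ** X)"
proof -
  have "(wnorm H (column l X))\<^sup>2 = (\<Sum>i\<in>UNIV. ((H ** X) $ i $ l)\<^sup>2)" for l
    unfolding wnorm_def power2_norm_eq_inner
    by (simp add: inner_vec_def matrix_vector_mult_def matrix_matrix_mult_def column_def power2_eq_square)
  then have "wnorm_mat H X = sqrt (\<Sum>l\<in>UNIV. \<Sum>i\<in>UNIV. ((H ** X) $ i $ l)\<^sup>2)"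
    by (simp add: wnorm_mat_def)
  also have "\<dots> = sqrt (inner (H ** X) (H ** X))"
    by (subst sum.swap) (simp add: inner_vec_def power2_eq_square)
  finally show ?thesis by (simp add: norm_eq_sqrt_inner)
qed

text \<open>The supremum in \<open>wnorm_op\<close> bounds its members once it is known to be
  bounded above; the bound used is the operator norm of \<open>H ** A ** H'\<close> with
  \<open>H'\<close> inverse to \<open>H\<close>.\<close>

lemma wnorm_matrix_vector_le:
  fixes H A :: "real^'n^'n"
  assumes "invertible H"
  shows "wnorm H (A *v x) \<le> wnorm_op H A * wnorm H x"
proof -
  obtain H' where H': "H' ** H = mat 1" using assms unfolding invertible_def by blast
  have inv: "H' *v (H *v y) = y" for y by (simp add: matrix_vector_mul_assoc H')
  have lin: "bounded_linear ((*v) (H ** A ** H'))"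
    by simp
  have bd: "wnorm H (A *v y) / wnorm H y \<le> onorm ((*v) (H ** A ** H'))" for y
  proof -
    have "wnorm H (A *v y) = norm ((H ** A ** H') *v (H *v y))"
      by (simp add: wnorm_def matrix_vector_mul_assoc[symmetric] inv)
    also have "\<dots> \<le> onorm ((*v) (H ** A ** H')) * norm (H *v y)"
      by (rule onorm[OF lin])
    finally show ?thesis
      using onorm_pos_le[OF lin] by (cases "norm (H *v y) = 0") (auto simp: wnorm_def divide_simps)
  qed
  then have "bdd_above (range (\<lambda>y. wnorm H (A *v y) / wnorm H y))"
    by (intro bdd_aboveI2)
  then have le: "wnorm H (A *v x) / wnorm H x \<le> wnorm_op H A"
    unfolding wnorm_op_def by (intro cSUP_upper) auto
  show ?thesis
  proof (cases "wnorm H x = 0")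
    case True
    then have "x = 0" using inv[of x] by (simp add: wnorm_def)
    then show ?thesis by (simp add: wnorm_def)
  next
    case False
    then have "wnorm H x > 0" by (simp add: wnorm_def)
    then show ?thesis using le by (simp add: field_simps)
  qed
qed

lemma norm_matrix_mult_le_wnorm_op:
  fixes H A :: "real^'n^'n" and X :: "real^'d^'n"
  assumes "invertible H" "wnorm_op H A \<le> r" "0 \<le> r"
  shows "norm (H ** (A ** X)) \<le> r * norm (H ** X)"
proof -
  have "(wnorm H (column l (A ** X)))\<^sup>2 \<le> r\<^sup>2 * (wnorm H (column l X))\<^sup>2" for l
  proof -
    have "column l (A ** X) = A *v column l X"
      by (simp add: vec_eq_iff column_def matrix_matrix_mult_def matrix_vector_mult_def)
    then have "wnorm H (column l (A ** X)) \<le> wnorm_op H A * wnorm H (column l X)"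
      using wnorm_matrix_vector_le[OF assms(1)] by metis
    also have "\<dots> \<le> r * wnorm H (column l X)"
      using assms by (intro mult_right_mono) (auto simp: wnorm_def)
    finally show ?thesis
      by (simp add: power_mult_distrib[symmetric] power_mono wnorm_def)
  qed
  then have "wnorm_mat H (A ** X) \<le> sqrt (r\<^sup>2 * (\<Sum>l\<in>UNIV. (wnorm H (column l X))\<^sup>2))"
    unfolding wnorm_mat_def by (auto simp: sum_distrib_left intro!: sum_mono)
  also have "\<dots> = r * wnorm_mat H X"
    using assms by (simp add: real_sqrt_mult wnorm_mat_def)
  finally show ?thesis by (simp add: wnorm_mat_eq_norm)
qed

section \<open>Uniform domination of families of vectors\<close>

text \<open>A big-O bound uniform over \<open>S\<close>: the constants need only exist, but may
  depend neither on the iterates nor on the step sizes.\<close>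

definition dominated :: "'t set \<Rightarrow> ('t \<Rightarrow> 'v::real_normed_vector) \<Rightarrow> ('t \<Rightarrow> real) \<Rightarrow> bool" where
  "dominated S F h \<longleftrightarrow> (\<exists>K\<ge>0. \<forall>t\<in>S. norm (F t) \<le> K * h t)"

lemma dominatedI:
  assumes "\<And>t. t \<in> S \<Longrightarrow> norm (F t) \<le> K * norm (F' t)" and "0 \<le> K" and "dominated S F' h"
  shows "dominated S F h"
proof -
  obtain J where J: "J \<ge> 0" "\<And>t. t \<in> S \<Longrightarrow> norm (F' t) \<le> J * h t"
    using assms(3) unfolding dominated_def by blast
  have "norm (F t) \<le> (K * J) * h t" if "t \<in> S" for t
    using assms(1)[OF that] mult_left_mono[OF J(2)[OF that] assms(2)] by (simp add: mult.assoc)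
  with J(1) assms(2) show ?thesis unfolding dominated_def by (intro exI[of _ "K * J"]) auto
qed

lemma dominated_norm: "(\<And>t. t \<in> S \<Longrightarrow> norm (F t) \<le> h t) \<Longrightarrow> dominated S F h"
  unfolding dominated_def by (intro exI[of _ 1]) auto

lemma dominated_linear:
  assumes "bounded_linear T" "dominated S F h"
  shows "dominated S (\<lambda>t. T (F t)) h"
proof -
  obtain K where "\<forall>x. norm (T x) \<le> norm x * K" "0 < K"
    using bounded_linear.pos_bounded[OF assms(1)] by blast
  then show ?thesis
    using assms(2) by (auto simp: mult.commute intro: dominatedI[of S _ K F, rotated 2])
qed

lemma dominated_add:
  assumes "dominated S F h" "dominated S F' h"
  shows "dominated S (\<lambda>t. F t + F' t) h"
proof -
  obtain J K where J: "J \<ge> 0" "\<And>t. t \<in> S \<Longrightarrow> norm (F t) \<le> J * h t"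
    and K: "K \<ge> 0" "\<And>t. t \<in> S \<Longrightarrow> norm (F' t) \<le> K * h t"
    using assms unfolding dominated_def by blast
  have "norm (F t + F' t) \<le> (J + K) * h t" if "t \<in> S" for t
    using J(2)[OF that] K(2)[OF that] norm_triangle_ineq[of "F t" "F' t"] by (simp add: distrib_right)
  with J K show ?thesis unfolding dominated_def by (intro exI[of _ "J + K"]) auto
qed

lemma dominated_minus: "dominated S F h \<Longrightarrow> dominated S (\<lambda>t. - F t) h"
  unfolding dominated_def by simp

lemma dominated_diff:
  "dominated S F h \<Longrightarrow> dominated S F' h \<Longrightarrow> dominated S (\<lambda>t. F t - F' t) h"
  using dominated_add[OF _ dominated_minus, of S F h F'] by simp

lemma dominated_mono:
  assumes "dominated S F h" "\<And>t. t \<in> S \<Longrightarrow> h t \<le> h' t"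
  shows "dominated S F h'"
proof -
  obtain J where J: "J \<ge> 0" "\<And>t. t \<in> S \<Longrightarrow> norm (F t) \<le> J * h t"
    using assms(1) unfolding dominated_def by blast
  then show ?thesis
    unfolding dominated_def using assms(2) by (meson mult_left_mono order_trans)
qed

text \<open>Equivalence of norms: multiplication by the inverse of \<open>H\<close> is
  bounded.\<close>

lemma dominated_invertible:
  fixes H :: "real^'n^'n" and F :: "'t \<Rightarrow> real^'d^'n"
  assumes "invertible H" shows "dominated S F (\<lambda>t. norm (H ** F t))"
proof -
  obtain H' where "H' ** H = mat 1" using assms unfolding invertible_def by blast
  then have "H' ** (H ** F t) = F t" for t by (simp add: matrix_mul_assoc)
  moreover have "dominated S (\<lambda>t. H' ** (H ** F t)) (\<lambda>t. norm (H ** F t))"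
    by (intro dominated_linear[OF bounded_linear_matrix_mult] dominated_norm) simp
  ultimately show ?thesis by simp
qed

section \<open>One step of the noiseless recursion\<close>

lemma wavg_1: "wavg 1 (X :: real^'d^'n) = (1 / real CARD('n)) *\<^sub>R (\<Sum>i\<in>UNIV. X $ i)"
  by (simp add: wavg_def vector_matrix_mult_def vec_eq_iff)

text \<open>The rows are compared one by one; the absolute value is there because \<open>L\<close>
  comes without a sign.\<close>

lemma norm_stacked_grad_diff_le:
  assumes "\<And>i p q. norm (grad (f i) p - grad (f i) q) \<le> L * norm (p - q)"
  shows "norm (stacked_grad f X - stacked_grad f Z) \<le> \<bar>L\<bar> * norm (X - Z)"
proof -
  have "norm (grad (f i) p - grad (f i) q) \<le> \<bar>L\<bar> * norm (p - q)" for i p q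
    using assms[of i p q] mult_right_mono[OF abs_ge_self, of "norm (p - q)" L] by simp
  then have "norm (stacked_grad f X - stacked_grad f Z) \<le> L2_set (\<lambda>i. \<bar>L\<bar> * norm ((X - Z) $ i)) UNIV"
    unfolding norm_vec_def by (intro L2_set_mono) (auto simp: stacked_grad_def)
  also have "\<dots> = \<bar>L\<bar> * norm (X - Z)"
    by (simp add: norm_vec_def L2_set_right_distrib)
  finally show ?thesis .
qed

section \<open>Deterministic data and the gradient of the average objective\<close>

locale vra_gt_data =
  fixes f :: "'n::finite \<Rightarrow> real^'d::finite \<Rightarrow> real"
    and R C Rhat Chat :: "real^'n^'n"
    and u v :: "real^'n"
    and xstar :: "real^'d"
    and L \<mu> \<gamma> \<rho>R \<rho>C :: real
  assumes differentiable: "\<And>i p. f i differentiable (at p)"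
    and smooth: "\<And>i p q. norm (grad (f i) p - grad (f i) q) \<le> L * norm (p - q)"
    and strong: "strongly_convex \<mu> (\<lambda>p. (\<Sum>j\<in>UNIV. f j p) / real CARD('n))"
    and minimizer: "\<And>p. (\<Sum>j\<in>UNIV. f j xstar) / real CARD('n)
                           \<le> (\<Sum>j\<in>UNIV. f j p) / real CARD('n)"
    and R_stoch: "R *v 1 = 1" and C_stoch: "1 v* C = 1"
    and u_eig: "u v* R = u" and v_eig: "C *v v = v"
    and u_sum: "inner u 1 = real CARD('n)" and v_sum: "inner v 1 = real CARD('n)"
    and uv: "0 < inner u v"
    and \<gamma>: "0 < \<gamma>" "\<gamma> < 1"
    and norm_inv: "invertible Rhat" "invertible Chat"
    and rho_range: "\<rho>R \<in> {0<..1}" "\<rho>C \<in> {0<..1}"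
    and C_contr: "wnorm_op Chat (mix \<gamma> C - (1 / real CARD('n)) *\<^sub>R outer v 1) < 1 - \<gamma> * \<rho>C"
begin

text \<open>The gradient of the average objective, written through \<open>stacked_grad\<close> at a
  consensual matrix so that the Lipschitz bound for \<open>stacked_grad\<close> applies to
  it.\<close>

definition mean_grad :: "real^'d \<Rightarrow> real^'d" where
  "mean_grad p = wavg 1 (stacked_grad f (outer 1 p))"

lemma mean_has_derivative:
  "((\<lambda>p. (\<Sum>j\<in>UNIV. f j p) / real CARD('n)) has_derivative (\<lambda>h. inner h (mean_grad p))) (at p)"
proof -
  have "((\<lambda>p. (\<Sum>j\<in>UNIV. f j p) / real CARD('n)) has_derivative
      (\<lambda>h. (\<Sum>j\<in>UNIV. inner h (grad (f j) p)) / real CARD('n))) (at p)"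
    using GDERIV_grad[OF differentiable] unfolding gderiv_def
    by (auto intro!: derivative_eq_intros)
  moreover have "(\<Sum>j\<in>UNIV. inner h (grad (f j) p)) / real CARD('n) = inner h (mean_grad p)" for h
    by (simp add: mean_grad_def wavg_1 stacked_grad_def outer_def inner_sum_right)
  ultimately show ?thesis by simp
qed

lemma mean_grad_xstar: "mean_grad xstar = 0"
proof -
  have "(\<lambda>h. inner h (mean_grad xstar)) = (\<lambda>h. 0)"
    using minimizer by (intro differential_zero_maxmin[OF _ _ mean_has_derivative, of _ UNIV]) auto
  then have "inner (mean_grad xstar) (mean_grad xstar) = 0" by metis
  then show ?thesis by simp
qed

lemma mu_pos: "0 < \<mu>"
  using strong by (simp add: strongly_convex_def)

text \<open>Strong convexity on the segment from \<open>p\<close> to \<open>xstar\<close> is read at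
  both ends. The slope at \<open>p\<close> gives
  \<open>inner (xstar - p) (mean_grad p) \<le> F xstar - F p - N\<close>; near \<open>xstar\<close>,
  minimality gives \<open>N \<le> F p - F xstar\<close>. Adding the two yields \<open>2 * N\<close>,
  the left-hand side.\<close>

lemma mean_grad_strongly_monotone:
  "\<mu> * (norm (p - xstar))\<^sup>2 \<le> inner (p - xstar) (mean_grad p)"
proof -
  define F where "F = (\<lambda>p. (\<Sum>j\<in>UNIV. f j p) / real CARD('n))"
  define N where "N = \<mu> / 2 * (norm (p - xstar))\<^sup>2"
  have "\<forall>x y. \<forall>t\<in>{0..1}. F ((1 - t) *\<^sub>R x + t *\<^sub>R y)
      \<le> (1 - t) * F x + t * F y - \<mu> / 2 * t * (1 - t) * (norm (x - y))\<^sup>2"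
    using strong unfolding strongly_convex_def F_def by blast
  note * = this[rule_format]
  have sc: "F ((1 - t) *\<^sub>R p + t *\<^sub>R xstar) \<le> (1 - t) * F p + t * F xstar - t * (1 - t) * N"
    if "0 \<le> t" "t \<le> 1" for t
    using *[of t p xstar] that by (simp add: N_def mult_ac)
  have min: "F xstar \<le> F q" for q using minimizer by (simp add: F_def)
  \<comment> \<open>The slope of \<open>F\<close> along the segment, later used as a right-hand
    limit because strong convexity speaks about nonnegative \<open>t\<close> only.\<close>
  have "((\<lambda>t. p + t *\<^sub>R (xstar - p)) has_derivative (\<lambda>h. h *\<^sub>R (xstar - p))) (at 0)"
    by (auto intro!: derivative_eq_intros)
  moreover have "(F has_derivative (\<lambda>h. inner h (mean_grad p))) (at (p + 0 *\<^sub>R (xstar - p)))"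
    using mean_has_derivative[of p] by (simp add: F_def)
  ultimately have "((\<lambda>t. F (p + t *\<^sub>R (xstar - p))) has_derivative
      (\<lambda>h. inner (h *\<^sub>R (xstar - p)) (mean_grad p))) (at 0)"
    by (rule has_derivative_compose)
  then have "((\<lambda>t. F (p + t *\<^sub>R (xstar - p))) has_real_derivative inner (xstar - p) (mean_grad p)) (at 0)"
    by (simp add: has_field_derivative_def mult_commute_abs)
  then have lim: "((\<lambda>t. (F (p + t *\<^sub>R (xstar - p)) - F p) / t) \<longlongrightarrow> inner (xstar - p) (mean_grad p)) (at_right 0)"
    by (auto simp: DERIV_def intro: tendsto_mono[OF at_le])
  have ev: "eventually (\<lambda>t::real. 0 < t \<and> t < 1) (at_right 0)"
    using eventually_at_right_less[of 0] eventually_at_right_real[of 0 1] by (auto elim: eventually_elim2)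
  have "eventually (\<lambda>t. (F (p + t *\<^sub>R (xstar - p)) - F p) / t \<le> F xstar - F p - (1 - t) * N) (at_right 0)"
    using ev
  proof eventually_elim
    case (elim t)
    have "p + t *\<^sub>R (xstar - p) = (1 - t) *\<^sub>R p + t *\<^sub>R xstar" by (simp add: algebra_simps)
    then have "F (p + t *\<^sub>R (xstar - p)) - F p \<le> t * (F xstar - F p - (1 - t) * N)"
      using sc[of t] elim by (simp add: algebra_simps)
    then show ?case using elim by (simp add: field_simps)
  qed
  moreover have "((\<lambda>t. F xstar - F p - (1 - t) * N) \<longlongrightarrow> F xstar - F p - (1 - 0) * N) (at_right 0)"
    by (intro tendsto_intros)
  ultimately have 1: "inner (xstar - p) (mean_grad p) \<le> F xstar - F p - N"
    using tendsto_le[OF _ _ lim] by force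
  \<comment> \<open>Now \<open>t\<close> measures the distance from \<open>xstar\<close>: strong
    convexity is taken at \<open>1 - t\<close> and divided by \<open>t\<close> before the
    limit.\<close>
  have "eventually (\<lambda>t. (1 - t) * N \<le> F p - F xstar) (at_right 0)"
    using ev
  proof eventually_elim
    case (elim t)
    have "t * ((1 - t) * N) \<le> t * (F p - F xstar)"
      using sc[of "1 - t"] min[of "(1 - (1 - t)) *\<^sub>R p + (1 - t) *\<^sub>R xstar"] elim by (simp add: algebra_simps)
    then show ?case using elim by simp
  qed
  moreover have "((\<lambda>t. (1 - t) * N) \<longlongrightarrow> (1 - 0) * N) (at_right 0)"
    by (intro tendsto_intros)
  ultimately have 2: "N \<le> F p - F xstar"
    using tendsto_upperbound[of _ N "at_right 0"] by force
  have "inner (p - xstar) (mean_grad p) = - inner (xstar - p) (mean_grad p)"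
    by (simp add: inner_diff_left)
  with 1 2 show ?thesis by (simp add: N_def)
qed

lemma mean_grad_lipschitz: "\<exists>K\<ge>0. \<forall>p. norm (mean_grad p) \<le> K * norm (p - xstar)"
proof -
  have "dominated UNIV (\<lambda>p. p - xstar) (\<lambda>p. norm (p - xstar))"
    by (rule dominated_norm) simp
  from dominated_linear[OF bounded_linear_outer[of 1] this]
  have "dominated UNIV (\<lambda>p. outer (1::real^'n) p - outer 1 xstar) (\<lambda>p. norm (p - xstar))"
    by (simp add: matrix_mult_linear_simps)
  from dominatedI[OF norm_stacked_grad_diff_le[of f L, OF smooth] _ this]
  have "dominated UNIV (\<lambda>p. stacked_grad f (outer 1 p) - stacked_grad f (outer 1 xstar)) (\<lambda>p. norm (p - xstar))"
    by simp
  from dominated_linear[OF bounded_linear_wavg[of 1] this]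
  have "dominated UNIV (\<lambda>p. mean_grad p - mean_grad xstar) (\<lambda>p. norm (p - xstar))"
    by (simp add: matrix_mult_linear_simps mean_grad_def)
  then show ?thesis by (simp add: mean_grad_xstar dominated_def)
qed

text \<open>In the expanded square the term \<open>a\<^sup>2 * K\<^sup>2\<close> is at most
  \<open>a * \<mu>\<close>, half of the monotonicity gain \<open>2 * a * \<mu>\<close>; and
  \<open>1 - a * \<mu> \<le> (1 - a * \<mu> / 2)\<^sup>2\<close>.\<close>

lemma gradient_step_contraction:
  "\<exists>\<epsilon>>0. \<forall>a p. 0 < a \<longrightarrow> a \<le> \<epsilon> \<longrightarrow>
     norm (p - xstar - a *\<^sub>R mean_grad p) \<le> (1 - a * (\<mu> / 2)) * norm (p - xstar)"
proof -
  obtain K where K: "K \<ge> 0" "\<And>p. norm (mean_grad p) \<le> K * norm (p - xstar)"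
    using mean_grad_lipschitz by blast
  \<comment> \<open>The first bound keeps the contraction factor nonnegative; the \<open>+ 1\<close>
    guards against \<open>K = 0\<close>.\<close>
  define \<epsilon> where "\<epsilon> = min (2 / \<mu>) (\<mu> / (K\<^sup>2 + 1))"
  have "norm (p - xstar - a *\<^sub>R mean_grad p) \<le> (1 - a * (\<mu> / 2)) * norm (p - xstar)"
    if a: "0 < a" "a \<le> \<epsilon>" for a p
  proof -
    define n where "n = norm (p - xstar)"
    have "a \<le> \<mu> / (K\<^sup>2 + 1)" using a by (simp add: \<epsilon>_def)
    moreover have "K\<^sup>2 + 1 > 0" by (simp add: add_nonneg_pos)
    ultimately have "a * (K\<^sup>2 + 1) \<le> \<mu>" by (simp only: pos_le_divide_eq)
    then have aK: "a * K\<^sup>2 \<le> \<mu>" using a by (simp add: algebra_simps)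
    have a\<mu>: "a * (\<mu> / 2) \<le> 1" using a mu_pos by (simp add: \<epsilon>_def field_simps)
    have "(norm (p - xstar - a *\<^sub>R mean_grad p))\<^sup>2
        = n\<^sup>2 - 2 * a * inner (p - xstar) (mean_grad p) + a\<^sup>2 * (norm (mean_grad p))\<^sup>2"
      unfolding n_def power2_norm_eq_inner
      by (simp add: inner_diff_left inner_diff_right inner_commute power2_eq_square algebra_simps)
    also have "\<dots> \<le> n\<^sup>2 - 2 * a * (\<mu> * n\<^sup>2) + a\<^sup>2 * (K * n)\<^sup>2"
      using a mean_grad_strongly_monotone[of p] K(2)[of p]
      by (intro add_mono diff_mono mult_left_mono power_mono) (auto simp: n_def)
    also have "\<dots> = n\<^sup>2 - 2 * a * \<mu> * n\<^sup>2 + (a * K\<^sup>2) * (a * n\<^sup>2)"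
      by (simp add: power2_eq_square algebra_simps)
    also have "\<dots> \<le> n\<^sup>2 - 2 * a * \<mu> * n\<^sup>2 + \<mu> * (a * n\<^sup>2)"
      using a aK by (intro add_left_mono mult_right_mono) auto
    also have "\<dots> \<le> (1 - a * (\<mu> / 2))\<^sup>2 * n\<^sup>2"
    proof -
      have "(1 - a * (\<mu> / 2))\<^sup>2 * n\<^sup>2 - (n\<^sup>2 - 2 * a * \<mu> * n\<^sup>2 + \<mu> * (a * n\<^sup>2)) = (a * (\<mu> / 2) * n)\<^sup>2"
        by (simp add: power2_eq_square algebra_simps)
      then show ?thesis using zero_le_power2[of "a * (\<mu> / 2) * n"] by linarith
    qed
    also have "\<dots> = ((1 - a * (\<mu> / 2)) * n)\<^sup>2" by (simp add: power_mult_distrib)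
    finally have "norm (p - xstar - a *\<^sub>R mean_grad p) \<le> (1 - a * (\<mu> / 2)) * n"
      by (rule power2_le_imp_le) (use a\<mu> in \<open>auto simp: n_def\<close>)
    then show ?thesis by (simp add: n_def)
  qed
  moreover have "\<epsilon> > 0" using mu_pos by (simp add: \<epsilon>_def add_nonneg_pos)
  ultimately show ?thesis by blast
qed

text \<open>
  With \<open>X' = mix b R ** X - a (Y + D) + b N\<close>, only the tracking error is measured after the noise
  \<open>N\<close> is added: the other two errors are linear in \<open>N\<close>, and in expectation their
  cross terms with \<open>N\<close> vanish.
\<close>

lemma one_step:
  "\<exists>c B \<epsilon>. 0 < c \<and> c \<le> 1 \<and> 0 < B \<and> 0 < \<epsilon> \<and> (\<forall>a b X Y D N. 0 < a \<longrightarrow> a \<le> \<epsilon> * b \<longrightarrow> 0 < b \<longrightarrow> b \<le> \<epsilon> \<longrightarrow>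
     wnorm_op Rhat (mix b R - (1 / real CARD('n)) *\<^sub>R outer 1 u) \<le> 1 - b * \<rho>R \<longrightarrow>
     wavg 1 Y = wavg 1 (stacked_grad f X) \<longrightarrow>
     (norm (Chat ** dev v 1 (mix \<gamma> C ** Y + stacked_grad f (mix b R ** X - a *\<^sub>R (Y + D) + b *\<^sub>R N) - stacked_grad f X)))\<^sup>2
     + (norm (Rhat ** dev 1 u (mix b R ** X - a *\<^sub>R (Y + D))))\<^sup>2
     + (norm (wavg u (mix b R ** X - a *\<^sub>R (Y + D)) - xstar))\<^sup>2
     \<le> (1 - a * c) * ((norm (Chat ** dev v 1 Y))\<^sup>2 + (norm (Rhat ** dev 1 u X))\<^sup>2 + (norm (wavg u X - xstar))\<^sup>2)
        + B * (a * (norm D)\<^sup>2 + b\<^sup>2 * (norm N)\<^sup>2))"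
proof -
  let ?G = "stacked_grad f"
  let ?n = "real CARD('n)"
  \<comment> \<open>Triples \<open>(X, Y, D)\<close> of iterate, tracker and perturbation; the
    constraint is the tracking invariant, established below as \<open>wavg_y'\<close>.\<close>
  define S where "S = {t :: (real^'d^'n) \<times> (real^'d^'n) \<times> (real^'d^'n). wavg 1 (fst (snd t)) = wavg 1 (?G (fst t))}"
  let ?p = "\<lambda>Y. norm (Chat ** dev v 1 Y)"
  let ?q = "\<lambda>X. norm (Rhat ** dev 1 u X)"
  let ?r = "\<lambda>X. norm (wavg u X - xstar)"
  let ?s = "\<lambda>t. ?p (fst (snd t)) + ?q (fst t) + ?r (fst t) + norm (snd (snd t))"
  define \<kappa>0 where "\<kappa>0 = inner u v / ?n"
  have \<kappa>0: "\<kappa>0 > 0" using uv by (simp add: \<kappa>0_def)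
  note G_lip = norm_stacked_grad_diff_le[of f L, OF smooth]
  have dY: "dominated S (\<lambda>t. dev v 1 (fst (snd t))) (\<lambda>t. ?p (fst (snd t)))"
    by (rule dominated_invertible[OF norm_inv(2)])
  have dX: "dominated S (\<lambda>t. dev 1 u (fst t)) (\<lambda>t. ?q (fst t))"
    by (rule dominated_invertible[OF norm_inv(1)])
  have dr: "dominated S (\<lambda>t. wavg u (fst t) - xstar) (\<lambda>t. ?r (fst t))"
    by (rule dominated_norm) simp
  have dD: "dominated S (\<lambda>t. snd (snd t)) (\<lambda>t. norm (snd (snd t)))"
    by (rule dominated_norm) simp
  \<comment> \<open>The distance of \<open>X\<close> from the optimal consensus splits into its
    consensus error and the optimality error of its average; this controls the average gradient at
    \<open>X\<close>.\<close>
  have "dominated S (\<lambda>t. dev 1 u (fst t) + outer 1 (wavg u (fst t) - xstar)) (\<lambda>t. ?q (fst t) + ?r (fst t))"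
    by (intro dominated_add dominated_mono[OF dX] dominated_mono[OF dominated_linear[OF bounded_linear_outer dr]]) auto
  then have "dominated S (\<lambda>t. fst t - outer 1 xstar) (\<lambda>t. ?q (fst t) + ?r (fst t))"
    by (simp add: dev_def matrix_mult_linear_simps)
  from dominated_linear[OF bounded_linear_wavg[of 1] dominatedI[OF G_lip _ this]]
  have "dominated S (\<lambda>t. wavg 1 (?G (fst t)) - mean_grad xstar) (\<lambda>t. ?q (fst t) + ?r (fst t))"
    by (simp add: mean_grad_def matrix_mult_linear_simps)
  then have dgrad: "dominated S (\<lambda>t. wavg 1 (?G (fst t))) (\<lambda>t. ?q (fst t) + ?r (fst t))"
    by (simp add: mean_grad_xstar)
  \<comment> \<open>The direction \<open>Y + D\<close> is the tracking error, plus the average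
    gradient spread along \<open>v\<close>, plus \<open>D\<close>.\<close>
  have "dominated S (\<lambda>t. dev v 1 (fst (snd t)) + outer v (wavg 1 (?G (fst t))) + snd (snd t)) ?s"
    by (intro dominated_add dominated_mono[OF dY] dominated_mono[OF dD]
        dominated_mono[OF dominated_linear[OF bounded_linear_outer dgrad]]) auto
  then obtain K1 where K1: "K1 \<ge> 0" "\<And>t. t \<in> S \<Longrightarrow>
      norm (dev v 1 (fst (snd t)) + outer v (wavg 1 (?G (fst t))) + snd (snd t)) \<le> K1 * ?s t"
    unfolding dominated_def by blast
  \<comment> \<open>\<open>R\<close> fixes consensual matrices, so the move
    \<open>R ** X - X\<close> depends on \<open>dev 1 u X\<close> only.\<close>
  have "dominated S (\<lambda>t. R ** dev 1 u (fst t) - dev 1 u (fst t)) (\<lambda>t. ?q (fst t))"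
    by (intro dominated_diff dominated_linear[OF bounded_linear_matrix_mult dX] dX)
  then obtain K2 where K2: "K2 \<ge> 0" "\<And>t. t \<in> S \<Longrightarrow>
      norm (R ** dev 1 u (fst t) - dev 1 u (fst t)) \<le> K2 * ?q (fst t)"
    unfolding dominated_def by blast
  have "dominated S (\<lambda>t. fst t - outer 1 (wavg u (fst t))) (\<lambda>t. ?q (fst t))"
    using dX by (simp add: dev_def)
  from dominated_linear[OF bounded_linear_wavg[of 1] dominatedI[OF G_lip _ this]]
  have dE: "dominated S (\<lambda>t. wavg 1 (?G (fst t)) - mean_grad (wavg u (fst t))) (\<lambda>t. ?q (fst t))"
    by (simp add: mean_grad_def matrix_mult_linear_simps)
  \<comment> \<open>The deviation of the averaged direction from
    \<open>\<kappa>0 *\<^sub>R mean_grad (wavg u X)\<close>. Its bound contains no optimality error,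
    as \<open>lyapunov_coupling\<close> demands of the perturbation of \<open>r\<close>.\<close>
  have "dominated S (\<lambda>t. wavg u (dev v 1 (fst (snd t)))
      + \<kappa>0 *\<^sub>R (wavg 1 (?G (fst t)) - mean_grad (wavg u (fst t))) + wavg u (snd (snd t)))
      (\<lambda>t. ?p (fst (snd t)) + ?q (fst t) + norm (snd (snd t)))"
    by (intro dominated_add dominated_mono[OF dominated_linear[OF bounded_linear_wavg dY]]
        dominated_mono[OF dominated_linear[OF bounded_linear_wavg dD]]
        dominated_mono[OF dominated_linear[OF bounded_linear_scaleR_right dE]]) auto
  then obtain K3 where K3: "K3 \<ge> 0" "\<And>t. t \<in> S \<Longrightarrow>
      norm (wavg u (dev v 1 (fst (snd t))) + \<kappa>0 *\<^sub>R (wavg 1 (?G (fst t)) - mean_grad (wavg u (fst t)))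
        + wavg u (snd (snd t))) \<le> K3 * (?p (fst (snd t)) + ?q (fst t) + norm (snd (snd t)))"
    unfolding dominated_def by blast
  have "dominated UNIV (\<lambda>Z :: real^'d^'n. Rhat ** dev 1 u Z) norm"
    by (intro dominated_linear[OF bounded_linear_matrix_mult] dominated_linear[OF bounded_linear_dev] dominated_norm) simp
  then obtain K4 where K4: "K4 \<ge> 0" "\<And>Z :: real^'d^'n. norm (Rhat ** dev 1 u Z) \<le> K4 * norm Z"
    unfolding dominated_def by auto
  have "dominated UNIV (\<lambda>(Z, W). ?G Z - ?G W) (\<lambda>(Z, W). norm (Z - W))"
    unfolding dominated_def using G_lip by (intro exI[of _ "\<bar>L\<bar>"]) auto
  from dominated_linear[OF bounded_linear_matrix_mult[of Chat] dominated_linear[OF bounded_linear_dev[of v 1] this]]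
  obtain K5 where K5: "K5 \<ge> 0" "\<And>Z W. norm (Chat ** dev v 1 (?G Z - ?G W)) \<le> K5 * norm (Z - W)"
    unfolding dominated_def by auto
  obtain \<epsilon>0 where \<epsilon>0: "\<epsilon>0 > 0" "\<And>a p. 0 < a \<Longrightarrow> a \<le> \<epsilon>0 \<Longrightarrow>
      norm (p - xstar - a *\<^sub>R mean_grad p) \<le> (1 - a * (\<mu> / 2)) * norm (p - xstar)"
    using gradient_step_contraction by blast

  \<comment> \<open>The rates of tracking, consensus and descent; the average performs gradient
    steps of effective length \<open>a * \<kappa>0\<close>, hence the third entry.\<close>
  define c where "c = Min {\<gamma> * \<rho>C, \<rho>R, \<kappa>0 * \<mu> / 2, 1}"
  have c: "0 < c" "c \<le> 1" "c \<le> \<gamma> * \<rho>C" "c \<le> \<rho>R" "c \<le> \<kappa>0 * \<mu> / 2"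
    using \<gamma> rho_range \<kappa>0 mu_pos by (auto simp: c_def)
  have \<gamma>\<rho>: "\<gamma> * \<rho>C \<le> 1" using \<gamma> rho_range by (auto intro: mult_le_one)
  define \<kappa> where "\<kappa> = Max {1, K5 * (K1 + K2 + 1), K4 * K1, K3}"
  have \<kappa>: "1 \<le> \<kappa>" "K5 * (K1 + K2 + 1) \<le> \<kappa>" "K4 * K1 \<le> \<kappa>" "K3 \<le> \<kappa>"
    by (auto simp: \<kappa>_def)
  \<comment> \<open>The first entry is the smallness condition of \<open>lyapunov_coupling\<close>;
    the last keeps \<open>a * \<kappa>0\<close> in the range of
    \<open>gradient_step_contraction\<close>.\<close>
  define \<epsilon> where "\<epsilon> = Min {c\<^sup>2 / (48 * \<kappa>\<^sup>2), 1, \<epsilon>0 / \<kappa>0}"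
  have \<epsilon>: "0 < \<epsilon>" "\<epsilon> \<le> c\<^sup>2 / (48 * \<kappa>\<^sup>2)" "\<epsilon> \<le> 1" "\<epsilon> \<le> \<epsilon>0 / \<kappa>0"
    using c \<kappa> \<epsilon>0 \<kappa>0 by (auto simp: \<epsilon>_def)
  show ?thesis
  proof (rule exI[of _ "c / 2"], rule exI[of _ "18 * \<kappa>\<^sup>2 / c"], rule exI[of _ \<epsilon>],
      intro conjI allI impI)
    fix a b :: real and X Y D N :: "real^'d^'n"
    assume a: "0 < a" "a \<le> \<epsilon> * b" and b: "0 < b" "b \<le> \<epsilon>"
      and contr: "wnorm_op Rhat (mix b R - (1 / ?n) *\<^sub>R outer 1 u) \<le> 1 - b * \<rho>R"
      and avg: "wavg 1 Y = wavg 1 (?G X)"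
    have t: "(X, Y, D) \<in> S" using avg by (simp add: S_def)
    define X0 where "X0 = mix b R ** X - a *\<^sub>R (Y + D)"
    let ?s' = "?p Y + ?q X + ?r X + norm D"
    have YD: "norm (Y + D) \<le> K1 * ?s'"
      using K1(2)[OF t] by (simp add: dev_def avg)
    have q': "?q X0 \<le> (1 - b * c) * ?q X + a * \<kappa> * ?s'"
    proof -
      have b1: "b * \<rho>R \<le> 1" using b \<epsilon> rho_range by (auto intro: mult_le_one)
      have "Rhat ** dev 1 u X0 = Rhat ** ((mix b R - (1 / ?n) *\<^sub>R outer 1 u) ** dev 1 u X)
          - a *\<^sub>R (Rhat ** dev 1 u (Y + D))"
        using dev_mult[of "mix b R" 1 u X] u_sum R_stoch u_eig
        by (simp add: X0_def linear_simps[OF bounded_linear_dev] matrix_mult_linear_simps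
            mix_right_eigenvector mix_left_eigenvector)
      then have "?q X0 \<le> norm (Rhat ** ((mix b R - (1 / ?n) *\<^sub>R outer 1 u) ** dev 1 u X))
          + a * norm (Rhat ** dev 1 u (Y + D))"
        using norm_triangle_ineq4 a by (metis abs_of_pos norm_scaleR)
      also have "\<dots> \<le> (1 - b * \<rho>R) * ?q X + a * (K4 * (K1 * ?s'))"
        using b1 a K4(1) YD
        by (intro add_mono mult_left_mono norm_matrix_mult_le_wnorm_op[OF norm_inv(1) contr]
            order_trans[OF K4(2)]) auto
      also have "\<dots> \<le> (1 - b * c) * ?q X + a * (\<kappa> * ?s')"
        using c b a \<kappa>(3) unfolding mult.assoc[of K4, symmetric]
        by (intro add_mono mult_right_mono mult_left_mono) auto
      finally show ?thesis by (simp add: mult.assoc)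
    qed
    have r': "?r X0 \<le> (1 - a * c) * ?r X + a * \<kappa> * (?p Y + ?q X + norm D)"
    proof -
      have "\<epsilon> * b \<le> \<epsilon> * 1" using b \<epsilon> by (intro mult_left_mono) auto
      then have "a \<le> \<epsilon>" using a by simp
      then have "a * \<kappa>0 \<le> \<epsilon> * \<kappa>0" using \<kappa>0 by (intro mult_right_mono) auto
      moreover have "\<epsilon> * \<kappa>0 \<le> \<epsilon>0" using \<epsilon>(4) \<kappa>0 by (simp add: pos_le_divide_eq)
      ultimately have a\<epsilon>: "a * \<kappa>0 \<le> \<epsilon>0" by linarith
      have "wavg u Y = wavg u (dev v 1 Y) + \<kappa>0 *\<^sub>R wavg 1 (?G X)"
        by (simp add: dev_def matrix_mult_linear_simps wavg_outer \<kappa>0_def avg)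
      \<comment> \<open>Adding and subtracting the mean gradient at the average exhibits an exact
        gradient step plus an error of order \<open>a\<close>.\<close>
      then have "wavg u X0 - xstar = (wavg u X - xstar - (a * \<kappa>0) *\<^sub>R mean_grad (wavg u X))
        - a *\<^sub>R (wavg u (dev v 1 Y) + \<kappa>0 *\<^sub>R (wavg 1 (?G X) - mean_grad (wavg u X)) + wavg u D)"
        using u_eig by (simp add: X0_def matrix_mult_linear_simps wavg_matrix_mult mix_left_eigenvector algebra_simps)
      then have "?r X0 \<le> norm (wavg u X - xstar - (a * \<kappa>0) *\<^sub>R mean_grad (wavg u X))
        + a * norm (wavg u (dev v 1 Y) + \<kappa>0 *\<^sub>R (wavg 1 (?G X) - mean_grad (wavg u X)) + wavg u D)"
        using norm_triangle_ineq4 a by (metis abs_of_pos norm_scaleR)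
      also have "\<dots> \<le> (1 - (a * \<kappa>0) * (\<mu> / 2)) * ?r X + a * (K3 * (?p Y + ?q X + norm D))"
        using K3(2)[OF t] a \<kappa>0 a\<epsilon> by (intro add_mono mult_left_mono \<epsilon>0) auto
      also have "\<dots> \<le> (1 - a * c) * ?r X + a * (\<kappa> * (?p Y + ?q X + norm D))"
        using mult_left_mono[OF c(5), of a] a \<kappa> by (intro add_mono mult_left_mono mult_right_mono) auto
      finally show ?thesis by (simp add: mult.assoc)
    qed
    define X' where "X' = X0 + b *\<^sub>R N"
    have p': "?p (mix \<gamma> C ** Y + ?G X' - ?G X)
        \<le> (1 - c) * ?p Y + \<kappa> * (b * ?q X + a * ?s' + b * norm N)"
    proof -
      have "R ** outer 1 w = outer 1 w" for w :: "real^'d"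
        by (simp add: matrix_mult_outer R_stoch)
      then have "X' - X = b *\<^sub>R (R ** dev 1 u X - dev 1 u X) - a *\<^sub>R (Y + D) + b *\<^sub>R N"
        by (simp add: X'_def X0_def mix_mult dev_def matrix_mult_linear_simps algebra_simps)
      then have "norm (X' - X) \<le> norm (b *\<^sub>R (R ** dev 1 u X - dev 1 u X)) + norm (a *\<^sub>R (Y + D)) + norm (b *\<^sub>R N)"
        by (metis norm_triangle_mono norm_triangle_ineq4 order_refl)
      also have "\<dots> = b * norm (R ** dev 1 u X - dev 1 u X) + a * norm (Y + D) + b * norm N"
        using a b by simp
      also have "\<dots> \<le> b * (K2 * ?q X) + a * (K1 * ?s') + b * norm N"
        using K2(2)[OF t] YD a b by (intro add_mono mult_left_mono) auto
      \<comment> \<open>A single constant for all three terms, so that \<kappa> can absorb it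
        together with \<open>K5\<close>.\<close>
      also have "\<dots> \<le> (K1 + K2 + 1) * (b * ?q X) + (K1 + K2 + 1) * (a * ?s') + (K1 + K2 + 1) * (b * norm N)"
      proof (intro add_mono)
        show "b * (K2 * ?q X) \<le> (K1 + K2 + 1) * (b * ?q X)"
          using K1 K2 b mult_right_mono[of K2 "K1 + K2 + 1" "b * ?q X"] by (simp add: mult_ac)
        show "a * (K1 * ?s') \<le> (K1 + K2 + 1) * (a * ?s')"
          using K1 K2 a mult_right_mono[of K1 "K1 + K2 + 1" "a * ?s'"] by (simp add: mult_ac)
        show "b * norm N \<le> (K1 + K2 + 1) * (b * norm N)"
          using K1 K2 b mult_right_mono[of 1 "K1 + K2 + 1" "b * norm N"] by simp
      qed
      finally have dX': "norm (X' - X) \<le> (K1 + K2 + 1) * (b * ?q X + a * ?s' + b * norm N)"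
        by (simp only: distrib_left)
      have "Chat ** dev v 1 (mix \<gamma> C ** Y + ?G X' - ?G X)
          = Chat ** ((mix \<gamma> C - (1 / ?n) *\<^sub>R outer v 1) ** dev v 1 Y) + Chat ** dev v 1 (?G X' - ?G X)"
        using dev_mult[of "mix \<gamma> C" v 1 Y] v_sum C_stoch v_eig
        by (simp add: linear_simps[OF bounded_linear_dev] matrix_mult_linear_simps inner_commute
            mix_right_eigenvector mix_left_eigenvector)
      then have "?p (mix \<gamma> C ** Y + ?G X' - ?G X)
          \<le> norm (Chat ** ((mix \<gamma> C - (1 / ?n) *\<^sub>R outer v 1) ** dev v 1 Y)) + norm (Chat ** dev v 1 (?G X' - ?G X))"
        by (metis norm_triangle_ineq)
      also have "\<dots> \<le> (1 - \<gamma> * \<rho>C) * ?p Y + K5 * ((K1 + K2 + 1) * (b * ?q X + a * ?s' + b * norm N))"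
        using C_contr \<gamma>\<rho> K5(1) dX'
        by (intro add_mono norm_matrix_mult_le_wnorm_op[OF norm_inv(2)] order_trans[OF K5(2)] mult_left_mono) auto
      also have "\<dots> \<le> (1 - c) * ?p Y + \<kappa> * (b * ?q X + a * ?s' + b * norm N)"
        unfolding mult.assoc[of K5, symmetric] using c(3) a b \<kappa>(2)
        by (intro add_mono mult_right_mono) (auto intro!: add_nonneg_nonneg mult_nonneg_nonneg)
      finally show ?thesis .
    qed
    have "a \<le> c\<^sup>2 / (48 * \<kappa>\<^sup>2) * b"
      using a(2) mult_right_mono[OF \<epsilon>(2), of b] b by linarith
    moreover have "b \<le> c\<^sup>2 / (48 * \<kappa>\<^sup>2)" using b \<epsilon> by linarith
    ultimately have "(?p (mix \<gamma> C ** Y + ?G X' - ?G X))\<^sup>2 + (?q X0)\<^sup>2 + (?r X0)\<^sup>2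
      \<le> (1 - a * c / 2) * ((?p Y)\<^sup>2 + (?q X)\<^sup>2 + (?r X)\<^sup>2) + 18 * \<kappa>\<^sup>2 / c * (a * (norm D)\<^sup>2 + b\<^sup>2 * (norm N)\<^sup>2)"
      using c \<kappa> a b p' q' r' by (intro lyapunov_coupling) auto
    then show "(?p (mix \<gamma> C ** Y + ?G (mix b R ** X - a *\<^sub>R (Y + D) + b *\<^sub>R N) - ?G X))\<^sup>2
        + (?q (mix b R ** X - a *\<^sub>R (Y + D)))\<^sup>2 + (?r (mix b R ** X - a *\<^sub>R (Y + D)))\<^sup>2
      \<le> (1 - a * (c / 2)) * ((?p Y)\<^sup>2 + (?q X)\<^sup>2 + (?r X)\<^sup>2) + 18 * \<kappa>\<^sup>2 / c * (a * (norm D)\<^sup>2 + b\<^sup>2 * (norm N)\<^sup>2)"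
      by (simp add: X'_def X0_def)
  qed (use c \<kappa> \<epsilon> in auto)
qed

end

section \<open>Square-integrable random vectors\<close>

definition sq_integrable :: "'a measure \<Rightarrow> ('a \<Rightarrow> 'b::euclidean_space) \<Rightarrow> bool" where
  "sq_integrable M X \<longleftrightarrow> X \<in> borel_measurable M \<and> integrable M (\<lambda>\<omega>. (norm (X \<omega>))\<^sup>2)"

lemma sq_integrableD:
  assumes "sq_integrable M X"
  shows "X \<in> borel_measurable M" "integrable M (\<lambda>\<omega>. (norm (X \<omega>))\<^sup>2)"
  using assms by (auto simp: sq_integrable_def)

lemma sq_integrable_bound:
  assumes "X \<in> borel_measurable M" "sq_integrable M Y" "\<And>\<omega>. norm (X \<omega>) \<le> K * norm (Y \<omega>)"
  shows "sq_integrable M X"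
proof -
  have int: "integrable M (\<lambda>\<omega>. K\<^sup>2 * (norm (Y \<omega>))\<^sup>2)"
    using assms by (auto simp: sq_integrable_def)
  have le: "(norm (X \<omega>))\<^sup>2 \<le> K\<^sup>2 * (norm (Y \<omega>))\<^sup>2" for \<omega>
    using power_mono[OF assms(3)[of \<omega>], of 2] by (simp add: power_mult_distrib)
  have "integrable M (\<lambda>\<omega>. (norm (X \<omega>))\<^sup>2)"
    by (rule Bochner_Integration.integrable_bound[OF int]) (use assms(1) le in auto)
  with assms(1) show ?thesis by (simp add: sq_integrable_def)
qed

lemma sq_integrable_linear:
  assumes "bounded_linear T" "sq_integrable M X"
  shows "sq_integrable M (\<lambda>\<omega>. T (X \<omega>))"
proof -
  obtain K where "\<And>x. norm (T x) \<le> norm x * K"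
    using bounded_linear.bounded[OF assms(1)] by blast
  moreover have "(\<lambda>\<omega>. T (X \<omega>)) \<in> borel_measurable M"
    using borel_measurable_continuous_on[OF linear_continuous_on[OF assms(1)] sq_integrableD(1)[OF assms(2)]]
    by simp
  ultimately show ?thesis
    by (intro sq_integrable_bound[OF _ assms(2), of _ K]) (auto simp: mult.commute)
qed

lemma norm_add_sq_le: "(norm (a + b))\<^sup>2 \<le> 2 * (norm a)\<^sup>2 + 2 * (norm (b::'a::real_normed_vector))\<^sup>2"
proof -
  have "(norm (a + b))\<^sup>2 \<le> (norm a + norm b)\<^sup>2"
    by (intro power_mono norm_triangle_ineq) auto
  also have "\<dots> \<le> 2 * (norm a)\<^sup>2 + 2 * (norm b)\<^sup>2"
    using zero_le_power2[of "norm a - norm b"] by (simp add: power2_eq_square algebra_simps)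
  finally show ?thesis .
qed

lemma sq_integrable_add:
  assumes "sq_integrable M X" "sq_integrable M Y"
  shows "sq_integrable M (\<lambda>\<omega>. X \<omega> + Y \<omega>)"
proof -
  have meas: "(\<lambda>\<omega>. X \<omega> + Y \<omega>) \<in> borel_measurable M"
    using assms by (auto simp: sq_integrable_def)
  have "integrable M (\<lambda>\<omega>. 2 * (norm (X \<omega>))\<^sup>2 + 2 * (norm (Y \<omega>))\<^sup>2)"
    using assms by (auto simp: sq_integrable_def)
  then have "integrable M (\<lambda>\<omega>. (norm (X \<omega> + Y \<omega>))\<^sup>2)"
    by (rule Bochner_Integration.integrable_bound) (use meas norm_add_sq_le in auto)
  with meas show ?thesis by (simp add: sq_integrable_def)
qed

lemma sq_integrable_scaleR: "sq_integrable M X \<Longrightarrow> sq_integrable M (\<lambda>\<omega>. c *\<^sub>R X \<omega>)"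
  by (rule sq_integrable_linear[OF bounded_linear_scaleR_right])

lemma sq_integrable_diff:
  "sq_integrable M X \<Longrightarrow> sq_integrable M Y \<Longrightarrow> sq_integrable M (\<lambda>\<omega>. X \<omega> - Y \<omega>)"
  using sq_integrable_add[of M X "\<lambda>\<omega>. (-1) *\<^sub>R Y \<omega>"] sq_integrable_scaleR[of M Y "-1"] by simp

lemma (in finite_measure) sq_integrable_const: "sq_integrable M (\<lambda>_. c)"
  by (simp add: sq_integrable_def)

text \<open>Subtracting \<open>g 0\<close> leaves a function bounded linearly by \<open>X\<close>;
  the constant is square integrable because the measure is finite.\<close>

lemma (in finite_measure) sq_integrable_lipschitz:
  assumes "\<And>x y. norm (g x - g y) \<le> K * norm (x - y)" "sq_integrable M X"
    and "g \<in> borel_measurable borel"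
  shows "sq_integrable M (\<lambda>\<omega>. g (X \<omega>))"
proof -
  have "(\<lambda>\<omega>. g (X \<omega>) - g 0) \<in> borel_measurable M"
    using assms sq_integrableD(1)[OF assms(2)] by measurable
  then have "sq_integrable M (\<lambda>\<omega>. g (X \<omega>) - g 0)"
    using assms(1)[of _ 0] by (intro sq_integrable_bound[OF _ assms(2), of _ K]) auto
  from sq_integrable_add[OF this sq_integrable_const[of "g 0"]] show ?thesis by simp
qed

lemma sq_integrable_cong:
  assumes "\<And>\<omega>. \<omega> \<in> space M \<Longrightarrow> X \<omega> = Y \<omega>"
  shows "sq_integrable M X \<longleftrightarrow> sq_integrable M Y"
proof -
  have "X \<in> borel_measurable M \<longleftrightarrow> Y \<in> borel_measurable M"
    using assms by (intro measurable_cong) auto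
  moreover have "integrable M (\<lambda>\<omega>. (norm (X \<omega>))\<^sup>2) \<longleftrightarrow> integrable M (\<lambda>\<omega>. (norm (Y \<omega>))\<^sup>2)"
    using assms by (intro Bochner_Integration.integrable_cong) auto
  ultimately show ?thesis by (simp add: sq_integrable_def)
qed

text \<open>Writes a matrix as a sum of linear images of its rows, which carries measurability from
  the rows to the matrix.\<close>

lemma matrix_rows_sum: "(X :: real^'d^'n) = (\<Sum>i\<in>UNIV. outer (axis i 1) (X $ i))"
proof -
  have "(\<Sum>k\<in>UNIV. axis k 1 $ i * X $ k $ j) = (\<Sum>k\<in>UNIV. if k = i then X $ k $ j else 0)" for i j
    by (intro sum.cong) (auto simp: axis_def)
  then show ?thesis by (simp add: vec_eq_iff outer_def)
qed

lemma borel_measurable_rows: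
  fixes X :: "'a \<Rightarrow> real^'d^'n"
  assumes "\<And>i. (\<lambda>\<omega>. X \<omega> $ i) \<in> borel_measurable M"
  shows "X \<in> borel_measurable M"
proof -
  have "(\<lambda>\<omega>. outer (axis i 1 :: real^'n) (X \<omega> $ i)) \<in> borel_measurable M" for i
    by (rule borel_measurable_continuous_on[OF linear_continuous_on[OF bounded_linear_outer] assms])
  then have "(\<lambda>\<omega>. \<Sum>i\<in>UNIV. outer (axis i 1 :: real^'n) (X \<omega> $ i)) \<in> borel_measurable M"
    by simp
  then show ?thesis by (simp flip: matrix_rows_sum)
qed

lemma norm_matrix_sq: "(norm (X :: real^'d^'n))\<^sup>2 = (\<Sum>i\<in>UNIV. (norm (X $ i))\<^sup>2)"
  by (simp add: norm_vec_def L2_set_def sum_nonneg)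

lemma sq_integrable_rows:
  fixes X :: "'a \<Rightarrow> real^'d^'n"
  assumes "\<And>i. sq_integrable M (\<lambda>\<omega>. X \<omega> $ i)"
  shows "sq_integrable M X"
  using assms borel_measurable_rows[of X M] by (auto simp: sq_integrable_def norm_matrix_sq)

lemma (in finite_measure) sq_integrable_integrable:
  assumes "sq_integrable M X" shows "integrable M X"
proof (rule Bochner_Integration.integrable_bound)
  show "integrable M (\<lambda>\<omega>. 1 + (norm (X \<omega>))\<^sup>2)" "X \<in> borel_measurable M"
    using assms by (auto simp: sq_integrable_def)
  have "norm (X \<omega>) \<le> 1 + (norm (X \<omega>))\<^sup>2" for \<omega>
    using zero_le_power2[of "norm (X \<omega>) - 1"] norm_ge_zero[of "X \<omega>"]
    unfolding power2_diff power_one by linarith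
  then show "AE \<omega> in M. norm (X \<omega>) \<le> norm (1 + (norm (X \<omega>))\<^sup>2)"
    by auto
qed

text \<open>The cross term vanishes: coordinatewise it is the expectation of a product of
  independent variables, one of which has mean zero.\<close>

lemma (in prob_space) expectation_norm_add_sq_indep:
  fixes P Z :: "'a \<Rightarrow> 'b::euclidean_space"
  assumes indep: "indep_var borel P borel Z"
    and sq: "sq_integrable M P" "sq_integrable M Z" and mean: "expectation Z = 0"
  shows "expectation (\<lambda>\<omega>. (norm (P \<omega> + Z \<omega>))\<^sup>2)
    = expectation (\<lambda>\<omega>. (norm (P \<omega>))\<^sup>2) + expectation (\<lambda>\<omega>. (norm (Z \<omega>))\<^sup>2)"
proof -
  have int: "integrable M P" "integrable M Z" using sq by (auto intro: sq_integrable_integrable)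
  have "integrable M (\<lambda>\<omega>. inner (P \<omega>) b * inner (Z \<omega>) b) \<and> expectation (\<lambda>\<omega>. inner (P \<omega>) b * inner (Z \<omega>) b) = 0"
    for b
  proof -
    have ind: "indep_var borel (\<lambda>\<omega>. inner (P \<omega>) b) borel (\<lambda>\<omega>. inner (Z \<omega>) b)"
      using indep_var_compose[OF indep, of "\<lambda>x. inner x b" borel "\<lambda>x. inner x b" borel] by (simp add: comp_def)
    have i: "integrable M (\<lambda>\<omega>. inner (P \<omega>) b)" "integrable M (\<lambda>\<omega>. inner (Z \<omega>) b)"
      using int by auto
    have "expectation (\<lambda>\<omega>. inner (Z \<omega>) b) = 0" using int mean by simp
    then show ?thesis
      using indep_var_integrable[OF ind i] indep_var_lebesgue_integral[OF ind i] by simp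
  qed
  then have cross: "integrable M (\<lambda>\<omega>. inner (P \<omega>) (Z \<omega>))" "expectation (\<lambda>\<omega>. inner (P \<omega>) (Z \<omega>)) = 0"
    by (auto simp: euclidean_inner[of "P _" "Z _"] Bochner_Integration.integral_sum)
  have "(norm (P \<omega> + Z \<omega>))\<^sup>2 = (norm (P \<omega>))\<^sup>2 + (norm (Z \<omega>))\<^sup>2 + 2 * inner (P \<omega>) (Z \<omega>)" for \<omega>
    unfolding power2_norm_eq_inner by (simp add: inner_add_left inner_add_right inner_commute)
  then show ?thesis using sq cross by (simp add: sq_integrable_def)
qed

section \<open>The past generated by initial values and part of the noise\<close>

text \<open>The join of the sigma-algebras of \<open>X\<close> and of the block \<open>T\<close> of
  \<open>Y\<close>. Intersections instead of a union serve as generators, so that the generating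
  class is intersection-stable.\<close>

definition history ::
  "'a measure \<Rightarrow> ('a \<Rightarrow> 'x::topological_space) \<Rightarrow> ('i \<Rightarrow> 'a \<Rightarrow> 'y::topological_space) \<Rightarrow> 'i set \<Rightarrow> 'a measure" where
  "history M X Y T = sigma (space M)
    {a \<inter> b | a b. a \<in> sets (vimage_algebra (space M) X borel)
       \<and> b \<in> sets (vimage_algebra (space M) (\<lambda>\<omega>. restrict (\<lambda>i. Y i \<omega>) T) (PiM T (\<lambda>_. borel)))}"

lemma sets_vimage_algebra_subset_Pow: "sets (vimage_algebra \<Omega> X N) \<subseteq> Pow \<Omega>"
  using sets.space_closed[of "vimage_algebra \<Omega> X N"] by simp

lemma space_history [simp]: "space (history M X Y T) = space M"
  unfolding history_def by (rule space_measure_of) (use sets_vimage_algebra_subset_Pow in blast)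

lemma sets_history:
  "sets (history M X Y T) = sigma_sets (space M)
    {a \<inter> b | a b. a \<in> sets (vimage_algebra (space M) X borel)
       \<and> b \<in> sets (vimage_algebra (space M) (\<lambda>\<omega>. restrict (\<lambda>i. Y i \<omega>) T) (PiM T (\<lambda>_. borel)))}"
  unfolding history_def by (rule sets_measure_of) (use sets_vimage_algebra_subset_Pow in blast)

lemma measurable_history_initial: "X \<in> measurable (history M X Y T) borel"
proof (rule measurableI)
  fix A :: "'b set" assume "A \<in> sets borel"
  then have "X -` A \<inter> space M \<in> sets (vimage_algebra (space M) X borel)"
    by (rule in_vimage_algebra)
  moreover have "space M \<in> sets (vimage_algebra (space M) (\<lambda>\<omega>. restrict (\<lambda>i. Y i \<omega>) T) (PiM T (\<lambda>_. borel)))"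
    by (metis sets.top space_vimage_algebra)
  moreover have "X -` A \<inter> space M = (X -` A \<inter> space M) \<inter> space M" by blast
  ultimately show "X -` A \<inter> space (history M X Y T) \<in> sets (history M X Y T)"
    unfolding sets_history space_history by (intro sigma_sets.Basic) blast
qed auto

lemma measurable_history_noise:
  assumes "i \<in> T" shows "Y i \<in> measurable (history M X Y T) borel"
proof (rule measurableI)
  fix A :: "'c set" assume A: "A \<in> sets borel"
  let ?f = "\<lambda>\<omega>. restrict (\<lambda>i. Y i \<omega>) T"
  have "(\<lambda>y. y i) -` A \<inter> space (PiM T (\<lambda>_. borel)) \<in> sets (PiM T (\<lambda>_. borel))"
    using A measurable_component_singleton[OF assms] by (rule measurable_sets[rotated])
  then have "?f -` ((\<lambda>y. y i) -` A \<inter> space (PiM T (\<lambda>_. borel))) \<inter> space M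
      \<in> sets (vimage_algebra (space M) ?f (PiM T (\<lambda>_. borel)))"
    by (rule in_vimage_algebra)
  moreover have "?f -` ((\<lambda>y. y i) -` A \<inter> space (PiM T (\<lambda>_. borel))) \<inter> space M = Y i -` A \<inter> space M"
    using assms by (auto simp: space_PiM)
  ultimately have 1: "Y i -` A \<inter> space M \<in> sets (vimage_algebra (space M) ?f (PiM T (\<lambda>_. borel)))"
    by simp
  have 2: "space M \<in> sets (vimage_algebra (space M) X borel)"
    by (metis sets.top space_vimage_algebra)
  have 3: "Y i -` A \<inter> space M = space M \<inter> (Y i -` A \<inter> space M)" by blast
  show "Y i -` A \<inter> space (history M X Y T) \<in> sets (history M X Y T)"
    unfolding sets_history space_history using 1 2 3 by (intro sigma_sets.Basic CollectI) metis
qed auto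

text \<open>The initial values are independent of all noise, and the blocks \<open>T\<close> and
  \<open>S\<close> of each other, so probabilities factorise on the generators of the past;
  intersection stability extends this to the generated sigma-algebras.\<close>

lemma (in prob_space) indep_history:
  fixes X :: "'a \<Rightarrow> 'x::topological_space" and Y :: "'i \<Rightarrow> 'a \<Rightarrow> 'y::topological_space"
  assumes Y: "indep_vars (\<lambda>_. borel) Y I" and X: "X \<in> borel_measurable M"
    and XY: "indep_set (sets (vimage_algebra (space M) X borel))
       (sets (vimage_algebra (space M) (\<lambda>\<omega>. restrict (\<lambda>i. Y i \<omega>) I) (PiM I (\<lambda>_. borel))))"
    and ST: "S \<inter> T = {}" "S \<subseteq> I" "T \<subseteq> I"
    and P: "P \<in> measurable (history M X Y T) N"
    and Z: "Z \<in> measurable (vimage_algebra (space M) (\<lambda>\<omega>. restrict (\<lambda>i. Y i \<omega>) S) (PiM S (\<lambda>_. borel))) N'"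
  shows "indep_var N P N' Z"
proof -
  define A where "A = sets (vimage_algebra (space M) X borel)"
  define f where "f J \<omega> = restrict (\<lambda>i. Y i \<omega>) J" for J \<omega>
  define B where "B J = sets (vimage_algebra (space M) (f J) (PiM J (\<lambda>_. borel)))" for J
  define G where "G = {a \<inter> b | a b. a \<in> A \<and> b \<in> B T}"
  have Yi: "Y i \<in> borel_measurable M" if "i \<in> I" for i
    using Y that by (auto simp: indep_vars_def)
  have fJ: "f J \<in> measurable M (PiM J (\<lambda>_. borel))" if "J \<subseteq> I" for J
    unfolding f_def using Yi that by (intro measurable_restrict) auto
  have B_eq: "B J = sigma_sets (space M) {f J -` D \<inter> space M | D. D \<in> sets (PiM J (\<lambda>_. borel))}" for J
    by (simp add: B_def sets_vimage_algebra)
  \<comment> \<open>A block is a function of the full family by restriction, so \<open>XY\<close>,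
    stated for the whole index set, applies to its blocks.\<close>
  have B_mono: "B J \<subseteq> B I" if "J \<subseteq> I" for J
  proof -
    have "f J -` D \<inter> space M \<in> B I" if "D \<in> sets (PiM J (\<lambda>_. borel))" for D
    proof -
      have "(\<lambda>y. restrict y J) -` D \<inter> space (PiM I (\<lambda>_. borel)) \<in> sets (PiM I (\<lambda>_. borel))"
        using that measurable_restrict_subset[OF \<open>J \<subseteq> I\<close>] by (rule measurable_sets[rotated])
      then have "f I -` ((\<lambda>y. restrict y J) -` D \<inter> space (PiM I (\<lambda>_. borel))) \<inter> space M \<in> B I"
        unfolding B_def by (rule in_vimage_algebra)
      moreover have "f I -` ((\<lambda>y. restrict y J) -` D \<inter> space (PiM I (\<lambda>_. borel))) \<inter> space M = f J -` D \<inter> space M"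
        using \<open>J \<subseteq> I\<close> by (auto simp: f_def space_PiM Int_absorb1)
      ultimately show ?thesis by simp
    qed
    moreover have "sigma_algebra (space M) (B I)"
      unfolding B_def by (metis sets.sigma_algebra_axioms space_vimage_algebra)
    ultimately show ?thesis
      unfolding B_eq[of J] by (intro sigma_algebra.sigma_sets_subset) auto
  qed
  have indB: "indep_set (B T) (B S)"
    using indep_var_restrict[OF Y, of T S] ST unfolding indep_var_eq B_eq f_def by (auto simp: Int_commute)
  have indAB: "indep_set A (B I)"
    using XY by (simp add: A_def B_def f_def[abs_def])
  have Bint: "b \<inter> b' \<in> B J" if "b \<in> B J" "b' \<in> B J" for b b' J
    using that unfolding B_def by blast
  \<comment> \<open>The initial event is split off first, then the two noise blocks are separated,
    then the initial event is joined again.\<close>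
  have "indep_set G (B S)"
    unfolding indep_sets2_eq
  proof (intro conjI ballI)
    show "G \<subseteq> events" "B S \<subseteq> events"
      using indB indAB unfolding indep_sets2_eq G_def by auto
    fix g d assume "g \<in> G" "d \<in> B S"
    then obtain a b where ab: "g = a \<inter> b" "a \<in> A" "b \<in> B T" by (auto simp: G_def)
    have "b \<in> B I" "d \<in> B I"
      using ab(3) \<open>d \<in> B S\<close> B_mono[OF ST(2)] B_mono[OF ST(3)] by auto
    then have "b \<inter> d \<in> B I" by (rule Bint)
    then have "prob (g \<inter> d) = prob a * prob (b \<inter> d)"
      using indep_setD[OF indAB ab(2)] ab by (simp add: Int_assoc)
    also have "\<dots> = prob a * prob b * prob d"
      using indep_setD[OF indB ab(3) \<open>d \<in> B S\<close>] by simp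
    also have "prob a * prob b = prob g"
      using indep_setD[OF indAB ab(2) \<open>b \<in> B I\<close>] ab by simp
    finally show "prob (g \<inter> d) = prob g * prob d" .
  qed
  moreover have "Int_stable G"
  proof (rule Int_stableI)
    fix g g' assume "g \<in> G" "g' \<in> G"
    then obtain a b a' b' where g: "g = a \<inter> b" "g' = a' \<inter> b'" and ab: "a \<in> A" "a' \<in> A" "b \<in> B T" "b' \<in> B T"
      by (auto simp: G_def)
    have "g \<inter> g' = (a \<inter> a') \<inter> (b \<inter> b')" using g by blast
    moreover have "a \<inter> a' \<in> A" using ab unfolding A_def by blast
    moreover have "b \<inter> b' \<in> B T" using Bint[OF ab(3,4)] .
    ultimately show "g \<inter> g' \<in> G"
      unfolding G_def by (intro CollectI) metis
  qed
  moreover have "Int_stable (B S)" using Bint by (intro Int_stableI)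
  ultimately have ind: "indep_set (sigma_sets (space M) G) (sigma_sets (space M) (B S))"
    by (rule indep_set_sigma_sets)
  have hist: "sets (history M X Y T) = sigma_sets (space M) G"
    by (simp add: sets_history G_def A_def B_def f_def[abs_def])
  have P': "P -` D \<inter> space M \<in> sigma_sets (space M) G" if "D \<in> sets N" for D
    using measurable_sets[OF P that] by (simp add: hist)
  have Z': "Z -` D \<inter> space M \<in> sigma_sets (space M) (B S)" if "D \<in> sets N'" for D
    using measurable_sets[OF Z that] by (simp add: B_def f_def[abs_def])
  have sub: "sigma_sets (space M) G \<subseteq> events" "sigma_sets (space M) (B S) \<subseteq> events"
    using ind unfolding indep_sets2_eq by auto
  show ?thesis
    unfolding indep_var_eq
  proof (intro conjI)
    show "random_variable N P" "random_variable N' Z"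
      using P' Z' sub measurable_space[OF P] measurable_space[OF Z] by (auto intro!: measurableI)
    have "sigma_sets (space M) {P -` D \<inter> space M | D. D \<in> sets N} \<subseteq> sigma_sets (space M) G"
      using P' by (intro sigma_sets_mono) auto
    moreover have "sigma_sets (space M) {Z -` D \<inter> space M | D. D \<in> sets N'} \<subseteq> sigma_sets (space M) (B S)"
      using Z' by (intro sigma_sets_mono) auto
    ultimately show "indep_set (sigma_sets (space M) {P -` D \<inter> space M | D. D \<in> sets N})
        (sigma_sets (space M) {Z -` D \<inter> space M | D. D \<in> sets N'})"
      using ind unfolding indep_sets2_eq by blast
  qed
qed

section \<open>The iteration with noise\<close>

locale vra_gt_random = vra_gt_data f R C Rhat Chat u v xstar L \<mu> \<gamma> \<rho>R \<rho>C + prob_space M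
  for f :: "'n::finite \<Rightarrow> real^'d::finite \<Rightarrow> real"
    and R C Rhat Chat :: "real^'n^'n"
    and u v :: "real^'n"
    and xstar :: "real^'d"
    and L \<mu> \<gamma> \<rho>R \<rho>C :: real
    and M :: "'a measure" +
  fixes \<xi> \<zeta> x s z y' :: "nat \<Rightarrow> 'a \<Rightarrow> real^'d^'n"
    and \<alpha>s \<beta>s \<eta>s :: "nat \<Rightarrow> real"
    and \<sigma> \<alpha> \<beta> \<eta> a1 a2 a3 :: real
  assumes a_range: "a1 \<in> {0<..1}" "a2 \<in> {0<..1}" "a3 \<in> {0<..1}"
    and exps: "\<eta> \<in> {1/2<..<1}" "\<alpha> \<in> {1/2<..<1}" "\<beta> \<in> {1/2<..<1}" "\<beta> < \<alpha>"
    and \<eta>s: "\<And>k. k \<ge> 1 \<Longrightarrow> \<eta>s k = a1 / real k powr \<eta>"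
    and \<beta>s: "\<And>k. k \<ge> 1 \<Longrightarrow> \<beta>s k = a2 / real k powr \<beta>"
    and \<alpha>s: "\<And>k. k \<ge> 1 \<Longrightarrow> \<alpha>s k = a3 / real k powr \<alpha>"
    and R_contr: "\<And>k. k \<ge> 1 \<Longrightarrow>
        wnorm_op Rhat (mix (\<beta>s k) R - (1 / real CARD('n)) *\<^sub>R outer 1 u) \<le> 1 - \<beta>s k * \<rho>R"
    and indep: "independent_noise M \<xi> \<zeta> (x 1) (s 1)"
    and \<xi>_mean: "\<And>i k. k \<ge> 1 \<Longrightarrow> (\<integral>\<omega>. \<xi> k \<omega> $ i \<partial>M) = 0"
    and \<zeta>_mean: "\<And>i k. k \<ge> 1 \<Longrightarrow> (\<integral>\<omega>. \<zeta> k \<omega> $ i \<partial>M) = 0"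
    and \<xi>_var: "\<And>i k. k \<ge> 1 \<Longrightarrow> integrable M (\<lambda>\<omega>. (norm (\<xi> k \<omega> $ i))\<^sup>2)"
               "\<And>i k. k \<ge> 1 \<Longrightarrow> (\<integral>\<omega>. (norm (\<xi> k \<omega> $ i))\<^sup>2 \<partial>M) \<le> \<sigma>\<^sup>2"
    and \<zeta>_var: "\<And>i k. k \<ge> 1 \<Longrightarrow> integrable M (\<lambda>\<omega>. (norm (\<zeta> k \<omega> $ i))\<^sup>2)"
               "\<And>i k. k \<ge> 1 \<Longrightarrow> (\<integral>\<omega>. (norm (\<zeta> k \<omega> $ i))\<^sup>2 \<partial>M) \<le> \<sigma>\<^sup>2"
    and init_moments: "\<And>i. integrable M (\<lambda>\<omega>. (norm (x 1 \<omega> $ i))\<^sup>2)"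
                      "\<And>i. integrable M (\<lambda>\<omega>. (norm (s 1 \<omega> $ i))\<^sup>2)"
    and iteration: "\<And>\<omega>. \<omega> \<in> space M \<Longrightarrow>
        vra_gt f R C \<gamma> \<alpha>s \<beta>s \<eta>s (\<lambda>k. \<xi> k \<omega>) (\<lambda>k. \<zeta> k \<omega>) (\<lambda>k. x k \<omega>) (\<lambda>k. s k \<omega>) (\<lambda>k. z k \<omega>)"
    and tracker: "\<And>\<omega>. \<omega> \<in> space M \<Longrightarrow> aux_tracker f C \<gamma> (\<lambda>k. x k \<omega>) (\<lambda>k. y' k \<omega>)"
begin

abbreviation G :: "real^'d^'n \<Rightarrow> real^'d^'n" where "G \<equiv> stacked_grad f"

text \<open>Matrix form of the noise sums. The diagonals vanish because a node is no in-neighbour of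
  itself; \<open>NC\<close> has entries 1 because \<zeta> enters without a weight from
  \<open>C\<close>.\<close>

definition NR :: "real^'n^'n" where "NR = (\<chi> i j. if j \<in> in_nbrs R i then R $ i $ j else 0)"
definition NC :: "real^'n^'n" where "NC = (\<chi> i j. if j \<in> in_nbrs C i then 1 else 0)"

subsection \<open>Matrix form and error decomposition\<close>

lemma step_size_pos:
  assumes "k \<ge> 1"
  shows "0 < \<eta>s k" "\<eta>s k \<le> 1" "0 < \<beta>s k" "0 < \<alpha>s k"
proof -
  have "real k powr \<eta> \<ge> 1" using assms exps by (auto intro: ge_one_powr_ge_zero)
  then show "\<eta>s k \<le> 1" using a_range assms by (simp add: \<eta>s field_simps)
qed (use assms a_range in \<open>auto simp: \<eta>s \<beta>s \<alpha>s\<close>)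

lemma iterates_1:
  assumes "\<omega> \<in> space M" shows "z 1 \<omega> = s 1 \<omega>" "y' 1 \<omega> = G (x 1 \<omega>)"
  using iteration[OF assms] tracker[OF assms] by (auto simp: vra_gt_def aux_tracker_def)

lemma y'_Suc:
  assumes "\<omega> \<in> space M" "k \<ge> 1"
  shows "y' (Suc k) \<omega> = mix \<gamma> C ** y' k \<omega> + G (x (Suc k) \<omega>) - G (x k \<omega>)"
  using tracker[OF assms(1)] assms(2) by (simp add: aux_tracker_def)

lemma s_Suc:
  assumes "\<omega> \<in> space M" "k \<ge> 1"
  shows "s (Suc k) \<omega> = (1 - \<gamma>) *\<^sub>R s k \<omega> + \<gamma> *\<^sub>R z k \<omega> + G (x k \<omega>)"
  unfolding vec_eq_iff[of "s (Suc k) \<omega>"]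
  using iteration[OF assms(1)] assms(2) by (simp add: vra_gt_def stacked_grad_def)

lemma x_Suc_s:
  assumes "\<omega> \<in> space M" "k \<ge> 1"
  shows "x (Suc k) \<omega> = mix (\<beta>s k) R ** x k \<omega> - \<alpha>s k *\<^sub>R (s (Suc k) \<omega> - s k \<omega>) + \<beta>s k *\<^sub>R (NR ** \<xi> k \<omega>)"
proof -
  have "(NR ** \<xi> k \<omega>) $ i = (\<Sum>j\<in>in_nbrs R i. R $ i $ j *\<^sub>R \<xi> k \<omega> $ j)" for i
  proof -
    have "(\<Sum>j\<in>UNIV. NR $ i $ j *\<^sub>R \<xi> k \<omega> $ j) = (\<Sum>j\<in>UNIV. if j \<in> in_nbrs R i then R $ i $ j *\<^sub>R \<xi> k \<omega> $ j else 0)"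
      by (intro sum.cong) (auto simp: NR_def)
    then show ?thesis by (simp add: matrix_mult_row sum.If_cases)
  qed
  then show ?thesis
    unfolding vec_eq_iff[of "x (Suc k) \<omega>"]
    using iteration[OF assms(1)] assms(2)
    by (simp add: vra_gt_def mix_mult matrix_mult_row[of R] algebra_simps)
qed

lemma z_Suc:
  assumes "\<omega> \<in> space M" "k \<ge> 1"
  shows "z (Suc k) \<omega> = (1 - \<eta>s k) *\<^sub>R z k \<omega> + C ** (s (Suc k) \<omega> - (1 - \<eta>s k) *\<^sub>R s k \<omega>) + \<eta>s k *\<^sub>R (NC ** \<zeta> (Suc k) \<omega>)"
proof -
  have N: "(NC ** \<zeta> (Suc k) \<omega>) $ i = (\<Sum>j\<in>in_nbrs C i. \<zeta> (Suc k) \<omega> $ j)" for i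
  proof -
    have "(\<Sum>j\<in>UNIV. NC $ i $ j *\<^sub>R \<zeta> (Suc k) \<omega> $ j) = (\<Sum>j\<in>UNIV. if j \<in> in_nbrs C i then \<zeta> (Suc k) \<omega> $ j else 0)"
      by (intro sum.cong) (auto simp: NC_def)
    then show ?thesis by (simp add: matrix_mult_row sum.If_cases)
  qed
  have z1: "z (Suc k) \<omega> $ i = (1 - \<eta>s k) *\<^sub>R z k \<omega> $ i
      + \<eta>s k *\<^sub>R ((\<Sum>j\<in>UNIV. C $ i $ j *\<^sub>R ((s (Suc k) \<omega> $ j - (1 - \<eta>s k) *\<^sub>R s k \<omega> $ j) /\<^sub>R \<eta>s k))
          + (\<Sum>j\<in>in_nbrs C i. \<zeta> (Suc k) \<omega> $ j))" for i
    using iteration[OF assms(1)] assms(2) by (simp add: vra_gt_def)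
  have z2: "\<eta>s k *\<^sub>R ((\<Sum>j\<in>UNIV. C $ i $ j *\<^sub>R ((s (Suc k) \<omega> $ j - (1 - \<eta>s k) *\<^sub>R s k \<omega> $ j) /\<^sub>R \<eta>s k))
          + (\<Sum>j\<in>in_nbrs C i. \<zeta> (Suc k) \<omega> $ j))
      = (C ** (s (Suc k) \<omega> - (1 - \<eta>s k) *\<^sub>R s k \<omega>)) $ i + (\<eta>s k *\<^sub>R (NC ** \<zeta> (Suc k) \<omega>)) $ i" for i
  proof -
    \<comment> \<open>The division by \<open>\<eta>s k\<close> inside the iteration is undone by the
      outer factor, \<open>\<eta>s k\<close> being nonzero.\<close>
    have cancel: "\<eta>s k * (c * inverse (\<eta>s k)) = c" for c
      using step_size_pos(1)[OF assms(2)] by simp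
    show ?thesis
      by (simp add: N cancel matrix_mult_row[of C] scaleR_add_right scaleR_sum_right)
  qed
  show ?thesis
    by (simp only: vec_eq_iff z1 z2 vector_add_component vector_scaleR_component add.assoc simp_thms)
qed

text \<open>
  \<open>sharing_err\<close> is driven by the noise \<open>\<zeta>\<close> alone, and so is the remainder \<open>mixing_err\<close> of the
  tracking variable \<open>s\<^sub>k\<^sub>+\<^sub>1 - s\<^sub>k - y'\<^sub>k - \<gamma> sharing_err\<^sub>k\<close>, which moreover has vanishing average.
\<close>

definition sharing_err :: "nat \<Rightarrow> 'a \<Rightarrow> real^'d^'n" where
  "sharing_err k \<omega> = z k \<omega> - C ** s k \<omega>"

definition mixing_err :: "nat \<Rightarrow> 'a \<Rightarrow> real^'d^'n" where
  "mixing_err k \<omega> = mix \<gamma> C ** s k \<omega> - s k \<omega> + G (x k \<omega>) - y' k \<omega>"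

definition tracking_noise :: "nat \<Rightarrow> 'a \<Rightarrow> real^'d^'n" where
  "tracking_noise k \<omega> = mixing_err k \<omega> + \<gamma> *\<^sub>R sharing_err k \<omega>"

text \<open>\<open>C ** s (Suc k)\<close> cancels, so no gradients enter this recursion.\<close>

lemma sharing_err_Suc:
  assumes "\<omega> \<in> space M" "k \<ge> 1"
  shows "sharing_err (Suc k) \<omega> = (1 - \<eta>s k) *\<^sub>R sharing_err k \<omega> + \<eta>s k *\<^sub>R (NC ** \<zeta> (Suc k) \<omega>)"
  by (simp add: sharing_err_def z_Suc[OF assms] matrix_mult_linear_simps algebra_simps)

lemma s_increment:
  assumes "\<omega> \<in> space M" "k \<ge> 1"
  shows "s (Suc k) \<omega> - s k \<omega> = y' k \<omega> + tracking_noise k \<omega>"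
  by (simp add: tracking_noise_def mixing_err_def sharing_err_def s_Suc[OF assms] mix_mult algebra_simps)

text \<open>The gradients at \<open>x (Suc k)\<close> cancel against those in
  \<open>y' (Suc k)\<close>, and \<open>s_increment\<close> eliminates \<open>s (Suc k)\<close>; a
  linear recursion driven by \<open>sharing_err\<close> remains.\<close>

lemma mixing_err_Suc:
  assumes "\<omega> \<in> space M" "k \<ge> 1"
  shows "mixing_err (Suc k) \<omega> = mix \<gamma> C ** mixing_err k \<omega> + \<gamma> *\<^sub>R (mix \<gamma> C ** sharing_err k \<omega> - sharing_err k \<omega>)"
proof -
  have s: "s (Suc k) \<omega> = s k \<omega> + y' k \<omega> + mixing_err k \<omega> + \<gamma> *\<^sub>R sharing_err k \<omega>"
    using s_increment[OF assms] by (simp add: tracking_noise_def algebra_simps)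
  have "mix \<gamma> C ** s k \<omega> = mixing_err k \<omega> + s k \<omega> - G (x k \<omega>) + y' k \<omega>"
    by (simp add: mixing_err_def)
  then show ?thesis
    by (simp add: mixing_err_def[of "Suc k"] y'_Suc[OF assms] s matrix_mult_linear_simps scaleR_diff_right)
qed

lemma wavg_mix_C: "wavg 1 (mix t C ** X) = wavg 1 X"
  using C_stoch by (intro wavg_matrix_mult mix_left_eigenvector)

text \<open>The invariant of gradient tracking: \<open>C\<close> preserves column sums, so the
  averages of the gradient increments telescope.\<close>

lemma wavg_y':
  assumes "\<omega> \<in> space M" "k \<ge> 1" shows "wavg 1 (y' k \<omega>) = wavg 1 (G (x k \<omega>))"
  using assms(2)
proof (induction k rule: dec_induct)
  case base
  then show ?case using iterates_1[OF assms(1)] by simp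
next
  case (step k)
  then show ?case by (simp add: y'_Suc[OF assms(1)] matrix_mult_linear_simps wavg_mix_C)
qed

text \<open>On matrices of average zero, \<open>mix \<gamma> C\<close> agrees with its deflation by
  \<open>outer v 1\<close>, which contracts in the norm of \<open>Chat\<close>.\<close>

lemma wavg_mixing_err:
  assumes "\<omega> \<in> space M" "k \<ge> 1" shows "wavg 1 (mixing_err k \<omega>) = 0"
  by (simp add: mixing_err_def matrix_mult_linear_simps wavg_mix_C wavg_y'[OF assms])

subsection \<open>Measurability and second moments\<close>

text \<open>
  Used twice: with \<open>Q\<close> measurability with respect to the past, and with \<open>Q\<close> square integrability.
\<close>

lemma iterates_induct:
  assumes cong: "\<And>X Y. (\<And>\<omega>. \<omega> \<in> space M \<Longrightarrow> X \<omega> = Y \<omega>) \<Longrightarrow> Q Y \<Longrightarrow> Q X"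
    and add: "\<And>X Y. Q X \<Longrightarrow> Q Y \<Longrightarrow> Q (\<lambda>\<omega>. X \<omega> + Y \<omega>)"
    and lin: "\<And>T X. bounded_linear T \<Longrightarrow> Q X \<Longrightarrow> Q (\<lambda>\<omega>. T (X \<omega>))"
    and grad: "\<And>X. Q X \<Longrightarrow> Q (\<lambda>\<omega>. G (X \<omega>))"
    and init: "Q (x 1)" "Q (s 1)"
    and noise: "\<And>j. 1 \<le> j \<Longrightarrow> j < K \<Longrightarrow> Q (\<xi> j)" "\<And>j. 1 \<le> j \<Longrightarrow> j \<le> K \<Longrightarrow> Q (\<zeta> j)"
    and k: "1 \<le> k" "k \<le> K"
  shows "Q (x k) \<and> Q (y' k) \<and> Q (sharing_err k) \<and> Q (tracking_noise k)"
proof -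
  have scale: "Q (\<lambda>\<omega>. c *\<^sub>R X \<omega>)" if "Q X" for c X
    using lin[OF bounded_linear_scaleR_right that] .
  have diff: "Q (\<lambda>\<omega>. X \<omega> - Y \<omega>)" if "Q X" "Q Y" for X Y
    using add[OF that(1) scale[OF that(2), of "-1"]] by simp
  have mult: "Q (\<lambda>\<omega>. A ** X \<omega>)" if "Q X" for A X
    using lin[OF bounded_linear_matrix_mult that] .
  note closed = add diff scale mult grad
  have Q: "Q (x k) \<and> Q (s k) \<and> Q (z k) \<and> Q (y' k)"
    using k
  proof (induction k rule: dec_induct)
    case base
    have "Q (z 1)" "Q (y' 1)"
      using cong[OF iterates_1(1) init(2)] cong[OF iterates_1(2) grad[OF init(1)]] by blast+
    with init show ?case by blast
  next
    case (step k)
    then have IH: "Q (x k)" "Q (s k)" "Q (z k)" "Q (y' k)" and k: "k \<ge> 1" "Suc k \<le> K" by auto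
    have s: "Q (s (Suc k))"
      by (rule cong, erule s_Suc[OF _ k(1)]) (intro closed IH)
    have x: "Q (x (Suc k))"
      by (rule cong, erule x_Suc_s[OF _ k(1)]) (intro closed IH s noise, use k in auto)
    have z: "Q (z (Suc k))"
      by (rule cong, erule z_Suc[OF _ k(1)]) (intro closed IH s noise, use k in auto)
    have "Q (y' (Suc k))"
      by (rule cong, erule y'_Suc[OF _ k(1)]) (intro closed IH x)
    with s x z show ?case by blast
  qed
  have e: "Q (sharing_err k)"
    unfolding sharing_err_def[abs_def] using Q by (intro closed) auto
  have "Q (mixing_err k)"
    unfolding mixing_err_def[abs_def] using Q by (intro closed) auto
  with e have "Q (tracking_noise k)"
    unfolding tracking_noise_def[abs_def] by (intro closed) auto
  with Q e show ?thesis by blast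
qed

lemma G_lipschitz: "norm (G X - G Z) \<le> \<bar>L\<bar> * norm (X - Z)"
  by (rule norm_stacked_grad_diff_le[OF smooth])

lemma G_measurable [measurable]: "G \<in> borel_measurable borel"
proof -
  have "\<bar>L\<bar>-lipschitz_on UNIV G"
    using G_lipschitz by (intro lipschitz_onI) (auto simp: dist_norm)
  then show ?thesis
    by (intro borel_measurable_continuous_onI lipschitz_on_continuous_on)
qed

section \<open>The noise family and the past of the iterates\<close>

lemma noise_indep: "indep_vars (\<lambda>_. borel) (noise_family \<xi> \<zeta>) noise_index"
  and initial_measurable: "(\<lambda>\<omega>. (x 1 \<omega>, s 1 \<omega>)) \<in> borel_measurable M"
  using indep by (auto simp: independent_noise_def)

lemma noise_rows_measurable:
  assumes "k \<ge> 1"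
  shows "(\<lambda>\<omega>. \<xi> k \<omega> $ i) \<in> borel_measurable M" "(\<lambda>\<omega>. \<zeta> k \<omega> $ i) \<in> borel_measurable M"
proof -
  have "noise_family \<xi> \<zeta> j \<in> borel_measurable M" if "j \<in> noise_index" for j
    using noise_indep that by (auto simp: indep_vars_def)
  from this[of "Inl (i, k)"] this[of "Inr (i, k)"] assms
  show "(\<lambda>\<omega>. \<xi> k \<omega> $ i) \<in> borel_measurable M" "(\<lambda>\<omega>. \<zeta> k \<omega> $ i) \<in> borel_measurable M"
    by (auto simp: noise_index_def noise_family_def[abs_def])
qed

lemma noise_sq_integrable:
  assumes "k \<ge> 1" shows "sq_integrable M (\<xi> k)" "sq_integrable M (\<zeta> k)"
  using noise_rows_measurable[OF assms] \<xi>_var(1)[OF assms] \<zeta>_var(1)[OF assms]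
    sq_integrable_rows[of M "\<xi> k"] sq_integrable_rows[of M "\<zeta> k"]
  by (simp_all add: sq_integrable_def)

lemma initial_sq_integrable: "sq_integrable M (x 1)" "sq_integrable M (s 1)"
proof -
  have "x 1 \<in> borel_measurable M" "s 1 \<in> borel_measurable M"
    using measurable_compose[OF initial_measurable borel_measurable_continuous_onI[OF continuous_on_fst[OF continuous_on_id]]]
      measurable_compose[OF initial_measurable borel_measurable_continuous_onI[OF continuous_on_snd[OF continuous_on_id]]]
    by auto
  then show "sq_integrable M (x 1)" "sq_integrable M (s 1)"
    using init_moments by (auto simp: sq_integrable_def norm_matrix_sq)
qed

lemma iterates_sq_integrable:
  assumes "k \<ge> 1"
  shows "sq_integrable M (x k)" "sq_integrable M (y' k)" "sq_integrable M (sharing_err k)"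
    "sq_integrable M (tracking_noise k)"
proof -
  have 1: "sq_integrable M X" if "\<And>\<omega>. \<omega> \<in> space M \<Longrightarrow> X \<omega> = Y \<omega>" "sq_integrable M Y"
    for X Y :: "'a \<Rightarrow> real^'d^'n"
    using sq_integrable_cong[of M X Y] that by blast
  have 2: "sq_integrable M (\<lambda>\<omega>. G (X \<omega>))" if "sq_integrable M X" for X
    by (rule sq_integrable_lipschitz[OF G_lipschitz that G_measurable])
  have "sq_integrable M (x k) \<and> sq_integrable M (y' k) \<and> sq_integrable M (sharing_err k) \<and> sq_integrable M (tracking_noise k)"
  proof (rule iterates_induct[where Q = "sq_integrable M" and K = k])
    show "sq_integrable M X" if "\<And>\<omega>. \<omega> \<in> space M \<Longrightarrow> X \<omega> = Y \<omega>" "sq_integrable M Y" for X Y :: "'a \<Rightarrow> real^'d^'n"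
      using that by (rule 1)
    show "sq_integrable M (\<lambda>\<omega>. X \<omega> + Y \<omega>)" if "sq_integrable M X" "sq_integrable M Y" for X Y :: "'a \<Rightarrow> real^'d^'n"
      using that by (rule sq_integrable_add)
    show "sq_integrable M (\<lambda>\<omega>. T (X \<omega>))" if "bounded_linear T" "sq_integrable M X" for T :: "real^'d^'n \<Rightarrow> real^'d^'n" and X
      using that by (rule sq_integrable_linear)
    show "sq_integrable M (\<lambda>\<omega>. G (X \<omega>))" if "sq_integrable M X" for X
      using that by (rule 2)
    show "sq_integrable M (\<xi> j)" if "1 \<le> j" "j < k" for j
      using that by (intro noise_sq_integrable)
    show "sq_integrable M (\<zeta> j)" if "1 \<le> j" "j \<le> k" for j
      using that by (intro noise_sq_integrable)
  qed (use initial_sq_integrable assms in auto)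
  then show "sq_integrable M (x k)" "sq_integrable M (y' k)" "sq_integrable M (sharing_err k)"
    "sq_integrable M (tracking_noise k)" by auto
qed

text \<open>What may enter the iterates at time \<open>k\<close>: \<open>\<xi> k\<close> first acts
  on \<open>x (Suc k)\<close>, whereas \<open>\<zeta> k\<close> already sits in \<open>z k\<close>
  when \<open>k \<ge> 2\<close>. Hence the two different cuts, which leave \<open>\<xi> k\<close>
  and \<open>\<zeta> (Suc k)\<close> fresh.\<close>

definition past :: "nat \<Rightarrow> 'a measure" where
  "past k = history M (\<lambda>\<omega>. (x 1 \<omega>, s 1 \<omega>)) (noise_family \<xi> \<zeta>)
     (Inl ` (UNIV \<times> {1..<k}) \<union> Inr ` (UNIV \<times> {1..k}))"

lemma iterates_past_measurable:
  assumes "k \<ge> 1"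
  shows "x k \<in> borel_measurable (past k)" "y' k \<in> borel_measurable (past k)"
    "sharing_err k \<in> borel_measurable (past k)" "tracking_noise k \<in> borel_measurable (past k)"
proof -
  let ?Q = "\<lambda>X :: 'a \<Rightarrow> real^'d^'n. X \<in> borel_measurable (past k)"
  have 1: "?Q X" if "\<And>\<omega>. \<omega> \<in> space M \<Longrightarrow> X \<omega> = Y \<omega>" "?Q Y" for X Y
    using measurable_cong[of "past k" X Y borel] that by (simp add: past_def)
  have 2: "?Q (\<lambda>\<omega>. T (X \<omega>))" if "bounded_linear T" "?Q X" for T :: "real^'d^'n \<Rightarrow> real^'d^'n" and X
    by (rule borel_measurable_continuous_on[OF linear_continuous_on[OF that(1)] that(2)])
  have "(\<lambda>\<omega>. (x 1 \<omega>, s 1 \<omega>)) \<in> borel_measurable (past k)"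
    unfolding past_def by (rule measurable_history_initial)
  then have 3: "?Q (x 1)" "?Q (s 1)"
    using borel_measurable_continuous_on[OF continuous_on_fst[OF continuous_on_id], of "\<lambda>\<omega>. (x 1 \<omega>, s 1 \<omega>)" "past k"]
      borel_measurable_continuous_on[OF continuous_on_snd[OF continuous_on_id], of "\<lambda>\<omega>. (x 1 \<omega>, s 1 \<omega>)" "past k"]
    by auto
  have 4: "?Q (\<xi> j)" if "1 \<le> j" "j < k" for j
  proof (rule borel_measurable_rows)
    fix i show "(\<lambda>\<omega>. \<xi> j \<omega> $ i) \<in> borel_measurable (past k)"
      using measurable_history_noise[of "Inl (i, j)" "Inl ` (UNIV \<times> {1..<k}) \<union> Inr ` (UNIV \<times> {1..k})"
          "noise_family \<xi> \<zeta>" M] that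
      by (auto simp: past_def noise_family_def[abs_def])
  qed
  have 5: "?Q (\<zeta> j)" if "1 \<le> j" "j \<le> k" for j
  proof (rule borel_measurable_rows)
    fix i show "(\<lambda>\<omega>. \<zeta> j \<omega> $ i) \<in> borel_measurable (past k)"
      using measurable_history_noise[of "Inr (i, j)" "Inl ` (UNIV \<times> {1..<k}) \<union> Inr ` (UNIV \<times> {1..k})"
          "noise_family \<xi> \<zeta>" M] that
      by (auto simp: past_def noise_family_def[abs_def])
  qed
  have 6: "?Q (\<lambda>\<omega>. X \<omega> + Y \<omega>)" if "?Q X" "?Q Y" for X Y
    using that by measurable
  have 7: "?Q (\<lambda>\<omega>. G (X \<omega>))" if "?Q X" for X
    using that by measurable
  have "?Q (x k) \<and> ?Q (y' k) \<and> ?Q (sharing_err k) \<and> ?Q (tracking_noise k)"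
  proof (rule iterates_induct[where Q = ?Q and K = k])
    show "?Q X" if "\<And>\<omega>. \<omega> \<in> space M \<Longrightarrow> X \<omega> = Y \<omega>" "?Q Y" for X Y :: "'a \<Rightarrow> real^'d^'n"
      using that by (rule 1)
    show "?Q (\<lambda>\<omega>. X \<omega> + Y \<omega>)" if "?Q X" "?Q Y" for X Y :: "'a \<Rightarrow> real^'d^'n"
      using that by (rule 6)
    show "?Q (\<lambda>\<omega>. T (X \<omega>))" if "bounded_linear T" "?Q X" for T :: "real^'d^'n \<Rightarrow> real^'d^'n" and X
      using that by (rule 2)
    show "?Q (\<lambda>\<omega>. G (X \<omega>))" if "?Q X" for X
      using that by (rule 7)
    show "?Q (\<xi> j)" if "1 \<le> j" "j < k" for j
      using that by (intro 4)
    show "?Q (\<zeta> j)" if "1 \<le> j" "j \<le> k" for j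
      using that by (intro 5)
  qed (use 3 assms in auto)
  then show "x k \<in> borel_measurable (past k)" "y' k \<in> borel_measurable (past k)"
    "sharing_err k \<in> borel_measurable (past k)" "tracking_noise k \<in> borel_measurable (past k)"
    by auto
qed

lemma noise_indep_past:
  assumes "k \<ge> 1" "P \<in> borel_measurable (past k)" "bounded_linear T"
  shows "indep_var borel P borel (\<lambda>\<omega>. T (\<xi> k \<omega>))"
    and "indep_var borel P borel (\<lambda>\<omega>. T (\<zeta> (Suc k) \<omega>))"
proof -
  let ?T = "Inl ` (UNIV \<times> {1..<k}) \<union> Inr ` (UNIV \<times> {1..k}) :: (('n \<times> nat) + ('n \<times> nat)) set"
  \<comment> \<open>One argument for both kinds of noise: \<open>S\<close> collects the indices of
    the rows of \<open>N\<close>, all outside the past.\<close>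
  have gen: "indep_var borel P borel (\<lambda>\<omega>. T (N \<omega>))"
    if S: "S \<inter> ?T = {}" "S \<subseteq> noise_index"
      and N: "\<And>i. \<exists>j\<in>S. (\<lambda>\<omega>. N \<omega> $ i) = noise_family \<xi> \<zeta> j"
    for S and N :: "'a \<Rightarrow> real^'d^'n"
  proof (rule indep_history[OF noise_indep initial_measurable _ S])
    let ?f = "\<lambda>\<omega>. restrict (\<lambda>j. noise_family \<xi> \<zeta> j \<omega>) S"
    let ?V = "vimage_algebra (space M) ?f (PiM S (\<lambda>_. borel))"
    show "indep_set (sets (vimage_algebra (space M) (\<lambda>\<omega>. (x 1 \<omega>, s 1 \<omega>)) borel))
     (sets (vimage_algebra (space M) (\<lambda>\<omega>. restrict (\<lambda>a. noise_family \<xi> \<zeta> a \<omega>) noise_index)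
          (PiM noise_index (\<lambda>_. borel))))"
      using indep by (simp add: independent_noise_def)
    show "?T \<subseteq> noise_index" by (auto simp: noise_index_def)
    show "P \<in> borel_measurable (history M (\<lambda>\<omega>. (x 1 \<omega>, s 1 \<omega>)) (noise_family \<xi> \<zeta>) ?T)"
      using assms(2) by (simp add: past_def)
    have f: "?f \<in> measurable ?V (PiM S (\<lambda>_. borel))"
      by (rule measurable_vimage_algebra1) (auto simp: space_PiM)
    have "N \<in> borel_measurable ?V"
    proof (rule borel_measurable_rows)
      fix i
      obtain j where j: "j \<in> S" "(\<lambda>\<omega>. N \<omega> $ i) = noise_family \<xi> \<zeta> j" using N by blast
      have "(\<lambda>\<omega>. ?f \<omega> j) \<in> borel_measurable ?V"
        by (rule measurable_compose[OF f measurable_component_singleton[OF j(1)]])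
      then show "(\<lambda>\<omega>. N \<omega> $ i) \<in> borel_measurable ?V"
        using j by simp
    qed
    then show "(\<lambda>\<omega>. T (N \<omega>)) \<in> borel_measurable ?V"
      by (rule borel_measurable_continuous_on[OF linear_continuous_on[OF assms(3)]])
  qed
  show "indep_var borel P borel (\<lambda>\<omega>. T (\<xi> k \<omega>))"
    using assms(1) by (intro gen[of "Inl ` (UNIV \<times> {k})"]) (auto simp: noise_index_def noise_family_def[abs_def])
  show "indep_var borel P borel (\<lambda>\<omega>. T (\<zeta> (Suc k) \<omega>))"
    by (intro gen[of "Inr ` (UNIV \<times> {Suc k})"]) (auto simp: noise_index_def noise_family_def[abs_def])
qed

lemma noise_linear_mean:
  assumes "k \<ge> 1" "bounded_linear T"
  shows "expectation (\<lambda>\<omega>. T (\<xi> k \<omega>)) = 0" "expectation (\<lambda>\<omega>. T (\<zeta> k \<omega>)) = 0"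
proof -
  have "expectation (\<lambda>\<omega>. T (N \<omega>)) = 0"
    if "sq_integrable M N" "\<And>i. expectation (\<lambda>\<omega>. N \<omega> $ i) = 0" for N :: "'a \<Rightarrow> real^'d^'n"
  proof -
    have int: "integrable M N" using that(1) by (rule sq_integrable_integrable)
    have "expectation N = 0"
      using that(2) integral_bounded_linear[OF bounded_linear_vec_nth int] by (simp add: vec_eq_iff)
    then show ?thesis
      using integral_bounded_linear[OF assms(2) int] by (simp add: linear_simps(3)[OF assms(2)])
  qed
  then show "expectation (\<lambda>\<omega>. T (\<xi> k \<omega>)) = 0" "expectation (\<lambda>\<omega>. T (\<zeta> k \<omega>)) = 0"
    using noise_sq_integrable[OF assms(1)] \<xi>_mean[OF assms(1)] \<zeta>_mean[OF assms(1)] by blast+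
qed

text \<open>The constant depends on \<open>T\<close> only and so serves all times at once.\<close>

lemma expectation_sq_linear_le:
  fixes T :: "'v::euclidean_space \<Rightarrow> 'w::euclidean_space"
  assumes "bounded_linear T"
  shows "\<exists>B\<ge>0. \<forall>X. sq_integrable M X \<longrightarrow>
    expectation (\<lambda>\<omega>. (norm (T (X \<omega>)))\<^sup>2) \<le> B * expectation (\<lambda>\<omega>. (norm (X \<omega>))\<^sup>2)"
proof -
  obtain K where K: "\<And>x. norm (T x) \<le> norm x * K"
    using bounded_linear.bounded[OF assms] by blast
  have "expectation (\<lambda>\<omega>. (norm (T (X \<omega>)))\<^sup>2) \<le> K\<^sup>2 * expectation (\<lambda>\<omega>. (norm (X \<omega>))\<^sup>2)"
    if "sq_integrable M X" for X
  proof -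
    have "(norm (T y))\<^sup>2 \<le> K\<^sup>2 * (norm y)\<^sup>2" for y
      using power_mono[OF K[of y], of 2] by (simp add: power_mult_distrib mult.commute)
    then have "expectation (\<lambda>\<omega>. (norm (T (X \<omega>)))\<^sup>2) \<le> expectation (\<lambda>\<omega>. K\<^sup>2 * (norm (X \<omega>))\<^sup>2)"
      using that sq_integrable_linear[OF assms that]
      by (intro integral_mono) (auto simp: sq_integrable_def)
    then show ?thesis by simp
  qed
  then show ?thesis by (intro exI[of _ "K\<^sup>2"]) auto
qed

lemma noise_linear_second_moment:
  fixes T :: "real^'d^'n \<Rightarrow> 'w::euclidean_space"
  assumes "bounded_linear T"
  shows "\<exists>B\<ge>0. \<forall>k\<ge>1. expectation (\<lambda>\<omega>. (norm (T (\<xi> k \<omega>)))\<^sup>2) \<le> B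
    \<and> expectation (\<lambda>\<omega>. (norm (T (\<zeta> k \<omega>)))\<^sup>2) \<le> B"
proof -
  obtain B where B: "B \<ge> 0" "\<And>X. sq_integrable M X \<Longrightarrow>
    expectation (\<lambda>\<omega>. (norm (T (X \<omega>)))\<^sup>2) \<le> B * expectation (\<lambda>\<omega>. (norm (X \<omega>))\<^sup>2)"
    using expectation_sq_linear_le[OF assms] by blast
  have "expectation (\<lambda>\<omega>. (norm (\<xi> k \<omega>))\<^sup>2) \<le> real CARD('n) * \<sigma>\<^sup>2"
    "expectation (\<lambda>\<omega>. (norm (\<zeta> k \<omega>))\<^sup>2) \<le> real CARD('n) * \<sigma>\<^sup>2" if "k \<ge> 1" for k
    using \<xi>_var[OF that] \<zeta>_var[OF that]
      sum_bounded_above[of UNIV "\<lambda>i. expectation (\<lambda>\<omega>. (norm (\<xi> k \<omega> $ i))\<^sup>2)" "\<sigma>\<^sup>2"]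
      sum_bounded_above[of UNIV "\<lambda>i. expectation (\<lambda>\<omega>. (norm (\<zeta> k \<omega> $ i))\<^sup>2)" "\<sigma>\<^sup>2"]
    by (simp_all add: norm_matrix_sq Bochner_Integration.integral_sum)
  then have "expectation (\<lambda>\<omega>. (norm (T (\<xi> k \<omega>)))\<^sup>2) \<le> B * (real CARD('n) * \<sigma>\<^sup>2)"
    "expectation (\<lambda>\<omega>. (norm (T (\<zeta> k \<omega>)))\<^sup>2) \<le> B * (real CARD('n) * \<sigma>\<^sup>2)" if "k \<ge> 1" for k
    using B noise_sq_integrable[OF that] that by (meson mult_left_mono order_trans)+
  then show ?thesis using B(1) by (intro exI[of _ "B * (real CARD('n) * \<sigma>\<^sup>2)"]) auto
qed

end

subsection \<open>Decay rates\<close>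

lemma divide_powr_antimono:
  fixes A p q :: real
  assumes "k \<ge> (1::nat)" "p \<le> q" "0 \<le> A"
  shows "A / real k powr q \<le> A / real k powr p"
  using assms by (intro divide_left_mono powr_mono mult_pos_pos) auto

context vra_gt_random
begin

lemma mixing_err_sq_integrable: "k \<ge> 1 \<Longrightarrow> sq_integrable M (mixing_err k)"
  using sq_integrable_diff[OF iterates_sq_integrable(4) sq_integrable_scaleR[OF iterates_sq_integrable(3), of _ \<gamma>], of k k]
  by (simp add: tracking_noise_def)

text \<open>The new noise is centred and independent of the current error, so it contributes at most
  \<open>(\<eta>s k)\<^sup>2 * B\<close> and no cross term; against a contraction by
  \<open>\<eta>s k\<close> this leaves an error of order \<open>\<eta>s k\<close>.\<close>

lemma sharing_err_rate:
  "\<exists>D>0. \<forall>k\<ge>1. expectation (\<lambda>\<omega>. (norm (sharing_err k \<omega>))\<^sup>2) \<le> D / real k powr \<eta>"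
proof -
  obtain B where B: "B \<ge> 0" "\<And>k. k \<ge> 1 \<Longrightarrow> expectation (\<lambda>\<omega>. (norm (NC ** \<zeta> k \<omega>))\<^sup>2) \<le> B"
    using noise_linear_second_moment[OF bounded_linear_matrix_mult[of NC]] by blast
  show ?thesis
  proof (rule chung_rate[where K = 1 and c = a1 and a = \<eta> and b = "a1\<^sup>2 * B"])
    fix k :: nat assume k: "k \<ge> 1"
    let ?e = "sharing_err k" and ?N = "\<lambda>\<omega>. NC ** \<zeta> (Suc k) \<omega>"
    have lin: "bounded_linear (\<lambda>X. \<eta>s k *\<^sub>R (NC ** (X :: real^'d^'n)))"
      by (intro bounded_linear_compose[OF bounded_linear_scaleR_right] bounded_linear_matrix_mult)
    have e: "sq_integrable M (\<lambda>\<omega>. (1 - \<eta>s k) *\<^sub>R ?e \<omega>)" "sq_integrable M (\<lambda>\<omega>. \<eta>s k *\<^sub>R ?N \<omega>)"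
      using iterates_sq_integrable(3)[OF k] noise_sq_integrable(2)[of "Suc k"]
      by (auto intro: sq_integrable_scaleR sq_integrable_linear[OF lin])
    have m: "(\<lambda>\<omega>. (1 - \<eta>s k) *\<^sub>R ?e \<omega>) \<in> borel_measurable (past k)"
      using iterates_past_measurable(3)[OF k] by measurable
    have "expectation (\<lambda>\<omega>. (norm (sharing_err (Suc k) \<omega>))\<^sup>2)
        = expectation (\<lambda>\<omega>. (norm ((1 - \<eta>s k) *\<^sub>R ?e \<omega> + \<eta>s k *\<^sub>R ?N \<omega>))\<^sup>2)"
      by (intro Bochner_Integration.integral_cong) (auto simp: sharing_err_Suc[OF _ k])
    also have "\<dots> = expectation (\<lambda>\<omega>. (norm ((1 - \<eta>s k) *\<^sub>R ?e \<omega>))\<^sup>2) + expectation (\<lambda>\<omega>. (norm (\<eta>s k *\<^sub>R ?N \<omega>))\<^sup>2)"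
      by (rule expectation_norm_add_sq_indep[OF noise_indep_past(2)[OF k m lin] e])
        (rule noise_linear_mean(2)[OF _ lin], simp)
    also have "\<dots> = (1 - \<eta>s k)\<^sup>2 * expectation (\<lambda>\<omega>. (norm (?e \<omega>))\<^sup>2) + (\<eta>s k)\<^sup>2 * expectation (\<lambda>\<omega>. (norm (?N \<omega>))\<^sup>2)"
      by (simp add: power_mult_distrib)
    also have "\<dots> \<le> (1 - \<eta>s k) * expectation (\<lambda>\<omega>. (norm (?e \<omega>))\<^sup>2) + (\<eta>s k)\<^sup>2 * B"
    proof (intro add_mono mult_right_mono mult_left_mono B)
      show "(1 - \<eta>s k)\<^sup>2 \<le> 1 - \<eta>s k"
        using step_size_pos[OF k] mult_left_le[of "1 - \<eta>s k" "1 - \<eta>s k"] by (simp add: power2_eq_square)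
    qed (auto intro: Bochner_Integration.integral_nonneg)
    also have "(\<eta>s k)\<^sup>2 * B = a1\<^sup>2 * B / real k powr (\<eta> + \<eta>)"
      using k by (simp add: \<eta>s power2_eq_square flip: powr_add)
    finally show "expectation (\<lambda>\<omega>. (norm (sharing_err (Suc k) \<omega>))\<^sup>2)
        \<le> (1 - a1 / real k powr \<eta>) * expectation (\<lambda>\<omega>. (norm (sharing_err k \<omega>))\<^sup>2) + a1\<^sup>2 * B / real k powr (\<eta> + \<eta>)"
      using k by (simp add: \<eta>s)
  qed (use a_range exps B in auto)
qed

lemma mixing_err_contraction:
  assumes "\<omega> \<in> space M" "k \<ge> 1"
  shows "norm (Chat ** mixing_err (Suc k) \<omega>) \<le> (1 - \<gamma> * \<rho>C) * norm (Chat ** mixing_err k \<omega>)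
    + norm (Chat ** (\<gamma> *\<^sub>R (mix \<gamma> C ** sharing_err k \<omega> - sharing_err k \<omega>)))"
proof -
  let ?m = "mixing_err k \<omega>"
  let ?A = "mix \<gamma> C - (1 / real CARD('n)) *\<^sub>R outer v 1"
  have "dev v 1 (mix \<gamma> C ** ?m) = ?A ** dev v 1 ?m"
    using v_sum C_stoch v_eig
    by (intro dev_mult) (auto simp: inner_commute mix_right_eigenvector mix_left_eigenvector)
  then have "mix \<gamma> C ** ?m = ?A ** ?m"
    by (simp add: dev_def wavg_mix_C wavg_mixing_err[OF assms] matrix_mult_linear_simps)
  then have "Chat ** mixing_err (Suc k) \<omega> = Chat ** (?A ** ?m)
      + Chat ** (\<gamma> *\<^sub>R (mix \<gamma> C ** sharing_err k \<omega> - sharing_err k \<omega>))"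
    by (simp only: mixing_err_Suc[OF assms] linear_simps(1)[OF bounded_linear_matrix_mult])
  then have "norm (Chat ** mixing_err (Suc k) \<omega>) \<le> norm (Chat ** (?A ** ?m))
      + norm (Chat ** (\<gamma> *\<^sub>R (mix \<gamma> C ** sharing_err k \<omega> - sharing_err k \<omega>)))"
    by (metis norm_triangle_ineq)
  moreover have "\<gamma> * \<rho>C \<le> 1" using \<gamma> rho_range by (auto intro: mult_le_one)
  then have "norm (Chat ** (?A ** ?m)) \<le> (1 - \<gamma> * \<rho>C) * norm (Chat ** ?m)"
    using C_contr by (intro norm_matrix_mult_le_wnorm_op[OF norm_inv(2)]) auto
  ultimately show ?thesis by linarith
qed

text \<open>Since the contraction factor is constant, this error inherits the rate of the sharing
  error that drives it; the estimate is pathwise.\<close>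

lemma mixing_err_rate:
  "\<exists>D>0. \<forall>k\<ge>1. expectation (\<lambda>\<omega>. (norm (Chat ** mixing_err k \<omega>))\<^sup>2) \<le> D / real k powr \<eta>"
proof -
  define T where "T X = Chat ** (\<gamma> *\<^sub>R (mix \<gamma> C ** X - X))" for X :: "real^'d^'n"
  have T: "bounded_linear T"
    unfolding T_def
    by (intro bounded_linear_compose[OF bounded_linear_matrix_mult] bounded_linear_compose[OF bounded_linear_scaleR_right]
        bounded_linear_sub bounded_linear_matrix_mult bounded_linear_ident)
  define t where "t = \<gamma> * \<rho>C"
  have t: "0 < t" "t \<le> 1" using \<gamma> rho_range by (auto simp: t_def intro: mult_le_one)
  obtain D where D: "D > 0" "\<And>k. k \<ge> 1 \<Longrightarrow> expectation (\<lambda>\<omega>. (norm (sharing_err k \<omega>))\<^sup>2) \<le> D / real k powr \<eta>"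
    using sharing_err_rate by blast
  obtain B where B: "B \<ge> 0" "\<And>X. sq_integrable M X \<Longrightarrow>
      expectation (\<lambda>\<omega>. (norm (T (X \<omega>)))\<^sup>2) \<le> B * expectation (\<lambda>\<omega>. (norm (X \<omega>))\<^sup>2)"
    using expectation_sq_linear_le[OF T] by blast
  show ?thesis
  \<comment> \<open>\<open>a = 0\<close> encodes the constant contraction, as
    \<open>k powr 0 = 1\<close> for positive \<open>k\<close>.\<close>
  proof (rule chung_rate[where K = 1 and c = t and a = 0 and b = "B * D / t"])
    fix k :: nat assume k: "k \<ge> 1"
    let ?m = "\<lambda>k \<omega>. (norm (Chat ** mixing_err k \<omega>))\<^sup>2"
    have m: "integrable M (?m k)" if "k \<ge> 1" for k
      using sq_integrable_linear[OF bounded_linear_matrix_mult mixing_err_sq_integrable[OF that]]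
      by (rule sq_integrableD(2))
    have e: "integrable M (\<lambda>\<omega>. (norm (T (sharing_err k \<omega>)))\<^sup>2)"
      using sq_integrable_linear[OF T iterates_sq_integrable(3)[OF k]] by (rule sq_integrableD(2))
    have "?m (Suc k) \<omega> \<le> (1 - t) * ?m k \<omega> + (norm (T (sharing_err k \<omega>)))\<^sup>2 / t" if "\<omega> \<in> space M" for \<omega>
      using mixing_err_contraction[OF that k] t by (intro square_affine_le) (auto simp: T_def t_def)
    then have "expectation (?m (Suc k)) \<le> expectation (\<lambda>\<omega>. (1 - t) * ?m k \<omega> + (norm (T (sharing_err k \<omega>)))\<^sup>2 / t)"
      using m[of "Suc k"] m[OF k] e by (intro integral_mono) auto
    also have "\<dots> = (1 - t) * expectation (?m k) + expectation (\<lambda>\<omega>. (norm (T (sharing_err k \<omega>)))\<^sup>2) / t"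
      using m[OF k] e by simp
    also have "expectation (\<lambda>\<omega>. (norm (T (sharing_err k \<omega>)))\<^sup>2) \<le> B * (D / real k powr \<eta>)"
      using B(2)[OF iterates_sq_integrable(3)[OF k]] mult_left_mono[OF D(2)[OF k] B(1)] by linarith
    finally show "expectation (?m (Suc k)) \<le> (1 - t / real k powr 0) * expectation (?m k) + B * D / t / real k powr (0 + \<eta>)"
      using k t by (simp add: divide_right_mono field_simps)
  qed (use t B D exps in auto)
qed

lemma tracking_noise_rate:
  "\<exists>D>0. \<forall>k\<ge>1. expectation (\<lambda>\<omega>. (norm (tracking_noise k \<omega>))\<^sup>2) \<le> D / real k powr \<eta>"
proof -
  obtain H' where H': "H' ** Chat = mat 1" using norm_inv(2) unfolding invertible_def by blast
  obtain B where B: "B \<ge> 0" "\<And>X :: 'a \<Rightarrow> real^'d^'n. sq_integrable M X \<Longrightarrow>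
      expectation (\<lambda>\<omega>. (norm (H' ** X \<omega>))\<^sup>2) \<le> B * expectation (\<lambda>\<omega>. (norm (X \<omega>))\<^sup>2)"
    using expectation_sq_linear_le[OF bounded_linear_matrix_mult[of H']] by blast
  obtain D where D: "D > 0" "\<And>k. k \<ge> 1 \<Longrightarrow> expectation (\<lambda>\<omega>. (norm (sharing_err k \<omega>))\<^sup>2) \<le> D / real k powr \<eta>"
    using sharing_err_rate by blast
  obtain E where E: "E > 0" "\<And>k. k \<ge> 1 \<Longrightarrow> expectation (\<lambda>\<omega>. (norm (Chat ** mixing_err k \<omega>))\<^sup>2) \<le> E / real k powr \<eta>"
    using mixing_err_rate by blast
  have "expectation (\<lambda>\<omega>. (norm (tracking_noise k \<omega>))\<^sup>2) \<le> (2 * B * E + 2 * \<gamma>\<^sup>2 * D) / real k powr \<eta>" if k: "k \<ge> 1" for k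
  proof -
    have "expectation (\<lambda>\<omega>. (norm (mixing_err k \<omega>))\<^sup>2) = expectation (\<lambda>\<omega>. (norm (H' ** (Chat ** mixing_err k \<omega>)))\<^sup>2)"
      by (simp add: matrix_mul_assoc H')
    also have "\<dots> \<le> B * expectation (\<lambda>\<omega>. (norm (Chat ** mixing_err k \<omega>))\<^sup>2)"
      by (intro B sq_integrable_linear[OF bounded_linear_matrix_mult] mixing_err_sq_integrable k)
    also have "\<dots> \<le> B * (E / real k powr \<eta>)" using B E k by (intro mult_left_mono) auto
    finally have m: "expectation (\<lambda>\<omega>. (norm (mixing_err k \<omega>))\<^sup>2) \<le> B * (E / real k powr \<eta>)" .
    have "expectation (\<lambda>\<omega>. (norm (tracking_noise k \<omega>))\<^sup>2)
        \<le> expectation (\<lambda>\<omega>. 2 * (norm (mixing_err k \<omega>))\<^sup>2 + 2 * (norm (\<gamma> *\<^sub>R sharing_err k \<omega>))\<^sup>2)"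
      using sq_integrableD(2)[OF iterates_sq_integrable(4)[OF k]] sq_integrableD(2)[OF mixing_err_sq_integrable[OF k]]
        sq_integrableD(2)[OF sq_integrable_scaleR[OF iterates_sq_integrable(3)[OF k]], of \<gamma>]
      by (intro integral_mono) (auto simp: tracking_noise_def norm_add_sq_le simp del: norm_scaleR)
    also have "\<dots> = 2 * expectation (\<lambda>\<omega>. (norm (mixing_err k \<omega>))\<^sup>2) + 2 * \<gamma>\<^sup>2 * expectation (\<lambda>\<omega>. (norm (sharing_err k \<omega>))\<^sup>2)"
      using sq_integrableD(2)[OF mixing_err_sq_integrable[OF k]] sq_integrableD(2)[OF iterates_sq_integrable(3)[OF k]]
      by (simp add: power_mult_distrib)
    also have "\<dots> \<le> 2 * (B * (E / real k powr \<eta>)) + 2 * \<gamma>\<^sup>2 * (D / real k powr \<eta>)"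
      using m D k by (intro add_mono mult_left_mono) auto
    finally show ?thesis by (simp add: add_divide_distrib mult.assoc)
  qed
  moreover have "0 < 2 * B * E + 2 * \<gamma>\<^sup>2 * D" using B E D \<gamma> by (intro add_nonneg_pos) auto
  ultimately show ?thesis by blast
qed

section \<open>The Lyapunov function in expectation\<close>

definition lyapunov :: "nat \<Rightarrow> 'a \<Rightarrow> real" where
  "lyapunov k \<omega> = (norm (Chat ** dev v 1 (y' k \<omega>)))\<^sup>2 + (norm (Rhat ** dev 1 u (x k \<omega>)))\<^sup>2
     + (norm (wavg u (x k \<omega>) - xstar))\<^sup>2"

lemma bounded_linear_mult_dev: "bounded_linear (\<lambda>X :: real^'d^'n. H ** dev a b X)"
  by (intro bounded_linear_compose[OF bounded_linear_matrix_mult] bounded_linear_dev)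

lemma sq_integrable_errors:
  assumes "sq_integrable M X"
  shows "sq_integrable M (\<lambda>\<omega>. Chat ** dev v 1 (X \<omega>))" "sq_integrable M (\<lambda>\<omega>. Rhat ** dev 1 u (X \<omega>))"
    "sq_integrable M (\<lambda>\<omega>. wavg u (X \<omega>) - xstar)"
  using assms
  by (auto intro!: sq_integrable_linear[OF bounded_linear_mult_dev] sq_integrable_diff sq_integrable_const
      sq_integrable_linear[OF bounded_linear_wavg])

lemma lyapunov_integrable: "k \<ge> 1 \<Longrightarrow> integrable M (lyapunov k)"
  unfolding lyapunov_def[abs_def]
  by (intro Bochner_Integration.integrable_add sq_integrableD(2) sq_integrable_errors iterates_sq_integrable)

text \<open>Consensus and optimality errors of \<open>x (Suc k)\<close> are affine in
  \<open>\<xi> k\<close>, which independence splits off at order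
  \<open>(\<beta>s k)\<^sup>2\<close>. The tracking error contains gradients at the noisy point and
  is bounded pointwise by \<open>one_step\<close>.\<close>

lemma lyapunov_recursion:
  "\<exists>c B D K. 0 < c \<and> c \<le> 1 \<and> 0 \<le> B \<and> 0 \<le> D \<and> (\<forall>k\<ge>K. k \<ge> 1 \<longrightarrow>
     expectation (lyapunov (Suc k)) \<le> (1 - \<alpha>s k * c) * expectation (lyapunov k)
       + B * \<alpha>s k / real k powr \<eta> + D * (\<beta>s k)\<^sup>2)"
proof -
  obtain c B \<epsilon> where c: "0 < c" "c \<le> 1" and B: "0 < B" and \<epsilon>: "0 < \<epsilon>"
    and step: "\<And>a b X Y D N. 0 < a \<Longrightarrow> a \<le> \<epsilon> * b \<Longrightarrow> 0 < b \<Longrightarrow> b \<le> \<epsilon> \<Longrightarrow>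
     wnorm_op Rhat (mix b R - (1 / real CARD('n)) *\<^sub>R outer 1 u) \<le> 1 - b * \<rho>R \<Longrightarrow>
     wavg 1 Y = wavg 1 (G X) \<Longrightarrow>
     (norm (Chat ** dev v 1 (mix \<gamma> C ** Y + G (mix b R ** X - a *\<^sub>R (Y + D) + b *\<^sub>R N) - G X)))\<^sup>2
     + (norm (Rhat ** dev 1 u (mix b R ** X - a *\<^sub>R (Y + D))))\<^sup>2
     + (norm (wavg u (mix b R ** X - a *\<^sub>R (Y + D)) - xstar))\<^sup>2
     \<le> (1 - a * c) * ((norm (Chat ** dev v 1 Y))\<^sup>2 + (norm (Rhat ** dev 1 u X))\<^sup>2 + (norm (wavg u X - xstar))\<^sup>2)
        + B * (a * (norm D)\<^sup>2 + b\<^sup>2 * (norm N)\<^sup>2)"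
    using one_step by blast
  obtain D where D: "D > 0" "\<And>k. k \<ge> 1 \<Longrightarrow> expectation (\<lambda>\<omega>. (norm (tracking_noise k \<omega>))\<^sup>2) \<le> D / real k powr \<eta>"
    using tracking_noise_rate by blast
  have lin1: "bounded_linear (\<lambda>X :: real^'d^'n. Rhat ** dev 1 u (NR ** X))"
    and lin2: "bounded_linear (\<lambda>X :: real^'d^'n. wavg u (NR ** X))"
    by (intro bounded_linear_compose[OF bounded_linear_mult_dev] bounded_linear_compose[OF bounded_linear_wavg]
        bounded_linear_matrix_mult)+
  obtain B1 where B1: "B1 \<ge> 0" "\<And>k. k \<ge> 1 \<Longrightarrow> expectation (\<lambda>\<omega>. (norm (Rhat ** dev 1 u (NR ** \<xi> k \<omega>)))\<^sup>2) \<le> B1"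
    using noise_linear_second_moment[OF lin1] by blast
  obtain B2 where B2: "B2 \<ge> 0" "\<And>k. k \<ge> 1 \<Longrightarrow> expectation (\<lambda>\<omega>. (norm (wavg u (NR ** \<xi> k \<omega>)))\<^sup>2) \<le> B2"
    using noise_linear_second_moment[OF lin2] by blast
  obtain B3 where B3: "B3 \<ge> 0" "\<And>k. k \<ge> 1 \<Longrightarrow> expectation (\<lambda>\<omega>. (norm (NR ** \<xi> k \<omega>))\<^sup>2) \<le> B3"
    using noise_linear_second_moment[OF bounded_linear_matrix_mult[of NR]] by blast
  \<comment> \<open>From some index on the step sizes meet the smallness conditions of
    \<open>one_step\<close>; the two sequences are the orders of
    \<open>\<alpha>s k / \<beta>s k\<close> and \<open>\<beta>s k\<close>.\<close>
  have "((\<lambda>k::nat. real k powr (\<beta> - \<alpha>)) \<longlonglongrightarrow> 0)" "((\<lambda>k::nat. real k powr (- \<beta>)) \<longlonglongrightarrow> 0)"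
    using exps by (real_asymp, real_asymp)
  then have "eventually (\<lambda>k::nat. real k powr (\<beta> - \<alpha>) < \<epsilon> * a2) at_top" "eventually (\<lambda>k::nat. real k powr (- \<beta>) < \<epsilon>) at_top"
    using \<epsilon> a_range by (auto intro!: order_tendstoD)
  then have "eventually (\<lambda>k::nat. real k powr (\<beta> - \<alpha>) < \<epsilon> * a2 \<and> real k powr (- \<beta>) < \<epsilon>) at_top"
    by (rule eventually_conj)
  then obtain K where K: "\<And>k. k \<ge> K \<Longrightarrow> real k powr (\<beta> - \<alpha>) < \<epsilon> * a2" "\<And>k. k \<ge> K \<Longrightarrow> real k powr (- \<beta>) < \<epsilon>"
    unfolding eventually_at_top_linorder by blast
  show ?thesis
  proof (rule exI[of _ c], rule exI[of _ "B * D"], rule exI[of _ "B * B3 + B1 + B2"], rule exI[of _ K],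
      intro conjI allI impI)
    fix k assume "K \<le> k" and k: "1 \<le> k"
    define a where "a = \<alpha>s k"
    define b where "b = \<beta>s k"
    have pos: "a > 0" "b > 0" using step_size_pos[OF k] by (auto simp: a_def b_def)
    have "a3 * real k powr (\<beta> - \<alpha>) \<le> 1 * (\<epsilon> * a2)"
      using a_range K(1)[OF \<open>K \<le> k\<close>] \<epsilon> by (intro mult_mono) auto
    then have ab: "a \<le> \<epsilon> * b"
      using k by (simp add: a_def b_def \<alpha>s \<beta>s powr_diff field_simps)
    have "a2 * real k powr (- \<beta>) \<le> 1 * \<epsilon>"
      using a_range K(2)[OF \<open>K \<le> k\<close>] \<epsilon> by (intro mult_mono) auto
    then have b\<epsilon>: "b \<le> \<epsilon>" using k by (simp add: b_def \<beta>s powr_minus field_simps)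
    \<comment> \<open>The next iterate before \<open>\<xi> k\<close> is added; it is measurable for
      the past, hence independent of that noise.\<close>
    define X0 where "X0 \<omega> = mix b R ** x k \<omega> - a *\<^sub>R (y' k \<omega> + tracking_noise k \<omega>)" for \<omega>
    have xS: "x (Suc k) \<omega> = X0 \<omega> + b *\<^sub>R (NR ** \<xi> k \<omega>)" if "\<omega> \<in> space M" for \<omega>
      by (simp add: X0_def a_def b_def x_Suc_s[OF that k] s_increment[OF that k])
    have X0: "sq_integrable M X0"
      unfolding X0_def[abs_def]
      by (intro sq_integrable_diff sq_integrable_scaleR sq_integrable_add iterates_sq_integrable k
          sq_integrable_linear[OF bounded_linear_matrix_mult])
    have "X0 \<in> borel_measurable (past k)"
    proof -
      have "(\<lambda>\<omega>. mix b R ** x k \<omega>) \<in> borel_measurable (past k)"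
        by (rule borel_measurable_continuous_on[OF linear_continuous_on[OF bounded_linear_matrix_mult]
              iterates_past_measurable(1)[OF k]])
      then show ?thesis
        unfolding X0_def[abs_def] using iterates_past_measurable[OF k] by measurable
    qed
    then have m1: "(\<lambda>\<omega>. Rhat ** dev 1 u (X0 \<omega>)) \<in> borel_measurable (past k)"
      and m2: "(\<lambda>\<omega>. wavg u (X0 \<omega>)) \<in> borel_measurable (past k)"
      by (auto intro: borel_measurable_continuous_on[OF linear_continuous_on[OF bounded_linear_mult_dev]]
          borel_measurable_continuous_on[OF linear_continuous_on[OF bounded_linear_wavg]])
    have m3: "(\<lambda>\<omega>. wavg u (X0 \<omega>) - xstar) \<in> borel_measurable (past k)" using m2 by measurable
    note \<xi>k = noise_sq_integrable(1)[OF k]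
    have lin1b: "bounded_linear (\<lambda>X :: real^'d^'n. b *\<^sub>R (Rhat ** dev 1 u (NR ** X)))"
      and lin2b: "bounded_linear (\<lambda>X :: real^'d^'n. b *\<^sub>R wavg u (NR ** X))"
      by (intro bounded_linear_compose[OF bounded_linear_scaleR_right] lin1 lin2)+
    have "expectation (\<lambda>\<omega>. (norm (Rhat ** dev 1 u (x (Suc k) \<omega>)))\<^sup>2)
        = expectation (\<lambda>\<omega>. (norm (Rhat ** dev 1 u (X0 \<omega>) + b *\<^sub>R (Rhat ** dev 1 u (NR ** \<xi> k \<omega>))))\<^sup>2)"
      by (intro Bochner_Integration.integral_cong) (auto simp: xS linear_simps[OF bounded_linear_mult_dev])
    also have "\<dots> = expectation (\<lambda>\<omega>. (norm (Rhat ** dev 1 u (X0 \<omega>)))\<^sup>2)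
        + expectation (\<lambda>\<omega>. (norm (b *\<^sub>R (Rhat ** dev 1 u (NR ** \<xi> k \<omega>))))\<^sup>2)"
      by (rule expectation_norm_add_sq_indep[OF noise_indep_past(1)[OF k m1 lin1b] sq_integrable_errors(2)[OF X0]
            sq_integrable_linear[OF lin1b \<xi>k] noise_linear_mean(1)[OF k lin1b]])
    also have "\<dots> \<le> expectation (\<lambda>\<omega>. (norm (Rhat ** dev 1 u (X0 \<omega>)))\<^sup>2) + b\<^sup>2 * B1"
      using B1(2)[OF k] by (simp add: power_mult_distrib mult_left_mono)
    finally have q: "expectation (\<lambda>\<omega>. (norm (Rhat ** dev 1 u (x (Suc k) \<omega>)))\<^sup>2)
        \<le> expectation (\<lambda>\<omega>. (norm (Rhat ** dev 1 u (X0 \<omega>)))\<^sup>2) + b\<^sup>2 * B1" .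
    have "expectation (\<lambda>\<omega>. (norm (wavg u (x (Suc k) \<omega>) - xstar))\<^sup>2)
        = expectation (\<lambda>\<omega>. (norm ((wavg u (X0 \<omega>) - xstar) + b *\<^sub>R wavg u (NR ** \<xi> k \<omega>)))\<^sup>2)"
      by (intro Bochner_Integration.integral_cong) (auto simp: xS linear_simps[OF bounded_linear_wavg] algebra_simps)
    also have "\<dots> = expectation (\<lambda>\<omega>. (norm (wavg u (X0 \<omega>) - xstar))\<^sup>2)
        + expectation (\<lambda>\<omega>. (norm (b *\<^sub>R wavg u (NR ** \<xi> k \<omega>)))\<^sup>2)"
      by (rule expectation_norm_add_sq_indep[OF noise_indep_past(1)[OF k m3 lin2b] sq_integrable_errors(3)[OF X0]
            sq_integrable_linear[OF lin2b \<xi>k] noise_linear_mean(1)[OF k lin2b]])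
    also have "\<dots> \<le> expectation (\<lambda>\<omega>. (norm (wavg u (X0 \<omega>) - xstar))\<^sup>2) + b\<^sup>2 * B2"
      using B2(2)[OF k] by (simp add: power_mult_distrib mult_left_mono)
    finally have r: "expectation (\<lambda>\<omega>. (norm (wavg u (x (Suc k) \<omega>) - xstar))\<^sup>2)
        \<le> expectation (\<lambda>\<omega>. (norm (wavg u (X0 \<omega>) - xstar))\<^sup>2) + b\<^sup>2 * B2" .
    have i1: "integrable M (\<lambda>\<omega>. (norm (Chat ** dev v 1 (y' (Suc k) \<omega>)))\<^sup>2)"
      and i2: "integrable M (\<lambda>\<omega>. (norm (Rhat ** dev 1 u (X0 \<omega>)))\<^sup>2)"
      and i3: "integrable M (\<lambda>\<omega>. (norm (wavg u (X0 \<omega>) - xstar))\<^sup>2)"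
      and i4: "integrable M (\<lambda>\<omega>. (norm (Rhat ** dev 1 u (x (Suc k) \<omega>)))\<^sup>2)"
      and i5: "integrable M (\<lambda>\<omega>. (norm (wavg u (x (Suc k) \<omega>) - xstar))\<^sup>2)"
      and i6: "integrable M (\<lambda>\<omega>. (norm (tracking_noise k \<omega>))\<^sup>2)"
      and i7: "integrable M (\<lambda>\<omega>. (norm (NR ** \<xi> k \<omega>))\<^sup>2)"
      by (intro sq_integrableD(2) sq_integrable_errors X0 iterates_sq_integrable k
          sq_integrable_linear[OF bounded_linear_matrix_mult \<xi>k]; simp)+
    have pw: "(norm (Chat ** dev v 1 (y' (Suc k) \<omega>)))\<^sup>2 + (norm (Rhat ** dev 1 u (X0 \<omega>)))\<^sup>2 + (norm (wavg u (X0 \<omega>) - xstar))\<^sup>2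
      \<le> (1 - a * c) * lyapunov k \<omega> + B * (a * (norm (tracking_noise k \<omega>))\<^sup>2 + b\<^sup>2 * (norm (NR ** \<xi> k \<omega>))\<^sup>2)"
      if \<omega>: "\<omega> \<in> space M" for \<omega>
      using step[OF pos(1) ab pos(2) b\<epsilon> R_contr[OF k, folded b_def] wavg_y'[OF \<omega> k],
          of "tracking_noise k \<omega>" "NR ** \<xi> k \<omega>"]
      unfolding y'_Suc[OF \<omega> k] xS[OF \<omega>] lyapunov_def X0_def .
    have "expectation (lyapunov (Suc k)) = expectation (\<lambda>\<omega>. (norm (Chat ** dev v 1 (y' (Suc k) \<omega>)))\<^sup>2)
        + expectation (\<lambda>\<omega>. (norm (Rhat ** dev 1 u (x (Suc k) \<omega>)))\<^sup>2)
        + expectation (\<lambda>\<omega>. (norm (wavg u (x (Suc k) \<omega>) - xstar))\<^sup>2)"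
      unfolding lyapunov_def[abs_def] using i1 i4 i5 by simp
    also have "\<dots> \<le> expectation (\<lambda>\<omega>. (norm (Chat ** dev v 1 (y' (Suc k) \<omega>)))\<^sup>2)
        + expectation (\<lambda>\<omega>. (norm (Rhat ** dev 1 u (X0 \<omega>)))\<^sup>2) + expectation (\<lambda>\<omega>. (norm (wavg u (X0 \<omega>) - xstar))\<^sup>2)
        + b\<^sup>2 * (B1 + B2)"
      using q r by (simp add: distrib_left)
    also have "\<dots> = expectation (\<lambda>\<omega>. (norm (Chat ** dev v 1 (y' (Suc k) \<omega>)))\<^sup>2 + (norm (Rhat ** dev 1 u (X0 \<omega>)))\<^sup>2
        + (norm (wavg u (X0 \<omega>) - xstar))\<^sup>2) + b\<^sup>2 * (B1 + B2)"
      using i1 i2 i3 by simp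
    also have "\<dots> \<le> expectation (\<lambda>\<omega>. (1 - a * c) * lyapunov k \<omega>
        + B * (a * (norm (tracking_noise k \<omega>))\<^sup>2 + b\<^sup>2 * (norm (NR ** \<xi> k \<omega>))\<^sup>2)) + b\<^sup>2 * (B1 + B2)"
      using i1 i2 i3 i6 i7 lyapunov_integrable[OF k] pw
      by (intro add_right_mono integral_mono Bochner_Integration.integrable_add integrable_mult_right) auto
    also have "\<dots> = (1 - a * c) * expectation (lyapunov k) + B * (a * expectation (\<lambda>\<omega>. (norm (tracking_noise k \<omega>))\<^sup>2)
        + b\<^sup>2 * expectation (\<lambda>\<omega>. (norm (NR ** \<xi> k \<omega>))\<^sup>2)) + b\<^sup>2 * (B1 + B2)"
      using i6 i7 lyapunov_integrable[OF k] by simp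
    also have "\<dots> \<le> (1 - a * c) * expectation (lyapunov k) + B * (a * (D / real k powr \<eta>) + b\<^sup>2 * B3) + b\<^sup>2 * (B1 + B2)"
      using pos B D(2)[OF k] B3(2)[OF k] by (intro add_mono mult_left_mono order_refl) auto
    also have "\<dots> = (1 - \<alpha>s k * c) * expectation (lyapunov k) + B * D * \<alpha>s k / real k powr \<eta> + (B * B3 + B1 + B2) * (\<beta>s k)\<^sup>2"
      by (simp add: a_def b_def algebra_simps)
    finally show "expectation (lyapunov (Suc k)) \<le> (1 - \<alpha>s k * c) * expectation (lyapunov k)
        + B * D * \<alpha>s k / real k powr \<eta> + (B * B3 + B1 + B2) * (\<beta>s k)\<^sup>2" .
  qed (use c B D B1 B2 B3 in auto)
qed

text \<open>\<open>chung_rate\<close> asks for forcing exponents of at least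
  \<open>\<alpha> + \<theta>\<close>. For \<open>\<alpha> + \<eta>\<close> this holds because
  \<open>\<beta> < \<alpha>\<close> gives \<open>\<theta> \<le> \<eta>\<close>, and for
  \<open>2 * \<beta>\<close> because \<open>\<theta> \<le> 2 * \<beta> - \<alpha>\<close>.\<close>

lemma lyapunov_rate:
  "\<exists>D>0. \<forall>k\<ge>1. expectation (lyapunov k) \<le> D / real k powr (min (2 * \<beta> - \<alpha>) (\<beta> + \<eta> - \<alpha>))"
proof -
  define \<theta> where "\<theta> = min (2 * \<beta> - \<alpha>) (\<beta> + \<eta> - \<alpha>)"
  \<comment> \<open>Nonnegativity comes from \<beta> and \<eta> exceeding 1/2 while \<alpha> stays
    below 1.\<close>
  have \<theta>: "0 \<le> \<theta>" "\<alpha> + \<theta> \<le> \<alpha> + \<eta>" "\<alpha> + \<theta> \<le> \<beta> + \<beta>" using exps by (auto simp: \<theta>_def)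
  obtain c B D K where c: "0 < c" "c \<le> 1" and BD: "0 \<le> B" "0 \<le> D" and rec: "\<And>k. k \<ge> K \<Longrightarrow> k \<ge> 1 \<Longrightarrow>
     expectation (lyapunov (Suc k)) \<le> (1 - \<alpha>s k * c) * expectation (lyapunov k)
       + B * \<alpha>s k / real k powr \<eta> + D * (\<beta>s k)\<^sup>2"
    using lyapunov_recursion by blast
  show ?thesis
    unfolding \<theta>_def[symmetric]
  proof (rule chung_rate[where K = "max K 1" and c = "a3 * c" and a = \<alpha> and b = "B * a3 + D * a2\<^sup>2"])
    fix k assume "max K 1 \<le> k"
    then have k: "K \<le> k" "1 \<le> k" by auto
    have "B * \<alpha>s k / real k powr \<eta> = B * a3 / real k powr (\<alpha> + \<eta>)"
      using k by (simp add: \<alpha>s powr_add)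
    also have "\<dots> \<le> B * a3 / real k powr (\<alpha> + \<theta>)"
      using k BD a_range \<theta> by (intro divide_powr_antimono) auto
    finally have 1: "B * \<alpha>s k / real k powr \<eta> \<le> B * a3 / real k powr (\<alpha> + \<theta>)" .
    have "D * (\<beta>s k)\<^sup>2 = D * a2\<^sup>2 / real k powr (\<beta> + \<beta>)"
      using k by (simp add: \<beta>s power2_eq_square flip: powr_add)
    also have "\<dots> \<le> D * a2\<^sup>2 / real k powr (\<alpha> + \<theta>)"
      using k BD a_range \<theta> by (intro divide_powr_antimono) auto
    finally have 2: "D * (\<beta>s k)\<^sup>2 \<le> D * a2\<^sup>2 / real k powr (\<alpha> + \<theta>)" .
    have "\<alpha>s k * c = a3 * c / real k powr \<alpha>" using k by (simp add: \<alpha>s)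
    with rec[OF k] 1 2 show "expectation (lyapunov (Suc k)) \<le> (1 - a3 * c / real k powr \<alpha>) * expectation (lyapunov k)
        + (B * a3 + D * a2\<^sup>2) / real k powr (\<alpha> + \<theta>)"
      by (simp add: add_divide_distrib)
  qed (use c a_range exps \<theta> BD in \<open>auto intro: mult_le_one\<close>)
qed

end

section \<open>Transfer of the rate to the weighted norms and the shifted index\<close>

theorem theorem3:
  fixes M :: "'a measure"
    and f :: "'n::finite \<Rightarrow> real^'d::finite \<Rightarrow> real"
    and R C Rhat Chat :: "real^'n^'n"
    and u v :: "real^'n"
    and xstar :: "real^'d"
    and \<xi> \<zeta> x s z y' :: "nat \<Rightarrow> 'a \<Rightarrow> real^'d^'n"
    and \<alpha>s \<beta>s \<eta>s :: "nat \<Rightarrow> real"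
    and L \<mu> \<sigma> \<gamma> \<alpha> \<beta> \<eta> a1 a2 a3 \<rho>R \<rho>C :: real
  assumes M: "prob_space M"
    \<comment> \<open>objective functions\<close>
    and convex: "\<And>i. convex_on UNIV (f i)"
    and differentiable: "\<And>i p. f i differentiable (at p)"
    and smooth: "\<And>i p q. norm (grad (f i) p - grad (f i) q) \<le> L * norm (p - q)"
    and strong: "strongly_convex \<mu> (\<lambda>p. (\<Sum>j\<in>UNIV. f j p) / real CARD('n))"
    and minimizer: "\<And>p. (\<Sum>j\<in>UNIV. f j xstar) / real CARD('n)
                           \<le> (\<Sum>j\<in>UNIV. f j p) / real CARD('n)"
    \<comment> \<open>weight matrices and network\<close>
    and R_nonneg: "\<And>i j. 0 \<le> R $ i $ j" and R_stoch: "R *v 1 = 1"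
    and C_nonneg: "\<And>i j. 0 \<le> C $ i $ j" and C_stoch: "1 v* C = 1"
    and diag_pos: "\<And>i. 0 < R $ i $ i" "\<And>i. 0 < C $ i $ i"
    and spanning: "tree_roots R \<noteq> {}" "tree_roots (transpose C) \<noteq> {}"
    and common_root: "tree_roots R \<inter> tree_roots (transpose C) \<noteq> {}"
    and u_nonneg: "\<And>i. 0 \<le> u $ i" and u_eig: "u v* R = u"
    and v_nonneg: "\<And>i. 0 \<le> v $ i" and v_eig: "C *v v = v"
    and u_sum: "inner u 1 = real CARD('n)" and v_sum: "inner v 1 = real CARD('n)"
    and uv: "0 < inner u v"
    \<comment> \<open>step sizes\<close>
    and \<gamma>: "0 < \<gamma>" "\<gamma> < 1"
    and a_range: "a1 \<in> {0<..1}" "a2 \<in> {0<..1}" "a3 \<in> {0<..1}"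
    and exps: "\<eta> \<in> {1/2<..<1}" "\<alpha> \<in> {1/2<..<1}" "\<beta> \<in> {1/2<..<1}" "\<alpha> > (1 + \<beta>) / 2"
    and \<eta>s: "\<And>k. k \<ge> 1 \<Longrightarrow> \<eta>s k = a1 / real k powr \<eta>"
    and \<beta>s: "\<And>k. k \<ge> 1 \<Longrightarrow> \<beta>s k = a2 / real k powr \<beta>"
    and \<alpha>s: "\<And>k. k \<ge> 1 \<Longrightarrow> \<alpha>s k = a3 / real k powr \<alpha>"
    \<comment> \<open>weighted norms\<close>
    and norm_inv: "invertible Rhat" "invertible Chat"
    and rho_range: "\<rho>R \<in> {0<..1}" "\<rho>C \<in> {0<..1}"
    and C_contr: "wnorm_op Chat (mix \<gamma> C - (1 / real CARD('n)) *\<^sub>R outer v 1) < 1 - \<gamma> * \<rho>C"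
    and R_contr: "\<And>k. k \<ge> 1 \<Longrightarrow>
        wnorm_op Rhat (mix (\<beta>s k) R - (1 / real CARD('n)) *\<^sub>R outer 1 u) \<le> 1 - \<beta>s k * \<rho>R"
    \<comment> \<open>noise and initial values\<close>
    and indep: "independent_noise M \<xi> \<zeta> (x 1) (s 1)"
    and \<xi>_mean: "\<And>i k. k \<ge> 1 \<Longrightarrow> (\<integral>\<omega>. \<xi> k \<omega> $ i \<partial>M) = 0"
    and \<zeta>_mean: "\<And>i k. k \<ge> 1 \<Longrightarrow> (\<integral>\<omega>. \<zeta> k \<omega> $ i \<partial>M) = 0"
    and \<xi>_var: "\<And>i k. k \<ge> 1 \<Longrightarrow> integrable M (\<lambda>\<omega>. (norm (\<xi> k \<omega> $ i))\<^sup>2)"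
               "\<And>i k. k \<ge> 1 \<Longrightarrow> (\<integral>\<omega>. (norm (\<xi> k \<omega> $ i))\<^sup>2 \<partial>M) \<le> \<sigma>\<^sup>2"
    and \<zeta>_var: "\<And>i k. k \<ge> 1 \<Longrightarrow> integrable M (\<lambda>\<omega>. (norm (\<zeta> k \<omega> $ i))\<^sup>2)"
               "\<And>i k. k \<ge> 1 \<Longrightarrow> (\<integral>\<omega>. (norm (\<zeta> k \<omega> $ i))\<^sup>2 \<partial>M) \<le> \<sigma>\<^sup>2"
    and init_moments: "\<And>i. integrable M (\<lambda>\<omega>. (norm (x 1 \<omega> $ i))\<^sup>2)"
                      "\<And>i. integrable M (\<lambda>\<omega>. (norm (s 1 \<omega> $ i))\<^sup>2)"
    \<comment> \<open>iteration\<close>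
    and iteration: "\<And>\<omega>. \<omega> \<in> space M \<Longrightarrow>
        vra_gt f R C \<gamma> \<alpha>s \<beta>s \<eta>s (\<lambda>k. \<xi> k \<omega>) (\<lambda>k. \<zeta> k \<omega>) (\<lambda>k. x k \<omega>) (\<lambda>k. s k \<omega>) (\<lambda>k. z k \<omega>)"
    and tracker: "\<And>\<omega>. \<omega> \<in> space M \<Longrightarrow> aux_tracker f C \<gamma> (\<lambda>k. x k \<omega>) (\<lambda>k. y' k \<omega>)"
  shows "\<exists>cstar>0.
     let V = (\<lambda>k \<omega>.
           (wnorm_mat Chat (y' k \<omega> - outer v (wavg 1 (y' k \<omega>))))\<^sup>2
         + (wnorm_mat Rhat (x k \<omega> - outer 1 (wavg u (x k \<omega>))))\<^sup>2
         + cstar * (norm (wavg u (x k \<omega>) - xstar))\<^sup>2)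
     in \<exists>c>0. \<forall>k\<ge>1. integrable M (V (k+1)) \<and>
          (\<integral>\<omega>. V (k+1) \<omega> \<partial>M) \<le> c * (1 / real k powr min (2*\<beta> - \<alpha>) (\<beta> + \<eta> - \<alpha>))"
proof -
  interpret prob_space M by (rule M)
  \<comment> \<open>Because \<open>\<beta> < 1\<close>, the bound \<open>(1 + \<beta>) / 2\<close>
    lies above \<beta>.\<close>
  have "\<beta> < \<alpha>" using exps by auto
  interpret vra_gt_random f R C Rhat Chat u v xstar L \<mu> \<gamma> \<rho>R \<rho>C M \<xi> \<zeta> x s z y' \<alpha>s \<beta>s \<eta>s \<sigma> \<alpha> \<beta> \<eta> a1 a2 a3
    by unfold_locales (fact assms \<open>\<beta> < \<alpha>\<close>)+
  define \<theta> where "\<theta> = min (2 * \<beta> - \<alpha>) (\<beta> + \<eta> - \<alpha>)"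
  have \<theta>: "0 \<le> \<theta>" using exps by (auto simp: \<theta>_def)
  obtain D where D: "D > 0" "\<And>k. k \<ge> 1 \<Longrightarrow> expectation (lyapunov k) \<le> D / real k powr \<theta>"
    using lyapunov_rate unfolding \<theta>_def by blast
  have "expectation (lyapunov (k + 1)) \<le> D * (1 / real k powr \<theta>)" if "k \<ge> 1" for k
  proof -
    have "expectation (lyapunov (k + 1)) \<le> D / real (k + 1) powr \<theta>" by (rule D) simp
    \<comment> \<open>The bound at \<open>k + 1\<close> is weakened to the one at \<open>k\<close>,
      the exponent being nonnegative.\<close>
    also have "\<dots> \<le> D / real k powr \<theta>"
      using that \<theta> D by (intro divide_left_mono powr_mono2 mult_pos_pos) auto
    finally show ?thesis by simp
  qed
  moreover have "integrable M (lyapunov (k + 1))" for k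
    by (rule lyapunov_integrable) simp
  ultimately have "\<exists>c>0. \<forall>k\<ge>1. integrable M (lyapunov (k + 1)) \<and> expectation (lyapunov (k + 1)) \<le> c * (1 / real k powr \<theta>)"
    using D(1) by blast
  \<comment> \<open>The witness is \<open>cstar = 1\<close>, since \<open>lyapunov\<close> is the
    unweighted sum.\<close>
  then show ?thesis
    by (intro exI[of _ 1]) (simp add: Let_def lyapunov_def[abs_def] \<theta>_def wnorm_mat_eq_norm flip: dev_def)
qed

end
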